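(* Let $u\colon[0,T)\times\mathbb{R}^2\to\mathbb{R}^3$ be a smooth solution of $$-\partial_t^2u+\Delta u=2u_x\wedge u_y$$ with $u(0)=u_0$, $\partial_tu(0)=u_1$, such that $u(t,\cdot)$ has compact support for each $t\in[0,T)$. Suppose $$E(u_0,u_1)<E(W,0)=\frac{4\pi}{3}\quad\text{and}\quad\|\nabla u_0\|_{L^2}>\|\nabla W\|_{L^2}=\sqrt{8\pi}.$$ Then $T<\infty$; more precisely, $\|u(t)\|_{L^2(\mathbb{R}^2)}$ cannot remain finite on an infinite time interval.
   Context: $\wedge$ is the cross product in $\mathbb{R}^3$, $\Delta$ the Laplacian on $\mathbb{R}^2$ acting componentwise. $E(u_0,u_1)=\int_{\mathbb{R}^2}\frac12(|u_1|^2+|\nabla u_0|^2)+\frac23u_0\cdot((u_0)_x\wedge(u_0)_y)\,dx\,dy$. $W$ denotes a ground state of $\Delta u=2u_x\wedge u_y$: $W(z)=\pi(P(z)/Q(z))+c$ with $\pi$ the (inverse) stereographic projection $\mathbb{C}\cong\mathbb{R}^2\to\mathbb{S}^2\subset\mathbb{R}^3$, $P,Q$ polynomials with $\max\{\deg P,\deg Q\}=1$, $c\in\mathbb{R}^3$, $W$ non-constant. *)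

theory Defs
  imports "HOL-Analysis.Analysis"
begin

definition smooth_on :: "'a::euclidean_space set \<Rightarrow> ('a \<Rightarrow> 'b::real_normed_vector) \<Rightarrow> bool" where
  "smooth_on S f \<longleftrightarrow> (\<exists>F. f \<in> F \<and>
     (\<forall>g\<in>F. continuous_on S g \<and>
        (\<exists>D. (\<forall>x\<in>S. (g has_derivative D x) (at x within S)) \<and>
             (\<forall>b\<in>Basis. (\<lambda>x. D x b) \<in> F))))"

definition dx :: "(real \<times> real \<Rightarrow> real^3) \<Rightarrow> real \<times> real \<Rightarrow> real^3" where
  "dx f z = vector_derivative (\<lambda>a. f (a, snd z)) (at (fst z))"

definition dy :: "(real \<times> real \<Rightarrow> real^3) \<Rightarrow> real \<times> real \<Rightarrow> real^3" where
  "dy f z = vector_derivative (\<lambda>b. f (fst z, b)) (at (snd z))"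

definition energy :: "(real \<times> real \<Rightarrow> real^3) \<Rightarrow> (real \<times> real \<Rightarrow> real^3) \<Rightarrow> real" where
  "energy u0 u1 = integral UNIV (\<lambda>z.
      (1/2) * ((norm (u1 z))\<^sup>2 + (norm (dx u0 z))\<^sup>2 + (norm (dy u0 z))\<^sup>2)
      + (2/3) * (u0 z \<bullet> cross3 (dx u0 z) (dy u0 z)))"

definition grad_L2 :: "(real \<times> real \<Rightarrow> real^3) \<Rightarrow> real" where
  "grad_L2 u0 = sqrt (integral UNIV (\<lambda>z. (norm (dx u0 z))\<^sup>2 + (norm (dy u0 z))\<^sup>2))"

end

(* Write G for the Dirichlet energy of u(t), A for the square of the norm of its time derivative, V for the
   integral of u . (u_x x u_y), and y for the square of the L2 norm of u(t). Then E = (A + G)/2 + 2V/3 is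
   conserved and y'' = 5A + G - 6E. The sharp isoperimetric inequality |V| <= (G^3 / (32 pi))^(1/2) shows
   that E >= 4 pi/3 whenever G = 8 pi, so by continuity G > 8 pi for all times. Hence y'' >= 5A + (8 pi - 6E)
   with 8 pi - 6E > 0, and as y'^2 <= 4yA the positive function y^(-1/4) is eventually concave and strictly
   decreasing, which is impossible on an infinite time interval.

   The isoperimetric inequality for maps u of the plane into space, without any minimal surface theory: the
   winding number g of u around the points of space satisfies int g = -V/3 and has total variation at most
   int |u_x x u_y| <= G/2. As g is integer valued, |int g| <= int |g|^(3/2), and the Sobolev inequality for
   functions of bounded variation, with its sharp constant from the Brunn-Minkowski inequality, bounds the
   right hand side. To avoid functions of bounded variation, g is mollified by spline kernels; Sard's
   theorem and the change of variables formula show that the mollifications tend to integers. *)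

theory Submission
  imports Defs
begin

subsection \<open>The Brunn-Minkowski inequality and the sharp Sobolev inequality\<close>

text \<open>The constants leave no room, because the hypotheses compare u with the ground state. For
  a conformal parametrisation of the unit sphere G = 8 pi, |V| = 4 pi, g is up to sign the indicator
  of the unit ball, and every inequality of the chain is an equality; 3/2 is the exponent that goes
  with L1 gradients in dimension 3. With G = 8 pi and A >= 0 the bound |V| <= 4 pi gives E >= 4 pi -
  8 pi/3 = 4 pi/3. The exponent 1/4 comes from y y'' >= 5 y A >= (5/4) y'^2 and (y^(-a))'' = a
  y^(-a-2) ((a+1) y'^2 - y y''): it is the largest a for which this yields concavity. A mollified g
  need not be integer valued, so |g| <= |g|^(3/2) can fail for it; only the failure tends to 0 with
  the scale of the kernels. The supports at different times are not assumed to lie in a common ball,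
  while differentiating integrals over the plane and discarding boundary terms require one; finite
  speed of propagation supplies it.\<close>

lemma bounded_borel_lmeasurable:
  fixes A :: "'a::euclidean_space set"
  assumes "A \<in> sets borel" "bounded A"
  shows "A \<in> lmeasurable"
  using assms by (simp add: bounded_set_imp_lmeasurable)

lemma measure_lborel_mono:
  fixes A B :: "'a::euclidean_space set"
  assumes "A \<in> sets borel" "B \<in> sets borel" "bounded B" "A \<subseteq> B"
  shows "measure lborel A \<le> measure lborel B"
proof (rule measure_mono_fmeasurable)
  show "B \<in> fmeasurable lborel"
    using assms emeasure_bounded_finite[of B] by (auto simp: fmeasurable_def)
qed (use assms in auto)

text \<open>Brunn-Minkowski on the line. For compact K in A and L in B, with M the maximum of K and
  m the minimum of L, the translates m + K and M + L both lie in K + L and meet only in m + M. The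
  set C stands in for A + B, which need not be Borel.\<close>

lemma measure_sumset_real:
  fixes A B C :: "real set"
  assumes A: "A \<in> sets borel" "bounded A" "A \<noteq> {}"
    and B: "B \<in> sets borel" "bounded B" "B \<noteq> {}"
    and C: "C \<in> sets borel" "bounded C"
    and sub: "\<And>x y. x \<in> A \<Longrightarrow> y \<in> B \<Longrightarrow> x + y \<in> C"
  shows "measure lborel A + measure lborel B \<le> measure lborel C"
proof (rule field_le_epsilon)
  fix e :: real assume "e > 0"
  have inner: "\<exists>K. compact K \<and> K \<noteq> {} \<and> K \<subseteq> D \<and> measure lborel D \<le> measure lborel K + e/2"
    if D: "D \<in> sets borel" "bounded D" "D \<noteq> {}" for D :: "real set"
  proof -
    have Dl: "D \<in> lmeasurable" using D by (simp add: bounded_borel_lmeasurable)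
    obtain K where K: "closed K" "K \<subseteq> D" "D - K \<in> lmeasurable" "emeasure lebesgue (D - K) < ennreal (e/2)"
      using sets_lebesgue_inner_closed[of D "e/2"] D \<open>e > 0\<close> by auto
    obtain d where d: "d \<in> D" using D by auto
    \<comment> \<open>Adjoining the point d keeps the compact set nonempty, so that its maximum and
      minimum exist.\<close>
    have cK: "compact (insert d K)"
      using K D by (meson bounded_subset compact_eq_bounded_closed compact_insert)
    have KD: "insert d K \<subseteq> D" using K d by auto
    have Kb: "insert d K \<in> sets borel" using cK by (rule borel_compact)
    have "measure lborel (D - insert d K) \<le> e/2"
    proof -
      have "measure lborel (D - insert d K) \<le> measure lborel (D - K)"
        by (rule measure_lborel_mono) (use D K Kb in \<open>auto intro: bounded_subset\<close>)
      also have "\<dots> = measure lebesgue (D - K)"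
        using K D by (simp add: measure_completion)
      also have "\<dots> \<le> e/2"
        using K(4) \<open>e > 0\<close> unfolding measure_def
        by (metis K(3) enn2real_mono ennreal_enn2real fmeasurableD2 less_eq_real_def ennreal_less_top enn2real_ennreal half_gt_zero order_less_imp_le)
      finally show ?thesis .
    qed
    moreover have "measure lborel (D - insert d K) = measure lborel D - measure lborel (insert d K)"
      by (rule measure_Diff) (use D KD Kb emeasure_bounded_finite[of D] in auto)
    ultimately show ?thesis using cK KD by (intro exI[of _ "insert d K"]) auto
  qed
  obtain K where K: "compact K" "K \<noteq> {}" "K \<subseteq> A" "measure lborel A \<le> measure lborel K + e/2"
    using inner[OF A] by blast
  obtain L where L: "compact L" "L \<noteq> {}" "L \<subseteq> B" "measure lborel B \<le> measure lborel L + e/2"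
    using inner[OF B] by blast
  obtain M where M: "M \<in> K" "\<And>x. x \<in> K \<Longrightarrow> x \<le> M"
    using compact_attains_sup[OF K(1,2)] by blast
  obtain m where m: "m \<in> L" "\<And>x. x \<in> L \<Longrightarrow> m \<le> x"
    using compact_attains_inf[OF L(1,2)] by blast
  have cK': "compact ((+) m ` K)" and cL': "compact ((+) M ` L)"
    using K L by (auto intro!: compact_translation)
  have "measure lborel K = measure lborel ((+) m ` K)"
    using measure_translation[of m K] cK' K(1) by (simp add: measure_completion borel_compact)
  moreover have "measure lborel L = measure lborel ((+) M ` L)"
    using measure_translation[of M L] cL' L(1) by (simp add: measure_completion borel_compact)
  moreover have "measure lborel ((+) m ` K \<union> (+) M ` L) = measure lborel ((+) m ` K) + measure lborel ((+) M ` L)"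
  proof -
    have "(+) m ` K \<inter> (+) M ` L \<subseteq> {m + M}"
    proof
      fix x assume "x \<in> (+) m ` K \<inter> (+) M ` L"
      then obtain k l where kl: "k \<in> K" "l \<in> L" "x = m + k" "x = M + l" by auto
      then show "x \<in> {m + M}" using M(2)[OF kl(1)] m(2)[OF kl(2)] by auto
    qed
    then have "(+) m ` K \<inter> (+) M ` L \<in> null_sets lborel"
      by (meson countable_finite countable_imp_null_set_lborel finite.emptyI finite.insertI finite_subset)
    then show ?thesis
      using cK' cL' emeasure_bounded_finite[OF compact_imp_bounded[OF cK']] emeasure_bounded_finite[OF compact_imp_bounded[OF cL']]
      by (subst measure_Un3) (auto simp: fmeasurable_def null_sets_def measure_def borel_compact)
  qed
  moreover have "measure lborel ((+) m ` K \<union> (+) M ` L) \<le> measure lborel C"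
  proof (rule measure_lborel_mono)
    show "(+) m ` K \<union> (+) M ` L \<subseteq> C"
      using sub K(3) L(3) M(1) m(1) by (force simp: add.commute)
  qed (use cK' cL' C in \<open>auto simp: borel_compact\<close>)
  ultimately show "measure lborel A + measure lborel B \<le> measure lborel C + e"
    using K(4) L(4) by linarith
qed

text \<open>Tonelli on the region 0 < t < F x. \<open>ennreal\<close> cuts F off at 0, and the
  indicator of positive t does the same on the right, so F may change sign.\<close>

lemma nn_integral_layer_cake:
  fixes F :: "'a::euclidean_space \<Rightarrow> real"
  assumes [measurable]: "F \<in> borel_measurable borel"
  shows "(\<integral>\<^sup>+x. ennreal (F x) \<partial>lborel) = (\<integral>\<^sup>+t. indicator {0<..} t * emeasure lborel {x. F x > t} \<partial>lborel)"
proof -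
  have "(\<integral>\<^sup>+x. ennreal (F x) \<partial>lborel) = (\<integral>\<^sup>+x. (\<integral>\<^sup>+t. indicator {0<..<F x} t \<partial>lborel) \<partial>(lborel::'a measure))"
  proof (rule nn_integral_cong)
    fix x
    show "ennreal (F x) = (\<integral>\<^sup>+t. indicator {0<..<F x} t \<partial>lborel)"
      by (cases "0 \<le> F x") (auto simp: ennreal_neg)
  qed
  also have "\<dots> = (\<integral>\<^sup>+x. (\<integral>\<^sup>+t. indicator {0<..} t * indicator {p. snd p < F (fst p)} (x, t) \<partial>lborel) \<partial>(lborel::'a measure))"
    by (intro nn_integral_cong) (auto simp: indicator_def)
  also have "\<dots> = (\<integral>\<^sup>+t. (\<integral>\<^sup>+x. indicator {0<..} t * indicator {p. snd p < F (fst p)} (x, t) \<partial>(lborel::'a measure)) \<partial>lborel)"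
    by (rule lborel_pair.Fubini'[symmetric]) measurable
  also have "\<dots> = (\<integral>\<^sup>+t. indicator {0<..} t * emeasure lborel {x. F x > t} \<partial>lborel)"
  proof (rule nn_integral_cong)
    fix t :: real
    have "(\<integral>\<^sup>+x. indicator {0<..} t * indicator {p. snd p < F (fst p)} (x, t) \<partial>(lborel::'a measure))
        = (\<integral>\<^sup>+x. indicator {0<..} t * indicator {x. F x > t} x \<partial>(lborel::'a measure))"
      by (intro nn_integral_cong) (auto simp: indicator_def)
    also have "\<dots> = indicator {0<..} t * emeasure lborel {x. F x > t}"
      by (subst nn_integral_cmult_indicator) auto
    finally show "(\<integral>\<^sup>+x. indicator {0<..} t * indicator {p. snd p < F (fst p)} (x, t) \<partial>(lborel::'a measure)) = \<dots>" .
  qed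
  finally show ?thesis .
qed

text \<open>The superlevel sets at height t satisfy {F > t} + {G > t} \<subseteq> {H > t}, and the
  inequality on the line is integrated over t. It asks for two nonempty summands, whence the
  normalisation of both suprema to 1: for t in (0, 1) neither set is empty, for t \<ge> 1 both
  are.\<close>

lemma nn_integral_sup_convolution_real:
  fixes F G H :: "real \<Rightarrow> real"
  assumes [measurable]: "F \<in> borel_measurable borel" "G \<in> borel_measurable borel" "H \<in> borel_measurable borel"
    and F: "\<And>x. F x \<le> 1" "\<And>t. t < 1 \<Longrightarrow> \<exists>x. F x > t" "bounded {x. F x > 0}"
    and G: "\<And>x. G x \<le> 1" "\<And>t. t < 1 \<Longrightarrow> \<exists>x. G x > t" "bounded {x. G x > 0}"
    and H: "\<And>x y. H (x + y) \<ge> min (F x) (G y)" "bounded {x. H x > 0}"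
  shows "(\<integral>\<^sup>+x. F x \<partial>lborel) + (\<integral>\<^sup>+x. G x \<partial>lborel) \<le> (\<integral>\<^sup>+x. H x \<partial>lborel)"
proof -
  have *: "indicator {0<..} t * emeasure lborel {x. F x > t} + indicator {0<..} t * emeasure lborel {x. G x > t}
      \<le> indicator {0<..} t * emeasure lborel {x. H x > t}" for t :: real
  proof (cases "0 < t \<and> t < 1")
    case True
    have bd: "bounded {x. F x > t}" "bounded {x. G x > t}" "bounded {x. H x > t}"
      by (rule bounded_subset[OF F(3)], use True in force)
        (rule bounded_subset[OF G(3)], use True in force, rule bounded_subset[OF H(2)], use True in force)
    have "measure lborel {x. F x > t} + measure lborel {x. G x > t} \<le> measure lborel {x. H x > t}"
    proof (rule measure_sumset_real)
      fix x y assume "x \<in> {x. F x > t}" "y \<in> {x. G x > t}"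
      then show "x + y \<in> {x. H x > t}" using H(1)[of x y] by auto
    qed (use bd F G True in auto)
    moreover have fin: "emeasure lborel {x. K x > t} = ennreal (measure lborel {x. K x > t})"
      if "bounded {x. K x > t}" for K :: "real \<Rightarrow> real"
      using emeasure_bounded_finite[OF that] by (simp add: emeasure_eq_ennreal_measure)
    ultimately show ?thesis using True bd
      by (simp add: fin ennreal_plus[symmetric] ennreal_leI del: ennreal_plus)
  next
    case False
    moreover have "t \<ge> 1 \<Longrightarrow> {x. F x > t} = {}" "t \<ge> 1 \<Longrightarrow> {x. G x > t} = {}"
      using F(1) G(1) by (force simp: not_less intro: order_trans)+
    ultimately show ?thesis by (cases "t \<le> 0") auto
  qed
  have m: "(\<lambda>t. emeasure lborel {x. K x > t}) \<in> borel_measurable borel" if [measurable]: "K \<in> borel_measurable borel" for K :: "real \<Rightarrow> real"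
    by measurable
  have "(\<integral>\<^sup>+x. F x \<partial>lborel) + (\<integral>\<^sup>+x. G x \<partial>lborel) =
      (\<integral>\<^sup>+t. indicator {0<..} t * emeasure lborel {x. F x > t} + indicator {0<..} t * emeasure lborel {x. G x > t} \<partial>lborel)"
    unfolding nn_integral_layer_cake[OF assms(1)] nn_integral_layer_cake[OF assms(2)]
    by (rule nn_integral_add[symmetric]) (use m in measurable)
  also have "\<dots> \<le> (\<integral>\<^sup>+x. H x \<partial>lborel)"
    unfolding nn_integral_layer_cake[OF assms(3)] by (intro nn_integral_mono *)
  finally show ?thesis .
qed

text \<open>The numbers \<open>a\<close>, \<open>b\<close> stand for the \<open>d\<close>-th roots of the volumes. The exponent is an explicit
  argument because the proof is by induction on the dimension, through the slices of a product space.\<close>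

definition brunn_minkowski :: "nat \<Rightarrow> 'a::euclidean_space itself \<Rightarrow> bool" where
  "brunn_minkowski d _ \<longleftrightarrow> (\<forall>(A::'a set) B C a b.
     A \<in> sets borel \<and> bounded A \<and> B \<in> sets borel \<and> bounded B \<and> C \<in> sets borel \<and> bounded C \<and>
     0 < a \<and> 0 < b \<and> a ^ d \<le> measure lborel A \<and> b ^ d \<le> measure lborel B \<and>
     (\<forall>x\<in>A. \<forall>y\<in>B. x + y \<in> C) \<longrightarrow> (a + b) ^ d \<le> measure lborel C)"

lemma brunn_minkowski_real: "brunn_minkowski 1 TYPE(real)"
  unfolding brunn_minkowski_def
proof clarsimp
  fix A B C :: "real set" and a b :: real
  assume *: "A \<in> sets borel" "bounded A" "B \<in> sets borel" "bounded B" "C \<in> sets borel" "bounded C"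
    "0 < a" "0 < b" "a \<le> measure lborel A" "b \<le> measure lborel B" "\<forall>x\<in>A. \<forall>y\<in>B. x + y \<in> C"
  then have "A \<noteq> {}" "B \<noteq> {}" by auto
  then have "measure lborel A + measure lborel B \<le> measure lborel C"
    using * by (intro measure_sumset_real) auto
  then show "a + b \<le> measure lborel C" using * by linarith
qed

text \<open>Jensen's inequality for x^(d+1) at the points a/(1-l) and b/l with weights 1-l = p/(p+q)
  and l = q/(p+q).\<close>

lemma power_sum_le_weighted:
  fixes a b p q :: real
  assumes "0 < a" "0 < b" "0 < p" "0 < q"
  shows "(a + b) ^ Suc d \<le> (p + q) ^ d * (a ^ Suc d / p ^ d + b ^ Suc d / q ^ d)"
proof -
  have conv: "convex_on {0..} (\<lambda>x::real. x ^ Suc d)"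
  proof (cases "even (Suc d)")
    case True
    then show ?thesis
      using convex_power_even convex_on_subset by blast
  qed (rule convex_power_odd)
  define l where "l = q / (p + q)"
  have l: "0 < l" "l < 1" and l1: "1 - l = p / (p + q)" using assms by (auto simp: l_def field_simps)
  have "((1 - l) *\<^sub>R (a / (1 - l)) + l *\<^sub>R (b / l)) ^ Suc d
      \<le> (1 - l) * (a / (1 - l)) ^ Suc d + l * (b / l) ^ Suc d"
    by (rule convex_onD[OF conv]) (use l assms in auto)
  then have "(a + b) ^ Suc d \<le> (1 - l) * (a / (1 - l)) ^ Suc d + l * (b / l) ^ Suc d"
    using l(1,2) by simp
  also have "(1 - l) * (a / (1 - l)) ^ Suc d = a ^ Suc d / (1 - l) ^ d"
    using l by (simp add: power_divide)
  also have "l * (b / l) ^ Suc d = b ^ Suc d / l ^ d"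
    using l by (simp add: power_divide)
  also have "a ^ Suc d / (1 - l) ^ d + b ^ Suc d / l ^ d = (p + q) ^ d * (a ^ Suc d / p ^ d + b ^ Suc d / q ^ d)"
    unfolding l1 by (simp add: l_def power_divide distrib_left mult_ac)
  finally show ?thesis .
qed

lemma measure_lborel_slices:
  fixes A :: "('a::euclidean_space \<times> 'b::euclidean_space) set"
  assumes "A \<in> sets borel" "bounded A"
  shows "(\<lambda>t. measure lborel (Pair t -` A)) \<in> borel_measurable borel"
    and "Pair t -` A \<in> sets borel" and "bounded (Pair t -` A)"
    and "(\<integral>\<^sup>+t. ennreal (measure lborel (Pair t -` A)) \<partial>lborel) = ennreal (measure lborel A)"
    and "bounded {t. measure lborel (Pair t -` A) > 0}"
    and "bdd_above (range (\<lambda>t. measure lborel (Pair t -` A)))"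
proof -
  have A': "A \<in> sets (lborel \<Otimes>\<^sub>M lborel)" using assms(1) by (metis lborel_prod sets_lborel)
  have [measurable]: "(\<lambda>t. emeasure lborel (Pair t -` A)) \<in> borel_measurable borel"
    using lborel.measurable_emeasure_Pair[OF A'] by simp
  show "(\<lambda>t. measure lborel (Pair t -` A)) \<in> borel_measurable borel"
    unfolding measure_def by measurable
  show 2: "Pair t -` A \<in> sets borel" for t
    using sets_Pair1[OF A'] by simp
  show 3: "bounded (Pair t -` A)" for t
    by (rule bounded_subset[OF bounded_snd[OF assms(2)]]) force
  have 4: "emeasure lborel (Pair t -` A) = ennreal (measure lborel (Pair t -` A))" for t
    using emeasure_bounded_finite[OF 3[of t]] by (intro emeasure_eq_ennreal_measure) (simp add: less_top)
  have "(\<integral>\<^sup>+t. ennreal (measure lborel (Pair t -` A)) \<partial>lborel) = emeasure (lborel \<Otimes>\<^sub>M lborel) A"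
    by (subst lborel.emeasure_pair_measure_alt[OF A']) (simp add: 4)
  then show "(\<integral>\<^sup>+t. ennreal (measure lborel (Pair t -` A)) \<partial>lborel) = ennreal (measure lborel A)"
    using emeasure_bounded_finite[OF assms(2)] by (simp add: lborel_prod emeasure_eq_ennreal_measure)
  show "bounded {t. measure lborel (Pair t -` A) > 0}"
  proof (rule bounded_subset[OF bounded_fst[OF assms(2)]])
    show "{t. 0 < measure lborel (Pair t -` A)} \<subseteq> fst ` A"
    proof
      fix t assume "t \<in> {t. 0 < measure lborel (Pair t -` A)}"
      then have "Pair t -` A \<noteq> {}" by auto
      then show "t \<in> fst ` A" by force
    qed
  qed
  obtain c where c: "snd ` A \<subseteq> cbox (-c) c"
    using bounded_subset_cbox_symmetric[OF bounded_snd[OF assms(2)]] by blast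
  show "bdd_above (range (\<lambda>t. measure lborel (Pair t -` A)))"
  proof (rule bdd_aboveI2)
    show "measure lborel (Pair t -` A) \<le> measure lborel (cbox (-c) c)" for t
      by (rule measure_lborel_mono) (use c 2 in force)+
  qed
qed

text \<open>The volumes of the slices over the first coordinate are divided by their suprema p^d and
  q^d. By the inequality in dimension d the slice of C over s + t has volume at least (p + q)^d
  times the minimum of the two normalised volumes, so
  \<open>nn_integral_sup_convolution_real\<close> applies; \<open>power_sum_le_weighted\<close> then
  eliminates p and q.\<close>

lemma brunn_minkowski_step:
  assumes BM: "brunn_minkowski d TYPE('a::euclidean_space)" and d: "d > 0"
  shows "brunn_minkowski (Suc d) TYPE(real \<times> 'a)"
  unfolding brunn_minkowski_def
proof (intro allI impI, elim conjE)
  fix A B C :: "(real \<times> 'a) set" and a b :: real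
  assume A: "A \<in> sets borel" "bounded A" and B: "B \<in> sets borel" "bounded B"
    and C: "C \<in> sets borel" "bounded C" and ab: "0 < a" "0 < b"
    and aA: "a ^ Suc d \<le> measure lborel A" and bB: "b ^ Suc d \<le> measure lborel B"
    and sub: "\<forall>x\<in>A. \<forall>y\<in>B. x + y \<in> C"
  define F where "F D t = measure lborel (Pair t -` D)" for t and D :: "(real \<times> 'a) set"
  note FA = measure_lborel_slices[OF A, folded F_def]
  note FB = measure_lborel_slices[OF B, folded F_def]
  note FC = measure_lborel_slices[OF C, folded F_def]
  have F0: "F D t \<ge> 0" for D t by (simp add: F_def)
  have pos: "(SUP t. F D t) > 0"
    if "(\<integral>\<^sup>+t. ennreal (F D t) \<partial>lborel) = ennreal (measure lborel D)" "c ^ Suc d \<le> measure lborel D" "c > 0"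
      "bdd_above (range (F D))" for D c
  proof (rule ccontr)
    assume n: "\<not> ?thesis"
    have le0: "F D t \<le> 0" for t
      using cSUP_upper[of t UNIV "F D"] that(4) n by auto
    then have "measure lborel D \<le> 0" using that(1) F0
      antisym[OF le0 F0] by simp
    moreover have "c ^ Suc d > 0" using that by simp
    ultimately show False using that by linarith
  qed
  define p where "p = root d (SUP t. F A t)"
  define q where "q = root d (SUP t. F B t)"
  have p: "p > 0" "p ^ d = (SUP t. F A t)" and q: "q > 0" "q ^ d = (SUP t. F B t)"
    using pos[OF FA(4) aA ab(1) FA(6)] pos[OF FB(4) bB ab(2) FB(6)] d
    by (auto simp: p_def q_def)
  have le: "F A t \<le> p ^ d" "F B t \<le> q ^ d" for t
    using cSUP_upper[of t UNIV "F A"] cSUP_upper[of t UNIV "F B"] FA(6) FB(6) p q by auto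
  have near: "\<exists>x. F D x / r ^ d > t" if "bdd_above (range (F D))" "r ^ d = (SUP t. F D t)" "r > 0" "t < 1" for D r t
  proof -
    have "t * r ^ d < (SUP t. F D t)" unfolding that(2)[symmetric] using that(3,4) by simp
    then have "\<exists>x. t * r ^ d < F D x"
      using less_cSUP_iff[OF UNIV_not_empty that(1)] by blast
    then show ?thesis using that(3) by (auto simp: field_simps)
  qed
  have bp: "bounded {x. 0 < F D x / c}" if "bounded {x. 0 < F D x}" "c > 0" for D c
    using that by (simp add: zero_less_divide_iff)
  note [measurable] = FA(1) FB(1) FC(1)
  have "(\<integral>\<^sup>+t. F A t / p ^ d \<partial>lborel) + (\<integral>\<^sup>+t. F B t / q ^ d \<partial>lborel) \<le> (\<integral>\<^sup>+t. F C t / (p + q) ^ d \<partial>lborel)"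
  proof (rule nn_integral_sup_convolution_real)
    fix s t
    show "min (F A s / p ^ d) (F B t / q ^ d) \<le> F C (s + t) / (p + q) ^ d"
    proof (cases "F A s > 0 \<and> F B t > 0")
      case True
      define m where "m = min (F A s / p ^ d) (F B t / q ^ d)"
      have m: "m > 0" using True p(1) q(1) by (simp add: m_def)
      \<comment> \<open>One factor r serves both slices: \<open>p * r\<close> and
        \<open>q * r\<close> are lower bounds for the d-th roots of their volumes.\<close>
      define r where "r = root d m"
      have r: "r > 0" "r ^ d = m" using m d by (auto simp: r_def)
      have "(p * r + q * r) ^ d \<le> measure lborel (Pair (s + t) -` C)"
      proof (rule BM[unfolded brunn_minkowski_def, rule_format, of "Pair s -` A" "Pair t -` B"], intro conjI)
        show "(p * r) ^ d \<le> measure lborel (Pair s -` A)"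
        proof -
          have "m \<le> F A s / p ^ d" by (simp add: m_def)
          then show ?thesis using p(1) r by (simp add: F_def power_mult_distrib field_simps)
        qed
        show "(q * r) ^ d \<le> measure lborel (Pair t -` B)"
        proof -
          have "m \<le> F B t / q ^ d" by (simp add: m_def)
          then show ?thesis using q(1) r by (simp add: F_def power_mult_distrib field_simps)
        qed
        show "\<forall>x\<in>Pair s -` A. \<forall>y\<in>Pair t -` B. x + y \<in> Pair (s + t) -` C"
          using sub by force
      qed (use FA(2,3) FB(2,3) FC(2,3) p q r in auto)
      then have "(p + q) ^ d * m \<le> F C (s + t)"
        using r by (simp add: F_def power_mult_distrib distrib_right[symmetric])
      then show ?thesis using p q unfolding m_def[symmetric] by (simp add: field_simps)
    next
      case False
      then have "min (F A s / p ^ d) (F B t / q ^ d) \<le> 0"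
        using F0[of A s] F0[of B t] by (auto simp: min_def not_less)
      also have "0 \<le> F C (s + t) / (p + q) ^ d" using F0 p q by simp
      finally show ?thesis .
    qed
  next
    show "\<And>t. F A t / p ^ d \<le> 1" "\<And>t. F B t / q ^ d \<le> 1" using le p(1) q(1) by auto
    show "\<And>t. t < 1 \<Longrightarrow> \<exists>x. t < F A x / p ^ d" using near[OF FA(6) p(2,1)] .
    show "\<And>t. t < 1 \<Longrightarrow> \<exists>x. t < F B x / q ^ d" using near[OF FB(6) q(2,1)] .
    show "bounded {x. 0 < F A x / p ^ d}" "bounded {x. 0 < F B x / q ^ d}" "bounded {x. 0 < F C x / (p + q) ^ d}"
      using bp FA(5) FB(5) FC(5) p(1) q(1) by auto
  qed measurable
  moreover have "(\<integral>\<^sup>+t. F D t / c \<partial>lborel) = ennreal (measure lborel D / c)"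
    if "(\<integral>\<^sup>+t. ennreal (F D t) \<partial>lborel) = ennreal (measure lborel D)" "c > 0" "F D \<in> borel_measurable borel" for D c
    using that F0 by (simp add: divide_ennreal[symmetric] nn_integral_divide)
  ultimately have "ennreal (measure lborel A / p ^ d) + ennreal (measure lborel B / q ^ d) \<le> ennreal (measure lborel C / (p + q) ^ d)"
    using FA(1,4) FB(1,4) FC(1,4) p(1) q(1) by simp
  then have "measure lborel A / p ^ d + measure lborel B / q ^ d \<le> measure lborel C / (p + q) ^ d"
    using p(1) q(1) by (simp add: ennreal_plus[symmetric] del: ennreal_plus)
  then have 1: "(p + q) ^ d * (measure lborel A / p ^ d + measure lborel B / q ^ d) \<le> measure lborel C"
    using p(1) q(1) by (simp add: field_simps)
  have "(a + b) ^ Suc d \<le> (p + q) ^ d * (a ^ Suc d / p ^ d + b ^ Suc d / q ^ d)"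
    by (rule power_sum_le_weighted) (use ab p(1) q(1) in auto)
  also have "\<dots> \<le> (p + q) ^ d * (measure lborel A / p ^ d + measure lborel B / q ^ d)"
    using p(1) q(1) aA bB by (intro mult_left_mono add_mono divide_right_mono) auto
  also note 1
  finally show "(a + b) ^ Suc d \<le> measure lborel C" .
qed

lemma brunn_minkowski_3: "brunn_minkowski 3 TYPE(real \<times> real \<times> real)"
  using brunn_minkowski_step[OF brunn_minkowski_step[OF brunn_minkowski_real]]
  by (simp add: numeral_3_eq_3)

text \<open>The idea: for small \<open>d\<close> the superlevel set \<open>h > t\<close> of \<open>h = \<bar>g\<bar> + d (\<bar>\<nabla>g\<bar> + w)\<close> contains the
  \<open>d\<close>-neighbourhood of the superlevel set of \<open>\<bar>g\<bar>\<close>, so Brunn-Minkowski bounds its volume from below.\<close>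

lemma gradient_level_set_bound:
  fixes g :: "real \<times> real \<times> real \<Rightarrow> real" and g' :: "real \<times> real \<times> real \<Rightarrow> real \<times> real \<times> real"
  assumes der: "\<And>p. (g has_derivative (\<lambda>v. g' p \<bullet> v)) (at p)"
    and cont: "continuous_on UNIV g'"
    and K: "compact K" "\<And>p. p \<notin> K \<Longrightarrow> g p = 0"
  shows "ennreal (3 * root 3 (4 * pi / 3)) *
      (\<integral>\<^sup>+t. indicator {0<..} t * ennreal ((root 3 (measure lborel {p. \<bar>g p\<bar> > t}))\<^sup>2) \<partial>lborel)
    \<le> (\<integral>\<^sup>+p. norm (g' p) \<partial>lborel)"
    (is "ennreal (3 * ?\<beta>) * ?I \<le> ?N")
proof -
  have gc: "continuous_on UNIV g"
    using der by (meson continuous_at_imp_continuous_on has_derivative_continuous)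
  have [measurable]: "g \<in> borel_measurable borel" "g' \<in> borel_measurable borel"
    using gc cont by (auto intro: borel_measurable_continuous_onI)
  have g'0: "g' p = 0" if "p \<notin> K" for p
  proof -
    have "open (- K)" using K by (simp add: compact_imp_closed open_Compl)
    then have "((\<lambda>_. 0::real) has_derivative (\<lambda>v. g' p \<bullet> v)) (at p)"
      by (rule has_derivative_transform_within_open[OF der]) (use that K in auto)
    then have "(\<lambda>v. g' p \<bullet> v) = (\<lambda>v. 0)"
      using has_derivative_unique has_derivative_const by blast
    then show ?thesis by (metis inner_eq_zero_iff)
  qed
  \<comment> \<open>\<open>K1\<close> and \<open>K2\<close> are the neighbourhoods of K of radius 1
    and 2. The function \<open>h\<close> below vanishes outside \<open>K1\<close>, and the mean
    value estimate at a point of \<open>K1\<close> uses a ball that stays in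
    \<open>K2\<close>.\<close>
  define K1 where "K1 = {x + y |x y. x \<in> K \<and> y \<in> cball 0 (1::real)}"
  have K1: "compact K1" unfolding K1_def by (intro compact_sums K compact_cball)
  have KK1: "K \<subseteq> K1" unfolding K1_def by force
  define K2 where "K2 = {x + y |x y. x \<in> K1 \<and> y \<in> cball 0 (1::real)}"
  have K2: "compact K2" unfolding K2_def by (intro compact_sums K1 compact_cball)
  have beta: "?\<beta> > 0" by simp
  let ?\<mu> = "\<lambda>t. measure lborel {p. \<bar>g p\<bar> > t}"
  have bdl: "bounded {p. \<bar>g p\<bar> > t}" if "t > 0" for t
    by (rule bounded_subset[OF compact_imp_bounded[OF K(1)]]) (use K that in force)
  have main: "ennreal (3 * ?\<beta>) * ?I \<le> ?N + ennreal (w * measure lborel K1)" if "w > 0" for w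
  proof -
    have "uniformly_continuous_on K2 g'"
      using K2 cont by (meson compact_uniformly_continuous continuous_on_subset subset_UNIV)
    then obtain e where e: "e > 0" "\<And>x y. x \<in> K2 \<Longrightarrow> y \<in> K2 \<Longrightarrow> dist y x < e \<Longrightarrow> dist (g' y) (g' x) < w"
      using \<open>w > 0\<close> unfolding uniformly_continuous_on_def by meson
    define d where "d = min e 1"
    have d: "d > 0" "d \<le> 1" "d \<le> e" using e by (auto simp: d_def)
    define h where "h p = \<bar>g p\<bar> + d * (norm (g' p) + w * indicator K1 p)" for p
    have [measurable]: "K1 \<in> sets borel" using K1 by (rule borel_compact)
    have [measurable]: "h \<in> borel_measurable borel" unfolding h_def by measurable
    have h0: "h p = 0" if "p \<notin> K1" for p
    proof -
      have "p \<notin> K" using that KK1 by blast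
      then show ?thesis using that K(2)[of p] g'0[of p] by (simp add: h_def)
    qed
    \<comment> \<open>The gain in volume is at least d times the isoperimetric lower bound for the
      boundary area of the superlevel set of |g|.\<close>
    have lev: "ennreal (?\<mu> t) + ennreal (3 * ?\<beta> * d) * ennreal ((root 3 (?\<mu> t))\<^sup>2) \<le> emeasure lborel {p. h p > t}"
      if t: "t > 0" for t
    proof (cases "?\<mu> t > 0")
      case True
      have sub: "x + y \<in> {p. h p > t}" if "x \<in> {p. \<bar>g p\<bar> > t}" "y \<in> ball 0 d" for x y
      proof -
        have xK: "x \<in> K" using that t K(2)[of x] by (cases "x \<in> K") auto
        have pK: "x + y \<in> K1" unfolding K1_def using xK that d by (intro CollectI exI[of _ x] exI[of _ y]) auto
        have "norm (g x - g (x + y)) \<le> (norm (g' (x + y)) + w) * norm (x - (x + y))"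
        proof (rule differentiable_bound)
          show "convex (ball (x + y) d)" by simp
          show "(g has_derivative (\<lambda>v. g' z \<bullet> v)) (at z within ball (x + y) d)" for z
            using der has_derivative_at_withinI by blast
          show "onorm ((\<bullet>) (g' z)) \<le> norm (g' (x + y)) + w" if "z \<in> ball (x + y) d" for z
          proof (rule onorm_bound)
            have zK: "z \<in> K2"
              unfolding K2_def using that pK d
              by (intro CollectI exI[of _ "x + y"] exI[of _ "z - (x + y)"]) (auto simp: dist_norm norm_minus_commute)
            have pK2: "x + y \<in> K2"
              unfolding K2_def using pK by (intro CollectI exI[of _ "x + y"] exI[of _ 0]) auto
            have "dist (g' z) (g' (x + y)) < w"
              by (rule e(2)[OF pK2 zK]) (use that d in \<open>auto simp: dist_commute\<close>)
            then have "norm (g' z) \<le> norm (g' (x + y)) + w"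
              by (smt (verit) dist_norm norm_triangle_sub)
            then show "norm (g' z \<bullet> v) \<le> (norm (g' (x + y)) + w) * norm v" for v
              by (metis Cauchy_Schwarz_ineq2 dual_order.trans mult_right_mono norm_ge_zero real_norm_def)
            show "0 \<le> norm (g' (x + y)) + w" using \<open>w > 0\<close> by simp
          qed
          show "x \<in> ball (x + y) d" "x + y \<in> ball (x + y) d"
            using that d by (auto simp: dist_norm)
        qed
        also have "\<dots> \<le> (norm (g' (x + y)) + w) * d"
          using that \<open>w > 0\<close> by (intro mult_left_mono) auto
        finally have "\<bar>g x\<bar> \<le> \<bar>g (x + y)\<bar> + d * (norm (g' (x + y)) + w)" by (simp add: mult.commute)
        then show ?thesis using that pK by (simp add: h_def)
      qed
      have bh: "bounded {p. h p > t}"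
        by (rule bounded_subset[OF compact_imp_bounded[OF K1]]) (use h0 t in force)
      define a where "a = root 3 (?\<mu> t)"
      have a: "a > 0" "a ^ 3 = ?\<mu> t" using True by (auto simp: a_def)
      have "(a + ?\<beta> * d) ^ 3 \<le> measure lborel {p. h p > t}"
      proof (rule brunn_minkowski_3[unfolded brunn_minkowski_def, rule_format, of "{p. \<bar>g p\<bar> > t}" "ball 0 d"], intro conjI)
        show "(?\<beta> * d) ^ 3 \<le> measure lborel (ball (0::real \<times> real \<times> real) d)"
        proof -
          have "measure lborel (ball (0::real \<times> real \<times> real) d) = 4 / 3 * pi * d ^ 3"
            using d by (simp add: content_ball unit_ball_vol_3 power3_eq_cube)
          moreover have "?\<beta> ^ 3 = 4 * pi / 3" by simp
          ultimately show ?thesis by (simp only: power_mult_distrib)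
        qed
        show "\<forall>x\<in>{p. t < \<bar>g p\<bar>}. \<forall>y\<in>ball 0 d. x + y \<in> {p. t < h p}" using sub by blast
      qed (use bdl t bh a beta d in auto)
      \<comment> \<open>Of the cubic only the terms of order 0 and 1 in d are kept.\<close>
      moreover have "a ^ 3 + 3 * ?\<beta> * d * a\<^sup>2 \<le> (a + ?\<beta> * d) ^ 3"
      proof -
        have "(a + c) ^ 3 = a ^ 3 + 3 * c * a\<^sup>2 + (3 * a * c\<^sup>2 + c ^ 3)" for c :: real
          by (simp add: algebra_simps power2_eq_square power3_eq_cube)
        moreover have "0 \<le> 3 * a * (?\<beta> * d)\<^sup>2 + (?\<beta> * d) ^ 3" using a d beta by simp
        ultimately show ?thesis by (simp add: mult.assoc)
      qed
      ultimately have "?\<mu> t + (3 * ?\<beta> * d) * a\<^sup>2 \<le> measure lborel {p. h p > t}"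
        using a by simp
      moreover have "emeasure lborel {p. h p > t} = ennreal (measure lborel {p. h p > t})"
        using emeasure_bounded_finite[OF bh] by (intro emeasure_eq_ennreal_measure) (simp add: less_top)
      ultimately show ?thesis using d beta unfolding a_def
        by (simp add: ennreal_mult[symmetric] ennreal_plus[symmetric] ennreal_leI del: ennreal_plus)
    next
      case False
      then have "?\<mu> t = 0" by (simp add: zero_less_measure_iff)
      then show ?thesis by simp
    qed
    have mu_eq: "emeasure lborel {p. \<bar>g p\<bar> > t} = ennreal (?\<mu> t)" if "t > 0" for t
      using emeasure_bounded_finite[OF bdl[OF that]] by (intro emeasure_eq_ennreal_measure) (simp add: less_top)
    have [measurable]: "?\<mu> \<in> borel_measurable borel"
      unfolding measure_def by measurable
    have "(\<integral>\<^sup>+p. \<bar>g p\<bar> \<partial>lborel) + ennreal (3 * ?\<beta> * d) * ?I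
        = (\<integral>\<^sup>+t. indicator {0<..} t * emeasure lborel {p. \<bar>g p\<bar> > t} +
             ennreal (3 * ?\<beta> * d) * (indicator {0<..} t * ennreal ((root 3 (?\<mu> t))\<^sup>2)) \<partial>lborel)"
      by (subst nn_integral_layer_cake, measurable, subst nn_integral_add) (auto simp: nn_integral_cmult)
    also have "\<dots> \<le> (\<integral>\<^sup>+t. indicator {0<..} t * emeasure lborel {p. h p > t} \<partial>lborel)"
      by (rule nn_integral_mono) (use lev mu_eq in \<open>auto split: split_indicator\<close>)
    also have "\<dots> = (\<integral>\<^sup>+p. h p \<partial>lborel)"
      by (rule nn_integral_layer_cake[symmetric]) measurable
    also have "\<dots> = (\<integral>\<^sup>+p. ennreal \<bar>g p\<bar> + (ennreal d * ennreal (norm (g' p)) + ennreal (d * w) * indicator K1 p) \<partial>lborel)"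
      using d \<open>w > 0\<close> unfolding h_def
      by (intro nn_integral_cong) (auto simp: ennreal_mult[symmetric] ennreal_plus[symmetric] distrib_left simp del: ennreal_plus split: split_indicator)
    also have "\<dots> = (\<integral>\<^sup>+p. \<bar>g p\<bar> \<partial>lborel) + (ennreal d * ?N + ennreal (d * w) * emeasure lborel K1)"
      by (subst nn_integral_add, measurable, subst nn_integral_add) (auto simp: nn_integral_cmult nn_integral_cmult_indicator)
    finally have *: "(\<integral>\<^sup>+p. \<bar>g p\<bar> \<partial>lborel) + ennreal (3 * ?\<beta> * d) * ?I \<le>
        (\<integral>\<^sup>+p. \<bar>g p\<bar> \<partial>lborel) + (ennreal d * ?N + ennreal (d * w) * emeasure lborel K1)" .
    \<comment> \<open>The integral of |g| occurs on both sides and, being finite, cancels; what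
      remains carries a factor d, which is divided out.\<close>
    have fin: "(\<integral>\<^sup>+p. \<bar>g p\<bar> \<partial>lborel) \<noteq> \<infinity>"
    proof -
      have "bounded (g ` K)" using K gc by (meson compact_continuous_image compact_imp_bounded continuous_on_subset subset_UNIV)
      then obtain M where M: "\<And>p. p \<in> K \<Longrightarrow> \<bar>g p\<bar> \<le> M" unfolding bounded_iff by auto
      have "(\<integral>\<^sup>+p. \<bar>g p\<bar> \<partial>lborel) \<le> (\<integral>\<^sup>+p. ennreal M * indicator K p \<partial>lborel)"
        by (rule nn_integral_mono) (use M K in \<open>auto split: split_indicator intro: ennreal_leI\<close>)
      also have "\<dots> = ennreal M * emeasure lborel K"
        by (rule nn_integral_cmult_indicator) (use K in \<open>auto intro: borel_compact\<close>)
      also have "\<dots> < \<infinity>" using emeasure_bounded_finite[OF compact_imp_bounded[OF K(1)]]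
        by (simp add: ennreal_mult_less_top)
      finally show ?thesis by simp
    qed
    have "ennreal (3 * ?\<beta> * d) * ?I \<le> ennreal d * ?N + ennreal (d * w) * emeasure lborel K1"
      using * fin by (simp add: ennreal_add_left_cancel_le)
    also have "emeasure lborel K1 = ennreal (measure lborel K1)"
      using emeasure_bounded_finite[OF compact_imp_bounded[OF K1]] by (intro emeasure_eq_ennreal_measure) (simp add: less_top)
    finally have "ennreal d * (ennreal (3 * ?\<beta>) * ?I) \<le> ennreal d * (?N + ennreal (w * measure lborel K1))"
      using d beta \<open>w > 0\<close> by (simp add: ennreal_mult distrib_left mult_ac)
    then show ?thesis using d by (simp add: ennreal_mult_le_mult_iff)
  qed
  show ?thesis
  proof (rule ennreal_le_epsilon)
    fix e :: real assume "e > 0"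
    \<comment> \<open>The added 1 guards against a null set \<open>K1\<close>.\<close>
    define w where "w = e / (measure lborel K1 + 1)"
    have m0: "measure lborel K1 \<ge> 0" by simp
    have "w > 0" using \<open>e > 0\<close> m0 by (simp add: w_def add_nonneg_pos)
    have "w * measure lborel K1 \<le> e"
    proof -
      have "w * measure lborel K1 \<le> w * (measure lborel K1 + 1)" using \<open>w > 0\<close> by simp
      also have "\<dots> = e" using m0 by (simp add: w_def add_nonneg_pos less_imp_neq[symmetric])
      finally show ?thesis .
    qed
    then show "ennreal (3 * ?\<beta>) * ?I \<le> ?N + ennreal e"
      using main[OF \<open>w > 0\<close>] by (meson add_left_mono ennreal_leI order_trans)
  qed
qed

text \<open>X is the integral over t of the integral of |g|^(1/2) over {|g| > t}. With \<mu>(t) the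
  volume of that set, Hoelder's inequality with exponents 3 and 3/2 bounds the inner integral by
  X^(1/3) \<mu>(t)^(2/3), so X^(2/3) is at most the level set integral of
  \<open>gradient_level_set_bound\<close>. The constant is (3 (4 pi/3)^(1/3))^3 = 36 pi, that of the
  isoperimetric inequality in space.\<close>

lemma sobolev_L1_gradient:
  fixes g :: "real \<times> real \<times> real \<Rightarrow> real" and g' :: "real \<times> real \<times> real \<Rightarrow> real \<times> real \<times> real"
  assumes der: "\<And>p. (g has_derivative (\<lambda>v. g' p \<bullet> v)) (at p)"
    and cont: "continuous_on UNIV g'"
    and K: "compact K" "\<And>p. p \<notin> K \<Longrightarrow> g p = 0"
    and N: "(\<integral>\<^sup>+p. norm (g' p) \<partial>lborel) \<le> ennreal N" "N \<ge> 0"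
    and X: "(\<integral>\<^sup>+p. ennreal (\<bar>g p\<bar> * sqrt \<bar>g p\<bar>) \<partial>lborel) = ennreal X" "X \<ge> 0"
  shows "36 * pi * X\<^sup>2 \<le> N ^ 3"
proof (cases "X = 0")
  case False
  with X have Xpos: "X > 0" by simp
  let ?\<mu> = "\<lambda>t. measure lborel {p. \<bar>g p\<bar> > t}"
  let ?I = "(\<integral>\<^sup>+t. indicator {0<..} t * ennreal ((root 3 (?\<mu> t))\<^sup>2) \<partial>lborel)"
  have gc: "continuous_on UNIV g"
    using der by (meson continuous_at_imp_continuous_on has_derivative_continuous)
  have [measurable]: "g \<in> borel_measurable borel"
    using gc by (auto intro: borel_measurable_continuous_onI)
  have bdl: "bounded {p. \<bar>g p\<bar> > t}" if "t > 0" for t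
    by (rule bounded_subset[OF compact_imp_bounded[OF K(1)]]) (use K that in force)
  have [measurable]: "?\<mu> \<in> borel_measurable borel"
    unfolding measure_def by measurable
  have inner: "(\<integral>\<^sup>+p. ennreal (sqrt \<bar>g p\<bar>) * indicator {p. \<bar>g p\<bar> > t} p \<partial>lborel) \<le> ennreal (root 3 X) * ennreal ((root 3 (?\<mu> t))\<^sup>2)"
    (is "?L \<le> _") if t: "t > 0" for t
  proof -
    have mu_eq: "emeasure lborel {p. \<bar>g p\<bar> > t} = ennreal (?\<mu> t)"
      using emeasure_bounded_finite[OF bdl[OF t]] by (intro emeasure_eq_ennreal_measure) (simp add: less_top)
    show ?thesis
    proof (cases "?\<mu> t > 0")
      case False
      then have "?\<mu> t = 0" by (simp add: zero_less_measure_iff)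
      then have "emeasure lborel {p. \<bar>g p\<bar> > t} = 0" using mu_eq by simp
      then have "{p. \<bar>g p\<bar> > t} \<in> null_sets lborel" by (intro null_setsI) auto
      then have "?L = 0" by (subst nn_integral_null_set[symmetric]) auto
      then show ?thesis by simp
    next
      case True
      \<comment> \<open>Hoelder's inequality is derived from the pointwise inequality
        \<open>young\<close>; with this s the two integrated terms add up to exactly the Hoelder
        bound.\<close>
      define s where "s = root 3 X / root 3 (?\<mu> t)"
      have s: "s > 0" using True Xpos by (simp add: s_def)
      have young: "sqrt y \<le> 2/3 * s + (y * sqrt y) / (3 * s\<^sup>2)" if "y \<ge> 0" for y
      proof -
        define r where "r = sqrt y / s"
        have r: "r \<ge> 0" "sqrt y = r * s" using s that by (auto simp: r_def)
        have "0 \<le> (r - 1)\<^sup>2 * (r + 2)" using r by simp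
        then have "r \<le> 2/3 + r ^ 3 / 3" by (simp add: power2_eq_square power3_eq_cube algebra_simps)
        then have "r * s \<le> (2/3 + r ^ 3 / 3) * s" using s by (intro mult_right_mono) auto
        moreover have "y = (r * s)\<^sup>2" using r that by (metis real_sqrt_pow2)
        ultimately show ?thesis using r s by (simp add: field_simps power2_eq_square power3_eq_cube)
      qed
      have "?L \<le> (\<integral>\<^sup>+p. ennreal (2/3 * s) * indicator {p. \<bar>g p\<bar> > t} p + ennreal (1 / (3 * s\<^sup>2)) * ennreal (\<bar>g p\<bar> * sqrt \<bar>g p\<bar>) \<partial>lborel)"
        using young s
        by (intro nn_integral_mono) (auto simp: ennreal_mult[symmetric] ennreal_plus[symmetric] simp del: ennreal_plus split: split_indicator intro!: ennreal_leI)
      also have "\<dots> = ennreal (2/3 * s) * ennreal (?\<mu> t) + ennreal (1 / (3 * s\<^sup>2)) * ennreal X"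
        by (subst nn_integral_add) (auto simp: nn_integral_cmult nn_integral_cmult_indicator mu_eq X)
      also have "\<dots> = ennreal (2/3 * s * ?\<mu> t + 1 / (3 * s\<^sup>2) * X)"
        using s True Xpos by (simp add: ennreal_mult[symmetric] ennreal_plus[symmetric] del: ennreal_plus)
      also have "2/3 * s * ?\<mu> t + 1 / (3 * s\<^sup>2) * X = root 3 X * (root 3 (?\<mu> t))\<^sup>2"
      proof -
        define x m where "x = root 3 X" and "m = root 3 (?\<mu> t)"
        have xm: "x > 0" "m > 0" "X = x ^ 3" "?\<mu> t = m ^ 3" using True Xpos by (auto simp: x_def m_def)
        have sx: "s = x / m" by (simp add: s_def x_def m_def)
        have "2/3 * s * m ^ 3 + 1 / (3 * s\<^sup>2) * x ^ 3 = x * m\<^sup>2"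
          unfolding sx using xm(1,2) by (simp add: field_simps power2_eq_square power3_eq_cube)
        then show ?thesis using xm(3,4) unfolding x_def m_def by simp
      qed
      finally show ?thesis using Xpos by (simp add: ennreal_mult)
    qed
  qed
  have "ennreal X = (\<integral>\<^sup>+p. ennreal (\<bar>g p\<bar> * sqrt \<bar>g p\<bar>) \<partial>lborel)" by (simp add: X)
  also have "\<dots> = (\<integral>\<^sup>+p. (\<integral>\<^sup>+t. ennreal (sqrt \<bar>g p\<bar>) * indicator {0<..<\<bar>g p\<bar>} t \<partial>lborel) \<partial>lborel)"
    by (intro nn_integral_cong, subst nn_integral_cmult_indicator) (auto simp: ennreal_mult[symmetric] mult.commute)
  also have "\<dots> = (\<integral>\<^sup>+p. (\<integral>\<^sup>+t. indicator {0<..} t * (ennreal (sqrt \<bar>g p\<bar>) * indicator {q. snd q < \<bar>g (fst q)\<bar>} (p, t)) \<partial>lborel) \<partial>lborel)"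
    by (intro nn_integral_cong) (auto simp: indicator_def)
  also have "\<dots> = (\<integral>\<^sup>+t. (\<integral>\<^sup>+p. indicator {0<..} t * (ennreal (sqrt \<bar>g p\<bar>) * indicator {q. snd q < \<bar>g (fst q)\<bar>} (p, t)) \<partial>lborel) \<partial>lborel)"
    by (rule lborel_pair.Fubini'[symmetric]) measurable
  also have "\<dots> = (\<integral>\<^sup>+t. indicator {0<..} t * (\<integral>\<^sup>+p. ennreal (sqrt \<bar>g p\<bar>) * indicator {p. \<bar>g p\<bar> > t} p \<partial>lborel) \<partial>lborel)"
  proof (rule nn_integral_cong)
    fix t :: real
    have "(\<integral>\<^sup>+p. indicator {0<..} t * (ennreal (sqrt \<bar>g p\<bar>) * indicator {q. snd q < \<bar>g (fst q)\<bar>} (p, t)) \<partial>lborel)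
      = (\<integral>\<^sup>+p. indicator {0<..} t * (ennreal (sqrt \<bar>g p\<bar>) * indicator {p. \<bar>g p\<bar> > t} p) \<partial>lborel)"
      by (intro nn_integral_cong) (auto simp: indicator_def)
    then show "(\<integral>\<^sup>+p. indicator {0<..} t * (ennreal (sqrt \<bar>g p\<bar>) * indicator {q. snd q < \<bar>g (fst q)\<bar>} (p, t)) \<partial>lborel)
      = indicator {0<..} t * (\<integral>\<^sup>+p. ennreal (sqrt \<bar>g p\<bar>) * indicator {p. \<bar>g p\<bar> > t} p \<partial>lborel)"
      by (simp add: nn_integral_cmult)
  qed
  also have "\<dots> \<le> (\<integral>\<^sup>+t. ennreal (root 3 X) * (indicator {0<..} t * ennreal ((root 3 (?\<mu> t))\<^sup>2)) \<partial>lborel)"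
    by (intro nn_integral_mono) (use inner in \<open>auto split: split_indicator\<close>)
  also have "\<dots> = ennreal (root 3 X) * ?I" by (rule nn_integral_cmult) measurable
  finally have 1: "ennreal X \<le> ennreal (root 3 X) * ?I" .
  define x where "x = root 3 X"
  have x: "x > 0" "X = x ^ 3" using Xpos by (auto simp: x_def)
  have "ennreal X = ennreal x * ennreal (x\<^sup>2)"
    using x by (simp add: ennreal_mult[symmetric] power2_eq_square power3_eq_cube mult.assoc)
  then have "ennreal x * ennreal (x\<^sup>2) \<le> ennreal x * ?I"
    using 1 unfolding x_def by simp
  then have "ennreal (x\<^sup>2) \<le> ?I" using x by (simp add: ennreal_mult_le_mult_iff)
  then have "ennreal (3 * root 3 (4 * pi / 3)) * ennreal (x\<^sup>2) \<le> ennreal (3 * root 3 (4 * pi / 3)) * ?I"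
    by (rule mult_left_mono) simp
  also note gradient_level_set_bound[OF der cont K]
  also note N(1)
  finally have "3 * root 3 (4 * pi / 3) * x\<^sup>2 \<le> N"
    using N(2) by (simp add: ennreal_mult[symmetric])
  then have "(3 * root 3 (4 * pi / 3) * x\<^sup>2) ^ 3 \<le> N ^ 3"
    by (rule power_mono) simp
  moreover have "(3 * root 3 (4 * pi / 3) * x\<^sup>2) ^ 3 = 36 * pi * X\<^sup>2"
    unfolding x(2) by (simp add: power_mult_distrib power2_eq_square power3_eq_cube mult_ac)
      (simp add: power3_eq_cube[symmetric] mult.assoc[symmetric])
  ultimately show ?thesis by simp
qed (use N in simp)

subsection \<open>Spline kernels\<close>

definition pospow :: "nat \<Rightarrow> real \<Rightarrow> real" where
  "pospow n s = (max 0 s) ^ n"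

lemma pospow_pos: "0 \<le> s \<Longrightarrow> pospow n s = s ^ n"
  by (simp add: pospow_def)

lemma pospow_neg: "s \<le> 0 \<Longrightarrow> 0 < n \<Longrightarrow> pospow n s = 0"
  by (simp add: pospow_def max_def)

text \<open>The exponent starts at 2 because \<open>pospow 1\<close> has a corner at 0. At 0 the
  difference quotient with increment h is exactly \<open>pospow (Suc n) h\<close>.\<close>

lemma DERIV_pospow: "(pospow (Suc (Suc n)) has_real_derivative (Suc (Suc n)) * pospow (Suc n) s) (at s)"
proof (cases s "0::real" rule: linorder_cases)
  case less
  have "((\<lambda>s. 0::real) has_real_derivative 0) (at s)" by simp
  then have "(pospow (Suc (Suc n)) has_real_derivative 0) (at s)"
    by (rule has_field_derivative_transform_within_open[of _ _ _ "{..<0}"]) (use less in \<open>auto simp: pospow_neg\<close>)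
  then show ?thesis using less by (simp add: pospow_neg)
next
  case greater
  have "((\<lambda>s. s ^ (Suc (Suc n))) has_real_derivative (Suc (Suc n)) * s ^ Suc n) (at s)"
    using DERIV_pow[of "Suc (Suc n)" s] by simp
  then have "(pospow (Suc (Suc n)) has_real_derivative (Suc (Suc n)) * s ^ Suc n) (at s)"
    by (rule has_field_derivative_transform_within_open[of _ _ _ "{0<..}"]) (use greater in \<open>auto simp: pospow_pos\<close>)
  then show ?thesis using greater by (simp add: pospow_pos)
next
  case equal
  have "((\<lambda>h. pospow (Suc n) h) \<longlongrightarrow> pospow (Suc n) 0) (at 0)"
    unfolding pospow_def by (intro tendsto_intros)
  then have "((\<lambda>h. pospow (Suc n) h) \<longlongrightarrow> 0) (at 0)" by (simp add: pospow_def)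
  then have "((\<lambda>h. (pospow (Suc (Suc n)) (0 + h) - pospow (Suc (Suc n)) 0) / h) \<longlongrightarrow> 0) (at 0)"
    by (rule Lim_transform_eventually) (auto simp: eventually_at_filter pospow_def max_def)
  then show ?thesis using equal by (simp add: DERIV_def pospow_def)
qed

lemma continuous_on_pospow [continuous_intros]:
  "continuous_on A f \<Longrightarrow> continuous_on A (\<lambda>x. pospow n (f x))"
  unfolding pospow_def by (intro continuous_intros)

text \<open>\<open>bspline 2\<close> is the quadratic B-spline; \<open>bspline 3\<close> and \<open>bspline 4\<close> are its iterated
  antiderivatives and \<open>bspline 1\<close> is its derivative.\<close>

definition bspline :: "nat \<Rightarrow> real \<Rightarrow> real" where
  "bspline n s = (pospow n (s + 3/2) - 3 * pospow n (s + 1/2) + 3 * pospow n (s - 1/2) - pospow n (s - 3/2)) / fact n"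

lemma continuous_on_bspline [continuous_intros]:
  "continuous_on A f \<Longrightarrow> continuous_on A (\<lambda>x. bspline n (f x))"
  unfolding bspline_def by (intro continuous_intros) auto

lemma DERIV_bspline: "(bspline (Suc (Suc n)) has_real_derivative bspline (Suc n) s) (at s)"
proof -
  define C where "C = (2 + real n)"
  have C: "C > 0" "fact (Suc (Suc n)) = C * fact (Suc n)" by (auto simp: C_def)
  have *: "((\<lambda>s. pospow (Suc (Suc n)) (s + c)) has_real_derivative C * pospow (Suc n) (s + c)) (at s)" for c
    using DERIV_shift[THEN iffD1, OF DERIV_pospow[of n "s + c"]] by (simp add: C_def)
  have "((\<lambda>s. (pospow (Suc (Suc n)) (s + 3/2) - 3 * pospow (Suc (Suc n)) (s + 1/2) + 3 * pospow (Suc (Suc n)) (s + (-1/2))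
      - pospow (Suc (Suc n)) (s + (-3/2))) / (C * fact (Suc n))) has_real_derivative
    (C * pospow (Suc n) (s + 3/2) - 3 * (C * pospow (Suc n) (s + 1/2)) + 3 * (C * pospow (Suc n) (s + (-1/2)))
      - C * pospow (Suc n) (s + (-3/2))) / (C * fact (Suc n))) (at s)"
    by (intro DERIV_cdivide DERIV_diff DERIV_add DERIV_cmult *)
  moreover have "(C * pospow (Suc n) (s + 3/2) - 3 * (C * pospow (Suc n) (s + 1/2)) + 3 * (C * pospow (Suc n) (s + (-1/2)))
      - C * pospow (Suc n) (s + (-3/2))) / (C * fact (Suc n)) = bspline (Suc n) s"
  proof -
    have "(C * x - 3 * (C * y) + 3 * (C * z) - C * w) / (C * F) = (x - 3 * y + 3 * z - w) / F" for x y z w F :: real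
      using mult_divide_mult_cancel_left[of C "x - 3 * y + 3 * z - w" F] C(1) by (simp add: algebra_simps)
    then show ?thesis by (simp add: bspline_def)
  qed
  ultimately show ?thesis unfolding bspline_def[abs_def] C(2)[symmetric] by simp
qed

lemma bspline_left: "s \<le> -3/2 \<Longrightarrow> 0 < n \<Longrightarrow> bspline n s = 0"
  by (simp add: bspline_def pospow_neg)

text \<open>To the right of all knots \<open>bspline n\<close> is the third central difference of
  s^n / n!, which annihilates polynomials of degree below 3 and gives 1 and s for n = 3 and n =
  4.\<close>

lemma bspline_right:
  assumes "s \<ge> 3/2"
  shows "bspline 1 s = 0" "bspline 2 s = 0" "bspline 3 s = 1" "bspline 4 s = s"
  using assms by (simp_all add: bspline_def pospow_pos fact_numeral field_simps power2_eq_square power3_eq_cube power4_eq_xxxx)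

lemma bspline_2_nonneg: "bspline 2 s \<ge> 0"
proof -
  consider "s \<le> -3/2" | "-3/2 \<le> s" "s \<le> -1/2" | "-1/2 \<le> s" "s \<le> 1/2" | "1/2 \<le> s" "s \<le> 3/2" | "s \<ge> 3/2"
    by linarith
  then show ?thesis
  proof cases
    case 2
    then have "bspline 2 s = (s + 3/2)\<^sup>2 / 2" by (simp add: bspline_def pospow_pos pospow_neg)
    then show ?thesis by (metis divide_nonneg_pos zero_le_power2 zero_less_numeral)
  next
    case 3
    then have "bspline 2 s = 3/4 - s\<^sup>2"
      by (simp add: bspline_def pospow_pos pospow_neg power2_eq_square field_simps)
    moreover have "\<bar>s\<bar> \<le> 1/2" using 3 by linarith
    then have "s\<^sup>2 \<le> (1/2)\<^sup>2" by (metis abs_ge_zero power2_abs power_mono)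
    ultimately show ?thesis by (simp add: power2_eq_square)
  next
    case 4
    then have "bspline 2 s = (s - 3/2)\<^sup>2 / 2"
      by (simp add: bspline_def pospow_pos pospow_neg power2_eq_square field_simps)
    then show ?thesis by (metis divide_nonneg_pos zero_le_power2 zero_less_numeral)
  qed (simp_all add: bspline_left bspline_right)
qed

text \<open>A chain of derivatives at scale e, read from the last to the first: a smoothed positive
  part, a smoothed Heaviside function, a mollifier of mass 1 and its derivative. Degree 2 for the
  mollifier is the least that makes \<open>kerD\<close> continuous, which the continuous
  differentiability of the mollified winding number relies on.\<close>

definition kerD :: "real \<Rightarrow> real \<Rightarrow> real" where "kerD e s = bspline 1 (s / e) / e\<^sup>2"
definition ker0 :: "real \<Rightarrow> real \<Rightarrow> real" where "ker0 e s = bspline 2 (s / e) / e"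
definition kerI :: "real \<Rightarrow> real \<Rightarrow> real" where "kerI e s = bspline 3 (s / e)"
definition kerJ :: "real \<Rightarrow> real \<Rightarrow> real" where "kerJ e s = e * bspline 4 (s / e)"

context
  fixes e :: real
  assumes e: "e > 0"
begin

lemma continuous_on_ker [continuous_intros]:
  assumes "continuous_on A f"
  shows "continuous_on A (\<lambda>x. kerD e (f x))" "continuous_on A (\<lambda>x. ker0 e (f x))" "continuous_on A (\<lambda>x. kerI e (f x))"
  using e assms unfolding kerD_def ker0_def kerI_def by (auto intro!: continuous_intros)

lemma DERIV_ker:
  "(ker0 e has_real_derivative kerD e s) (at s)"
  "(kerI e has_real_derivative ker0 e s) (at s)"
  "(kerJ e has_real_derivative kerI e s) (at s)"
proof -
  have *: "((\<lambda>s. bspline (Suc (Suc n)) (s / e)) has_real_derivative bspline (Suc n) (s / e) * (1 / e)) (at s)" for n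
    by (rule DERIV_chain2[OF DERIV_bspline]) (use e in \<open>auto intro!: derivative_eq_intros\<close>)
  show "(ker0 e has_real_derivative kerD e s) (at s)"
    unfolding ker0_def[abs_def] kerD_def
    using DERIV_cdivide[OF *[of 0], of e] e by (simp add: numeral_eq_Suc power2_eq_square)
  show "(kerI e has_real_derivative ker0 e s) (at s)"
    unfolding kerI_def[abs_def] ker0_def using *[of 1] by (simp add: numeral_eq_Suc)
  show "(kerJ e has_real_derivative kerI e s) (at s)"
    unfolding kerJ_def[abs_def] kerI_def using DERIV_cmult[OF *[of 2], of e] e by (simp add: numeral_eq_Suc)
qed

lemma ker0_nonneg: "0 \<le> ker0 e s"
  using e bspline_2_nonneg by (simp add: ker0_def)

lemma ker_left: "s \<le> - (3/2) * e \<Longrightarrow> ker0 e s = 0 \<and> kerI e s = 0 \<and> kerJ e s = 0"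
  using e by (simp add: ker0_def kerI_def kerJ_def bspline_left field_simps)

lemma ker_right: "s \<ge> 3/2 * e \<Longrightarrow> ker0 e s = 0 \<and> kerI e s = 1 \<and> kerJ e s = s"
  using e bspline_right[of "s / e"] by (simp add: ker0_def kerI_def kerJ_def field_simps)

lemma ker0_far: "\<bar>s\<bar> \<ge> 3/2 * e \<Longrightarrow> ker0 e s = 0"
  using ker_left[of s] ker_right[of s] by (cases "s \<ge> 0") auto

lemma has_integral_ker0:
  assumes "\<bar>x\<bar> + 3/2 * e \<le> M"
  shows "((\<lambda>s. ker0 e (s - x)) has_integral 1) {-M..M}"
proof -
  have "((\<lambda>s. ker0 e (s - x)) has_integral (kerI e (M - x) - kerI e (- M - x))) {-M..M}"
  proof (rule fundamental_theorem_of_calculus)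
    show "-M \<le> M" using assms e abs_ge_zero[of x] by linarith
    have "((\<lambda>s. kerI e (s - x)) has_real_derivative ker0 e (s - x)) (at s)" for s
      using DERIV_shift[THEN iffD1, OF DERIV_ker(2)[of "s + - x"]] by simp
    then show "((\<lambda>s. kerI e (s - x)) has_vector_derivative ker0 e (s - x)) (at s within {-M..M})" for s
      by (meson has_real_derivative_iff_has_vector_derivative has_vector_derivative_at_within)
  qed
  moreover have "kerI e (M - x) = 1" "kerI e (- M - x) = 0"
    using assms ker_right[of "M - x"] ker_left[of "- M - x"] by (auto simp: abs_le_iff)
  ultimately show ?thesis by simp
qed

text \<open>The value is exact, without an error of order e: by the symmetry of the spline,
  \<open>kerJ e s\<close> equals s beyond the transition zone, not just s plus a constant. This
  makes the integral of the mollified winding number independent of e.\<close>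

lemma has_integral_kerI:
  assumes "\<bar>x\<bar> + 3/2 * e \<le> M"
  shows "((\<lambda>s. kerI e (s - x)) has_integral (M - x)) {-M..M}"
proof -
  have "((\<lambda>s. kerI e (s - x)) has_integral (kerJ e (M - x) - kerJ e (- M - x))) {-M..M}"
  proof (rule fundamental_theorem_of_calculus)
    show "-M \<le> M" using assms e abs_ge_zero[of x] by linarith
    have "((\<lambda>s. kerJ e (s - x)) has_real_derivative kerI e (s - x)) (at s)" for s
      using DERIV_shift[THEN iffD1, OF DERIV_ker(3)[of "s + - x"]] by simp
    then show "((\<lambda>s. kerJ e (s - x)) has_vector_derivative kerI e (s - x)) (at s within {-M..M})" for s
      by (meson has_real_derivative_iff_has_vector_derivative has_vector_derivative_at_within)
  qed
  moreover have "kerJ e (M - x) = M - x" "kerJ e (- M - x) = 0"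
    using assms ker_right[of "M - x"] ker_left[of "- M - x"] by (auto simp: abs_le_iff)
  ultimately show ?thesis by simp
qed

end

subsection \<open>Calculus in the plane\<close>

text \<open>The partial derivatives are arguments instead of values of a differential operator, so
  that product and chain rules compose as theorems and deliver the derivatives as explicit
  terms.\<close>

definition C1_plane :: "(real \<times> real \<Rightarrow> 'a::real_normed_vector) \<Rightarrow> (real \<times> real \<Rightarrow> 'a) \<Rightarrow> (real \<times> real \<Rightarrow> 'a) \<Rightarrow> bool" where
  "C1_plane f fx fy \<longleftrightarrow> (\<forall>z. (f has_derivative (\<lambda>v. fst v *\<^sub>R fx z + snd v *\<^sub>R fy z)) (at z)) \<and>
     continuous_on UNIV fx \<and> continuous_on UNIV fy"

lemma C1_planeD:
  assumes "C1_plane f fx fy"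
  shows "(f has_derivative (\<lambda>v. fst v *\<^sub>R fx z + snd v *\<^sub>R fy z)) (at z within A)"
    "continuous_on A f" "continuous_on A fx" "continuous_on A fy"
    "((\<lambda>a. f (a, y)) has_vector_derivative fx (x, y)) (at x within X)"
    "((\<lambda>b. f (x, b)) has_vector_derivative fy (x, y)) (at y within Y)"
proof -
  have d: "(f has_derivative (\<lambda>v. fst v *\<^sub>R fx z + snd v *\<^sub>R fy z)) (at z)" for z
    using assms unfolding C1_plane_def by blast
  then show "(f has_derivative (\<lambda>v. fst v *\<^sub>R fx z + snd v *\<^sub>R fy z)) (at z within A)"
    using has_derivative_at_withinI by blast
  show "continuous_on A f"
    by (meson continuous_at_imp_continuous_on d has_derivative_continuous)
  show "continuous_on A fx" "continuous_on A fy"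
    using assms by (auto simp: C1_plane_def intro: continuous_on_subset)
  have "((\<lambda>a. f (a, y)) has_derivative (\<lambda>h. fst (h, 0::real) *\<^sub>R fx (x, y) + snd (h, 0::real) *\<^sub>R fy (x, y))) (at x)"
    by (rule has_derivative_compose[OF _ d, of "\<lambda>a. (a, y)" _ x, simplified]) (auto intro!: derivative_eq_intros)
  then show "((\<lambda>a. f (a, y)) has_vector_derivative fx (x, y)) (at x within X)"
    by (simp add: has_vector_derivative_def has_derivative_at_withinI)
  have "((\<lambda>b. f (x, b)) has_derivative (\<lambda>h. fst (0::real, h) *\<^sub>R fx (x, y) + snd (0::real, h) *\<^sub>R fy (x, y))) (at y)"
    by (rule has_derivative_compose[OF _ d, of "\<lambda>b. (x, b)" _ y, simplified]) (auto intro!: derivative_eq_intros)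
  then show "((\<lambda>b. f (x, b)) has_vector_derivative fy (x, y)) (at y within Y)"
    by (simp add: has_vector_derivative_def has_derivative_at_withinI)
qed

lemma (in bounded_bilinear) C1_plane:
  assumes f: "C1_plane f fx fy" and g: "C1_plane g gx gy"
  shows "C1_plane (\<lambda>z. prod (f z) (g z)) (\<lambda>z. prod (f z) (gx z) + prod (fx z) (g z)) (\<lambda>z. prod (f z) (gy z) + prod (fy z) (g z))"
  unfolding C1_plane_def
proof (intro conjI allI)
  show "((\<lambda>z. prod (f z) (g z)) has_derivative (\<lambda>v. fst v *\<^sub>R (prod (f z) (gx z) + prod (fx z) (g z)) + snd v *\<^sub>R (prod (f z) (gy z) + prod (fy z) (g z)))) (at z)" for z
    by (rule has_derivative_eq_rhs[OF FDERIV[OF C1_planeD(1)[OF f] C1_planeD(1)[OF g]]])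
      (simp add: fun_eq_iff add_left add_right scaleR_left scaleR_right scaleR_add_right)
qed (use C1_planeD[OF f] C1_planeD[OF g] in \<open>auto intro!: continuous_on_add continuous_on\<close>)

lemmas C1_plane_mult = bounded_bilinear.C1_plane[OF bounded_bilinear_mult]

lemma C1_plane_linear:
  assumes "bounded_linear h" "C1_plane f fx fy"
  shows "C1_plane (\<lambda>z. h (f z)) (\<lambda>z. h (fx z)) (\<lambda>z. h (fy z))"
proof -
  interpret h: bounded_linear h by fact
  show ?thesis unfolding C1_plane_def
  proof (intro conjI allI)
    show "((\<lambda>z. h (f z)) has_derivative (\<lambda>v. fst v *\<^sub>R h (fx z) + snd v *\<^sub>R h (fy z))) (at z)" for z
      by (rule has_derivative_eq_rhs[OF h.has_derivative[OF C1_planeD(1)[OF assms(2)]]])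
        (simp add: fun_eq_iff h.add h.scaleR)
  qed (use C1_planeD[OF assms(2)] in \<open>auto intro!: h.continuous_on\<close>)
qed

lemma C1_plane_compose_real:
  assumes f: "C1_plane f fx fy" and h: "\<And>s. (h has_real_derivative h' s) (at s)" and h': "continuous_on UNIV h'"
  shows "C1_plane (\<lambda>z. h (f z)) (\<lambda>z. h' (f z) * fx z) (\<lambda>z. h' (f z) * fy z)"
  unfolding C1_plane_def
proof (intro conjI allI)
  show "((\<lambda>z. h (f z)) has_derivative (\<lambda>v. fst v *\<^sub>R (h' (f z) * fx z) + snd v *\<^sub>R (h' (f z) * fy z))) (at z)" for z
    by (rule has_derivative_eq_rhs[OF has_derivative_compose[OF C1_planeD(1)[OF f] h[unfolded has_field_derivative_def]]])
      (simp add: fun_eq_iff algebra_simps)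
qed (use C1_planeD[OF f] h' in \<open>auto intro!: continuous_intros continuous_on_compose2[OF h']\<close>)

lemma C1_plane_diff:
  assumes "C1_plane f fx fy" "C1_plane g gx gy"
  shows "C1_plane (\<lambda>z. f z - g z) (\<lambda>z. fx z - gx z) (\<lambda>z. fy z - gy z)"
  unfolding C1_plane_def
proof (intro conjI allI)
  show "((\<lambda>z. f z - g z) has_derivative (\<lambda>v. fst v *\<^sub>R (fx z - gx z) + snd v *\<^sub>R (fy z - gy z))) (at z)" for z
    by (rule has_derivative_eq_rhs[OF has_derivative_diff[OF C1_planeD(1)[OF assms(1)] C1_planeD(1)[OF assms(2)]]])
      (simp add: fun_eq_iff algebra_simps)
qed (use C1_planeD[OF assms(1)] C1_planeD[OF assms(2)] in \<open>auto intro!: continuous_intros\<close>)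

lemma C1_plane_const: "C1_plane (\<lambda>z. c) (\<lambda>z. 0) (\<lambda>z. 0)"
  by (simp add: C1_plane_def)

text \<open>The inequality is not strict, so a function that vanishes beyond M is 0 on the boundary
  of \<open>square M\<close>; this is what kills the boundary terms.\<close>

definition vanishes_beyond :: "real \<Rightarrow> ('a::real_normed_vector \<Rightarrow> 'b::zero) \<Rightarrow> bool" where
  "vanishes_beyond M f \<longleftrightarrow> (\<forall>z. M \<le> norm z \<longrightarrow> f z = 0)"

lemma vanishes_beyondD: "vanishes_beyond M f \<Longrightarrow> M \<le> norm z \<Longrightarrow> f z = 0"
  by (simp add: vanishes_beyond_def)

lemma vanishes_beyond_mono: "vanishes_beyond M f \<Longrightarrow> M \<le> N \<Longrightarrow> vanishes_beyond N f"
  by (auto simp: vanishes_beyond_def)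

lemma vanishes_beyond_closure:
  fixes f :: "'a::euclidean_space \<Rightarrow> 'b::real_normed_vector"
  assumes "M > 0" "continuous_on UNIV f" "\<And>z. M < norm z \<Longrightarrow> f z = 0"
  shows "vanishes_beyond M f"
proof -
  have "closure (- cball 0 M) \<subseteq> {z. f z = 0}"
    by (rule closure_minimal) (use assms in \<open>auto intro: closed_Collect_eq\<close>)
  then show ?thesis by (auto simp: closure_complement vanishes_beyond_def subset_iff)
qed

lemma C1_plane_vanishes:
  assumes f: "C1_plane f fx fy" and M: "vanishes_beyond M f" "M > 0"
  shows "vanishes_beyond M fx" "vanishes_beyond M fy"
proof -
  have "fx z = 0 \<and> fy z = 0" if "M < norm z" for z
  proof -
    have "((\<lambda>z. 0) has_derivative (\<lambda>v. fst v *\<^sub>R fx z + snd v *\<^sub>R fy z)) (at z)"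
      by (rule has_derivative_transform_within_open[OF C1_planeD(1)[OF f], of "- cball 0 M"])
        (use that M in \<open>auto simp: vanishes_beyond_def\<close>)
    then have "(\<lambda>v. fst v *\<^sub>R fx z + snd v *\<^sub>R fy z) = (\<lambda>v. 0)"
      by (rule has_derivative_unique) auto
    from fun_cong[OF this, of "(1, 0)"] fun_cong[OF this, of "(0, 1)"] show ?thesis by simp
  qed
  then show "vanishes_beyond M fx" "vanishes_beyond M fy"
    using vanishes_beyond_closure[OF M(2)] C1_planeD[OF f] by blast+
qed

abbreviation square :: "real \<Rightarrow> (real \<times> real) set" where
  "square M \<equiv> cbox (- M, - M) (M, M)"

lemma norm_le_imp_square: "norm z \<le> M \<Longrightarrow> z \<in> square M"
  using norm_fst_le[of "fst z" "snd z"] norm_snd_le[of "snd z" "fst z"] by (cases z) (auto simp: abs_le_iff)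

lemma integral_UNIV_eq_square:
  fixes f :: "real \<times> real \<Rightarrow> 'a::euclidean_space"
  assumes "vanishes_beyond M f"
  shows "integral UNIV f = integral (square M) f"
proof (rule integral_spike_set[symmetric])
  have "f z = 0" if "z \<notin> square M" for z
    using assms norm_le_imp_square[of z M] that unfolding vanishes_beyond_def by (meson linear)
  then show "negligible {x \<in> square M - UNIV. f x \<noteq> 0}" "negligible {x \<in> UNIV - square M. f x \<noteq> 0}"
    by (auto intro!: empty_imp_negligible)
qed

lemma integral_partial_derivative_eq_0:
  fixes f :: "real \<times> real \<Rightarrow> 'a::euclidean_space"
  assumes f: "C1_plane f fx fy" and M: "vanishes_beyond M f" "M > 0"
  shows "integral (square M) fx = 0" "integral (square M) fy = 0"
proof -
  have z: "f (x, y) = 0" if "\<bar>x\<bar> = M \<or> \<bar>y\<bar> = M" for x y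
    using that M(1) norm_fst_le[of x y] norm_snd_le[of y x] by (auto simp: vanishes_beyond_def)
  have "((\<lambda>x. fx (x, y)) has_integral f (M, y) - f (-M, y)) {-M..M}" for y
    by (rule fundamental_theorem_of_calculus) (use M C1_planeD(5)[OF f] in auto)
  then have 1: "integral (cbox (-M) M) (\<lambda>x. fx (x, y)) = 0" for y
    using z M(2) by (auto intro!: integral_unique)
  have "((\<lambda>y. fy (x, y)) has_integral f (x, M) - f (x, -M)) {-M..M}" for x
    by (rule fundamental_theorem_of_calculus) (use M C1_planeD(6)[OF f] in auto)
  then have 2: "integral (cbox (-M) M) (\<lambda>y. fy (x, y)) = 0" for x
    using z M(2) by (auto intro!: integral_unique)
  have "integral (square M) fx = integral (cbox (-M) M) (\<lambda>x. integral (cbox (-M) M) (\<lambda>y. fx (x, y)))"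
    by (rule integral_prod_continuous) (rule C1_planeD[OF f])
  also have "\<dots> = integral (cbox (-M) M) (\<lambda>y. integral (cbox (-M) M) (\<lambda>x. fx (x, y)))"
    by (rule integral_swap_continuous) (use C1_planeD[OF f] in auto)
  also have "\<dots> = 0" by (simp only: 1 integral_0)
  finally show "integral (square M) fx = 0" .
  have "integral (square M) fy = integral (cbox (-M) M) (\<lambda>x. integral (cbox (-M) M) (\<lambda>y. fy (x, y)))"
    by (rule integral_prod_continuous) (rule C1_planeD[OF f])
  also have "\<dots> = 0" by (simp only: 2 integral_0)
  finally show "integral (square M) fy = 0" .
qed

text \<open>As \<open>py = qx\<close>, the integrand is the divergence (w q)_x - (w p)_y. In the
  applications (p, q) is a gradient, possibly multiplied by a function of its potential, and w
  contains kernels. Vanishing is asked of p and q and not of w, since such kernels are constant but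
  not zero far out.\<close>

lemma integral_jacobian_eq_0:
  fixes w p q :: "real \<times> real \<Rightarrow> real"
  assumes w: "C1_plane w wx wy" and p: "C1_plane p px py" and q: "C1_plane q qx qy" and pq: "py = qx"
    and M: "vanishes_beyond M p" "vanishes_beyond M q" "M > 0"
  shows "integral (square M) (\<lambda>z. wx z * q z - wy z * p z) = 0"
proof -
  note 1 = C1_plane_mult[OF w q] and 2 = C1_plane_mult[OF w p]
  have *: "vanishes_beyond M (\<lambda>z. w z * q z)" "vanishes_beyond M (\<lambda>z. w z * p z)"
    using M by (auto simp: vanishes_beyond_def)
  have "integral (square M) (\<lambda>z. wx z * q z - wy z * p z) = integral (square M) (\<lambda>z. (w z * qx z + wx z * q z) - (w z * py z + wy z * p z))"
    by (simp add: pq)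
  also have "\<dots> = integral (square M) (\<lambda>z. w z * qx z + wx z * q z) - integral (square M) (\<lambda>z. w z * py z + wy z * p z)"
    by (rule integral_diff) (use C1_planeD[OF 1] C1_planeD[OF 2] in \<open>auto intro!: integrable_continuous\<close>)
  also have "\<dots> = 0"
    using integral_partial_derivative_eq_0(1)[OF 1 *(1) M(3)] integral_partial_derivative_eq_0(2)[OF 2 *(2) M(3)] by simp
  finally show ?thesis .
qed

text \<open>Leibniz's rule for operator valued derivatives, translated to gradients:
  \<open>blinfun_inner_left\<close> is bounded linear in the gradient and so commutes with the
  integral.\<close>

lemma has_derivative_integral_gradient:
  fixes F :: "'a::euclidean_space \<Rightarrow> 'b::euclidean_space \<Rightarrow> real" and V :: "'a \<Rightarrow> 'b \<Rightarrow> 'a"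
  assumes der: "\<And>p z. ((\<lambda>p. F p z) has_derivative (\<lambda>v. V p z \<bullet> v)) (at p)"
    and F: "\<And>p. continuous_on UNIV (F p)" and V: "continuous_on UNIV (\<lambda>(p, z). V p z)"
  shows "((\<lambda>p. integral (cbox a b) (F p)) has_derivative (\<lambda>v. integral (cbox a b) (V p) \<bullet> v)) (at p)"
proof -
  have Vc: "continuous_on A (V p)" for p A
    by (rule continuous_on_compose2[OF V, of A "\<lambda>z. (p, z)", simplified])
      (rule continuous_on_Pair[OF continuous_on_const continuous_on_id])
  have bl: "bounded_linear (blinfun_inner_left :: 'a \<Rightarrow> _)" by (rule bounded_linear_blinfun_inner_left)
  have "((\<lambda>p. integral (cbox a b) (F p)) has_derivative
      blinfun_apply (integral (cbox a b) (\<lambda>z. blinfun_inner_left (V p z)))) (at p within UNIV)"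
  proof (rule leibniz_rule)
    show "((\<lambda>p. F p t) has_derivative blinfun_apply (blinfun_inner_left (V x t))) (at x within UNIV)" for x t
      using der[where p = x and z = t] by (simp add: inner_commute)
    show "F x integrable_on cbox a b" for x
      using F by (meson continuous_on_subset integrable_continuous subset_UNIV)
    show "continuous_on (UNIV \<times> cbox a b) (\<lambda>(x, t). blinfun_inner_left (V x t))"
      using bounded_linear.continuous_on[OF bl continuous_on_subset[OF V subset_UNIV]]
      by (simp add: case_prod_beta)
  qed auto
  moreover have "integral (cbox a b) (\<lambda>z. blinfun_inner_left (V p z)) = blinfun_inner_left (integral (cbox a b) (V p))"
    using integral_linear[OF integrable_continuous[OF Vc] bl] by (simp add: o_def)
  ultimately show ?thesis by (simp add: inner_commute)
qed

subsection \<open>The mollified winding number of a surface\<close>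

lemma has_integral_prod3:
  fixes f g h :: "real \<Rightarrow> real"
  assumes c: "continuous_on UNIV f" "continuous_on UNIV g" "continuous_on UNIV h"
    and i: "(f has_integral I) {-N..N}" "(g has_integral J) {-N..N}" "(h has_integral K) {-N..N}"
  shows "integral (cbox (-N, -N, -N) (N, N, N)) (\<lambda>(x, y, z). f x * g y * h z) = I * J * K"
proof -
  have cc: "continuous_on A f" "continuous_on A g" "continuous_on A h" for A
    using c by (auto intro: continuous_on_subset)
  have c': "continuous_on A (\<lambda>p. f (u p))" "continuous_on A (\<lambda>p. g (u p))" "continuous_on A (\<lambda>p. h (u p))"
    if "continuous_on A u" for A u
    using that c by (auto intro: continuous_on_compose2)
  have i': "integral (cbox (-N) N) f = I" "integral (cbox (-N) N) g = J" "integral (cbox (-N) N) h = K"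
    using i by (simp_all add: integral_unique)
  have inner: "integral (cbox (-N, -N) (N, N)) (\<lambda>q. f x * (g (fst q) * h (snd q))) = f x * (J * K)" for x
  proof -
    have "integral (cbox (-N, -N) (N, N)) (\<lambda>q. g (fst q) * h (snd q)) = J * K"
      by (subst integral_prod_continuous) (auto intro!: continuous_intros c' simp: i' i'[unfolded cbox_interval])
    then show ?thesis by simp
  qed
  have "integral (cbox (-N, -N, -N) (N, N, N)) (\<lambda>(x, y, z). f x * g y * h z)
    = integral (cbox (-N) N) (\<lambda>x. integral (cbox (-N, -N) (N, N)) (\<lambda>q. f x * (g (fst q) * h (snd q))))"
    by (subst integral_prod_continuous)
      (auto simp: case_prod_beta mult.assoc intro!: continuous_intros c')
  also have "\<dots> = integral (cbox (-N) N) (\<lambda>x. f x * (J * K))" by (simp only: inner)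
  also have "\<dots> = I * J * K"
    by (simp add: i'[unfolded cbox_interval] mult.assoc)
  finally show ?thesis .
qed

text \<open>The map (a, b, c) from the plane to space. Second derivatives are included for a and b
  only, because their gradients serve as the curl-free fields of
  \<open>integral_jacobian_eq_0\<close>, while c enters through the other factor. The repeated
  \<open>axy\<close> and \<open>bxy\<close> build in the symmetry of mixed derivatives. The prime in
  \<open>by'\<close> avoids a keyword.\<close>

locale compact_surface =
  fixes a b c ax ay axx axy ayy bx by' bxx bxy byy cx cy :: "real \<times> real \<Rightarrow> real" and M :: real
  assumes C1: "C1_plane a ax ay" "C1_plane ax axx axy" "C1_plane ay axy ayy"
    "C1_plane b bx by'" "C1_plane bx bxx bxy" "C1_plane by' bxy byy" "C1_plane c cx cy"
    and M: "M > 0" "vanishes_beyond M a" "vanishes_beyond M b" "vanishes_beyond M c"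
begin

text \<open>\<open>n1\<close>, \<open>n2\<close>, \<open>n3\<close> are the components of the cross
  product of the two partial derivatives of (a, b, c), that is, the normal with length the area
  element. \<open>nn\<close> collects them in the product space in which the Sobolev inequality is
  stated.\<close>

definition "n1 z = bx z * cy z - by' z * cx z"
definition "n2 z = cx z * ay z - cy z * ax z"
definition "n3 z = ax z * by' z - ay z * bx z"
definition "nn z = (n1 z, n2 z, n3 z)"

definition "kk1 e p z = ker0 e (fst p - a z)"
definition "kk2 e p z = ker0 e (fst (snd p) - b z)"
definition "kk3 e p z = ker0 e (snd (snd p) - c z)"
definition "kkI e p z = kerI e (snd (snd p) - c z)"

text \<open>As \<open>e\<close> tends to 0, this tends to the winding number of the surface around \<open>p\<close>, counted along
  the ray that leaves \<open>p\<close> in the negative third direction.\<close>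

definition "degree_density e p z = kk1 e p z * kk2 e p z * kkI e p z * n3 z"
definition "mollified_degree e p = integral (square M) (degree_density e p)"
text \<open>The integrand of the gradient of the mollified winding number: the product mollifier,
  evaluated at p minus the surface point, spreads out the normal.\<close>

definition "gradient_density e p z = (kk1 e p z * kk2 e p z * kk3 e p z) *\<^sub>R nn z"

lemma vanish: "vanishes_beyond M ax" "vanishes_beyond M ay" "vanishes_beyond M bx" "vanishes_beyond M by'"
  using C1_plane_vanishes[OF C1(1) M(2,1)] C1_plane_vanishes[OF C1(4) M(3,1)] by auto

lemma cont [continuous_intros]:
  assumes "continuous_on A u"
  shows "continuous_on A (\<lambda>x. a (u x))" "continuous_on A (\<lambda>x. b (u x))" "continuous_on A (\<lambda>x. c (u x))"
    "continuous_on A (\<lambda>x. n1 (u x))" "continuous_on A (\<lambda>x. n2 (u x))" "continuous_on A (\<lambda>x. n3 (u x))"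
    "continuous_on A (\<lambda>x. nn (u x))"
proof -
  have *: "continuous_on UNIV f \<Longrightarrow> continuous_on A (\<lambda>x. f (u x))" for f :: "real \<times> real \<Rightarrow> 'z::topological_space"
    using assms by (auto intro: continuous_on_compose2)
  show "continuous_on A (\<lambda>x. a (u x))" "continuous_on A (\<lambda>x. b (u x))" "continuous_on A (\<lambda>x. c (u x))"
    by (intro * C1_planeD[OF C1(1)] C1_planeD[OF C1(4)] C1_planeD[OF C1(7)])+
  show 1: "continuous_on A (\<lambda>x. n1 (u x))" "continuous_on A (\<lambda>x. n2 (u x))" "continuous_on A (\<lambda>x. n3 (u x))"
    unfolding n1_def n2_def n3_def
    by (intro continuous_intros *[OF C1_planeD(3)[OF C1(1)]] *[OF C1_planeD(4)[OF C1(1)]] *[OF C1_planeD(3)[OF C1(4)]]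
       *[OF C1_planeD(4)[OF C1(4)]] *[OF C1_planeD(3)[OF C1(7)]] *[OF C1_planeD(4)[OF C1(7)]])+
  show "continuous_on A (\<lambda>x. nn (u x))"
    unfolding nn_def by (intro continuous_intros 1)
qed

text \<open>In each case the difference of the two sides is an integral to which
  \<open>integral_jacobian_eq_0\<close> applies. The first two move a derivative off a kernel, so
  that all components of the gradient acquire the same product kernel. The next two say that the
  projection of a closed surface to a plane has signed area 0, also when weighted by a function of
  the projected point. The last two compare the three coordinate formulas for the enclosed
  volume.\<close>

lemma jacobian_identities:
  assumes e: "e > 0"
  shows "integral (square M) (\<lambda>z. kerD e (fst p - a z) * kk2 e p z * kkI e p z * n3 z)
      = integral (square M) (\<lambda>z. kk1 e p z * kk2 e p z * kk3 e p z * n1 z)" (is ?A)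
    and "integral (square M) (\<lambda>z. kk1 e p z * kerD e (fst (snd p) - b z) * kkI e p z * n3 z)
      = integral (square M) (\<lambda>z. kk1 e p z * kk2 e p z * kk3 e p z * n2 z)" (is ?B)
    and "integral (square M) (\<lambda>z. kk1 e p z * kk2 e p z * n3 z) = 0"
    and "integral (square M) n3 = 0"
    and "integral (square M) (\<lambda>z. a z * n1 z) = integral (square M) (\<lambda>z. c z * n3 z)" (is ?C)
    and "integral (square M) (\<lambda>z. b z * n2 z) = integral (square M) (\<lambda>z. c z * n3 z)" (is ?D)
proof -
  have sub: "C1_plane (\<lambda>z. q - f z) (\<lambda>z. - fx z) (\<lambda>z. - fy z)" if "C1_plane f fx fy" for q :: real and f fx fy
    using C1_plane_diff[OF C1_plane_const that] by simp
  have ker: "C1_plane (\<lambda>z. ker0 e (q - f z)) (\<lambda>z. kerD e (q - f z) * - fx z) (\<lambda>z. kerD e (q - f z) * - fy z)"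
     "C1_plane (\<lambda>z. kerI e (q - f z)) (\<lambda>z. ker0 e (q - f z) * - fx z) (\<lambda>z. ker0 e (q - f z) * - fy z)"
    if "C1_plane f fx fy" for q :: real and f fx fy
    using C1_plane_compose_real[OF sub[OF that] DERIV_ker(1)[OF e]] C1_plane_compose_real[OF sub[OF that] DERIV_ker(2)[OF e]]
      continuous_on_ker[OF e continuous_on_id] by auto
  have I: "integral (square M) h = 0"
    if "C1_plane w wx wy" "C1_plane p px py" "C1_plane q qx qy" "\<And>z. py z = qx z" "vanishes_beyond M p" "vanishes_beyond M q"
      "\<And>z. h z = wx z * q z - wy z * p z" for w wx wy p px py q qx qy h :: "real \<times> real \<Rightarrow> real"
  proof -
    have "py = qx" using that(4) by (rule ext)
    moreover have "h = (\<lambda>z. wx z * q z - wy z * p z)" using that(7) by (rule ext)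
    ultimately show ?thesis using integral_jacobian_eq_0[OF that(1-3) _ that(5,6) M(1)] by blast
  qed
  note cu = continuous_on_ker[OF e]
  note k = kk1_def kk2_def kk3_def kkI_def n1_def n2_def n3_def
  have v: "vanishes_beyond M (\<lambda>z. h z * f z)" if "vanishes_beyond M f" for h f :: "real \<times> real \<Rightarrow> real"
    using that by (simp add: vanishes_beyond_def)
  \<comment> \<open>Here w is the product of the kernels in a and c, and (p, q) is the kernel in b
    times the gradient of b; \<open>i2\<close> exchanges the roles of a and b.\<close>
  have i1: "integral (square M) (\<lambda>z. kk1 e p z * kk2 e p z * kk3 e p z * n1 z - kerD e (fst p - a z) * kk2 e p z * kkI e p z * n3 z) = 0"
    by (rule I[OF C1_plane_mult[OF ker(1)[OF C1(1), of "fst p"] ker(2)[OF C1(7), of "snd (snd p)"]]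
        C1_plane_mult[OF ker(1)[OF C1(4), of "fst (snd p)"] C1(5)] C1_plane_mult[OF ker(1)[OF C1(4), of "fst (snd p)"] C1(6)]
        _ v[OF vanish(3)] v[OF vanish(4)]]; simp add: k algebra_simps)
  have i2: "integral (square M) (\<lambda>z. kk1 e p z * kerD e (fst (snd p) - b z) * kkI e p z * n3 z - kk1 e p z * kk2 e p z * kk3 e p z * n2 z) = 0"
    by (rule I[OF C1_plane_mult[OF ker(1)[OF C1(4), of "fst (snd p)"] ker(2)[OF C1(7), of "snd (snd p)"]]
        C1_plane_mult[OF ker(1)[OF C1(1), of "fst p"] C1(2)] C1_plane_mult[OF ker(1)[OF C1(1), of "fst p"] C1(3)]
        _ v[OF vanish(1)] v[OF vanish(2)]]; simp add: k algebra_simps)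
  have i3: "integral (square M) (\<lambda>z. - (kk1 e p z * kk2 e p z * n3 z)) = 0"
    by (rule I[OF ker(2)[OF C1(1), of "fst p"]
        C1_plane_mult[OF ker(1)[OF C1(4), of "fst (snd p)"] C1(5)] C1_plane_mult[OF ker(1)[OF C1(4), of "fst (snd p)"] C1(6)]
        _ v[OF vanish(3)] v[OF vanish(4)]]; simp add: k algebra_simps)
  show "integral (square M) n3 = 0"
    by (rule I[OF C1(1,5,6) _ vanish(3,4)]; simp add: k algebra_simps)
  have i4: "integral (square M) (\<lambda>z. c z * n3 z - a z * n1 z) = 0"
    by (rule I[OF C1_plane_mult[OF C1(1) C1(7)] C1(5,6) _ vanish(3,4)]; simp add: k algebra_simps)
  have i5: "integral (square M) (\<lambda>z. b z * n2 z - c z * n3 z) = 0"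
    by (rule I[OF C1_plane_mult[OF C1(4) C1(7)] C1(2,3) _ vanish(1,2)]; simp add: k algebra_simps)
  have eqI: "integral (square M) f = integral (square M) g"
    if "integral (square M) (\<lambda>z. f z - g z) = 0" "continuous_on UNIV f" "continuous_on UNIV g" for f g :: "real \<times> real \<Rightarrow> real"
  proof -
    have "f integrable_on square M" "g integrable_on square M"
      using that by (auto intro: integrable_continuous continuous_on_subset)
    then show ?thesis using that(1) integral_diff[of f "square M" g] by simp
  qed
  have [continuous_intros]: "continuous_on A (kk1 e p)" "continuous_on A (kk2 e p)" "continuous_on A (kk3 e p)" "continuous_on A (kkI e p)" for A
    unfolding kk1_def[abs_def] kk2_def[abs_def] kk3_def[abs_def] kkI_def[abs_def] by (auto intro!: continuous_intros cu)
  show ?A by (rule eqI[symmetric, OF i1]) (auto intro!: continuous_intros cu)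
  show ?B by (rule eqI[OF i2]) (auto intro!: continuous_intros cu)
  show "integral (square M) (\<lambda>z. kk1 e p z * kk2 e p z * n3 z) = 0" using i3 by simp
  show ?C by (rule eqI[symmetric, OF i4]) (auto intro!: continuous_intros)
  show ?D by (rule eqI[OF i5]) (auto intro!: continuous_intros)
qed

lemma continuous_on_densities [continuous_intros]:
  assumes "e > 0" "continuous_on A u" "continuous_on A v"
  shows "continuous_on A (\<lambda>x. kk1 e (u x) (v x))" "continuous_on A (\<lambda>x. kk2 e (u x) (v x))"
    "continuous_on A (\<lambda>x. kk3 e (u x) (v x))" "continuous_on A (\<lambda>x. kkI e (u x) (v x))"
    "continuous_on A (\<lambda>x. degree_density e (u x) (v x))" "continuous_on A (\<lambda>x. gradient_density e (u x) (v x))"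
proof -
  show 1: "continuous_on A (\<lambda>x. kk1 e (u x) (v x))" "continuous_on A (\<lambda>x. kk2 e (u x) (v x))"
    "continuous_on A (\<lambda>x. kk3 e (u x) (v x))" "continuous_on A (\<lambda>x. kkI e (u x) (v x))"
    unfolding kk1_def kk2_def kk3_def kkI_def using assms
    by (auto intro!: continuous_intros continuous_on_ker)
  show "continuous_on A (\<lambda>x. degree_density e (u x) (v x))" "continuous_on A (\<lambda>x. gradient_density e (u x) (v x))"
    unfolding degree_density_def gradient_density_def using assms(3)
    by (auto intro!: continuous_intros 1)
qed

text \<open>Differentiation under the integral gives V. Its third component already has the desired
  form, since the derivative of \<open>kerI\<close> is \<open>ker0\<close>; the other two are
  brought into it by the first two Jacobian identities.\<close>

lemma has_derivative_mollified_degree: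
  assumes e: "e > 0"
  shows "(mollified_degree e has_derivative (\<lambda>v. integral (square M) (gradient_density e p) \<bullet> v)) (at p)"
proof -
  define V where "V p z = (kerD e (fst p - a z) * kk2 e p z * kkI e p z * n3 z,
     kk1 e p z * kerD e (fst (snd p) - b z) * kkI e p z * n3 z, kk1 e p z * kk2 e p z * kk3 e p z * n3 z)" for p z
  have D: "((\<lambda>p. h (u p - q)) has_derivative (\<lambda>v. h' (u p - q) * u v)) (at p)"
    if "bounded_linear u" "\<And>s. (h has_real_derivative h' s) (at s)" for h h' :: "real \<Rightarrow> real" and u :: "real \<times> real \<times> real \<Rightarrow> real" and p q
    by (rule has_derivative_eq_rhs[OF has_derivative_compose[OF _ that(2)[unfolded has_field_derivative_def], of _ "\<lambda>v. u v"]])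
      (auto intro!: derivative_eq_intros bounded_linear_imp_has_derivative that(1))
  have bl: "bounded_linear (\<lambda>p::real\<times>real\<times>real. fst (snd p))" "bounded_linear (\<lambda>p::real\<times>real\<times>real. snd (snd p))"
    by (auto intro!: bounded_linear_intros)
  have der: "((\<lambda>p. degree_density e p z) has_derivative (\<lambda>v. V p z \<bullet> v)) (at p)" for p z
    unfolding degree_density_def kk1_def kk2_def kkI_def
    by (rule has_derivative_eq_rhs[OF has_derivative_mult[OF has_derivative_mult[OF has_derivative_mult[OF
        D[OF bounded_linear_fst DERIV_ker(1)[OF e]] D[OF bl(1) DERIV_ker(1)[OF e]]] D[OF bl(2) DERIV_ker(2)[OF e]]] has_derivative_const]])
      (auto simp: V_def kk1_def kk2_def kk3_def kkI_def fun_eq_iff inner_prod_def algebra_simps)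
  have V: "continuous_on UNIV (\<lambda>(p, z). V p z)"
    unfolding V_def case_prod_beta using e by (auto intro!: continuous_intros continuous_on_ker)
  have "(mollified_degree e has_derivative (\<lambda>v. integral (square M) (V p) \<bullet> v)) (at p)"
    unfolding mollified_degree_def[abs_def]
    by (rule has_derivative_integral_gradient[OF der _ V]) (use e in \<open>auto intro!: continuous_intros\<close>)
  moreover have "integral (square M) (V p) = integral (square M) (gradient_density e p)"
  proof -
    have Vc: "continuous_on (square M) (V p)"
      unfolding V_def using e by (auto intro!: continuous_intros continuous_on_ker)
    have Gc: "continuous_on (square M) (gradient_density e p)"
      using e by (auto intro!: continuous_intros)
    have P: "integral (square M) f = (integral (square M) (\<lambda>z. fst (f z)), integral (square M) (\<lambda>z. fst (snd (f z))), integral (square M) (\<lambda>z. snd (snd (f z))))"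
      if f: "continuous_on (square M) f" for f :: "real \<times> real \<Rightarrow> real \<times> real \<times> real"
      using integral_linear[OF integrable_continuous[OF f] bounded_linear_fst]
        integral_linear[OF integrable_continuous[OF f] bl(1)] integral_linear[OF integrable_continuous[OF f] bl(2)]
      by (simp add: o_def prod_eq_iff)
    show ?thesis
      unfolding P[OF Vc] P[OF Gc] using jacobian_identities(1,2)[OF e, of p]
      by (simp add: V_def gradient_density_def nn_def mult.assoc)
  qed
  ultimately show ?thesis by simp
qed

end

section \<open>The volume estimate for the mollified winding number and its limit\<close>

lemma nn_integral_eq_integral_cbox:
  fixes f :: "'a::euclidean_space \<Rightarrow> real"
  assumes "continuous_on UNIV f" "\<And>x. 0 \<le> f x" "\<And>x. x \<notin> cbox l u \<Longrightarrow> f x = 0"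
  shows "(\<integral>\<^sup>+x. ennreal (f x) \<partial>lborel) = ennreal (integral (cbox l u) f)"
proof (rule nn_integral_has_integral_lborel)
  have "(f has_integral integral (cbox l u) f) (cbox l u)"
    using assms(1) by (intro integrable_integral integrable_continuous) (auto intro: continuous_on_subset)
  then show "(f has_integral integral (cbox l u) f) UNIV"
    by (rule has_integral_on_superset) (use assms in auto)
qed (use assms in \<open>auto intro: borel_measurable_continuous_onI\<close>)

text \<open>Bounded, continuous and zero at the integers: this is how integrality of the limit is used.\<close>

definition integer_defect :: "real \<Rightarrow> real" where
  "integer_defect x = max 0 (\<bar>x\<bar> - \<bar>x\<bar> * sqrt \<bar>x\<bar>)"

lemma integer_defect_Ints: "x \<in> \<int> \<Longrightarrow> integer_defect x = 0"
proof -
  assume "x \<in> \<int>"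
  then obtain k :: int where k: "x = of_int k" by (auto elim: Ints_cases)
  show ?thesis
  proof (cases "k = 0")
    case False
    then have "1 \<le> \<bar>x\<bar>" using k by simp
    then have "1 \<le> sqrt \<bar>x\<bar>" by simp
    then have "\<bar>x\<bar> * 1 \<le> \<bar>x\<bar> * sqrt \<bar>x\<bar>" by (intro mult_left_mono) auto
    then show ?thesis by (simp add: integer_defect_def)
  qed (simp add: k integer_defect_def)
qed

lemma integer_defect_bounds: "0 \<le> integer_defect x" "integer_defect x \<le> 1"
  "\<bar>x\<bar> \<le> \<bar>x\<bar> * sqrt \<bar>x\<bar> + integer_defect x"
proof -
  show "integer_defect x \<le> 1"
  proof (cases "\<bar>x\<bar> \<le> 1")
    case True
    have "0 \<le> \<bar>x\<bar> * sqrt \<bar>x\<bar>" by simp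
    with True have "\<bar>x\<bar> - \<bar>x\<bar> * sqrt \<bar>x\<bar> \<le> 1" by linarith
    then show ?thesis by (simp add: integer_defect_def)
  next
    case False
    then have "\<bar>x\<bar> * 1 \<le> \<bar>x\<bar> * sqrt \<bar>x\<bar>" by (intro mult_left_mono) auto
    then show ?thesis by (simp add: integer_defect_def)
  qed
qed (auto simp: integer_defect_def)

lemma continuous_on_integer_defect: "continuous_on A f \<Longrightarrow> continuous_on A (\<lambda>x. integer_defect (f x))"
  unfolding integer_defect_def by (intro continuous_intros)

abbreviation cube :: "real \<Rightarrow> (real \<times> real \<times> real) set" where
  "cube N \<equiv> cbox (- N, - N, - N) (N, N, N)"

lemma not_cube: "p \<notin> cube N \<Longrightarrow> N < \<bar>fst p\<bar> \<or> N < \<bar>fst (snd p)\<bar> \<or> N < \<bar>snd (snd p)\<bar>"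
  by (cases p) (auto simp: abs_if split: if_splits)

context compact_surface
begin

lemma bounded_range: "\<exists>B\<ge>0. \<forall>z. \<bar>a z\<bar> \<le> B \<and> \<bar>b z\<bar> \<le> B \<and> \<bar>c z\<bar> \<le> B"
proof -
  have "compact ((\<lambda>z. (a z, b z, c z)) ` cball 0 M)"
    by (intro compact_continuous_image continuous_on_Pair cont[OF continuous_on_id] compact_cball)
  then have "bounded ((\<lambda>z. (a z, b z, c z)) ` cball 0 M)" by (rule compact_imp_bounded)
  then obtain B where "\<forall>x\<in>(\<lambda>z. (a z, b z, c z)) ` cball 0 M. norm x \<le> B"
    unfolding bounded_iff by (rule exE)
  then have B: "norm (a z, b z, c z) \<le> B" if "z \<in> cball 0 M" for z
    by (rule bspec) (rule imageI[OF that])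
  have B0: "B \<ge> 0" by (rule order_trans[OF norm_ge_zero B[of 0]]) (use M(1) in simp)
  have "\<bar>a z\<bar> \<le> B \<and> \<bar>b z\<bar> \<le> B \<and> \<bar>c z\<bar> \<le> B" for z
  proof (cases "norm z \<le> M")
    case True
    then have "norm (a z, b z, c z) \<le> B" by (intro B) simp
    moreover have "\<bar>a z\<bar> \<le> norm (a z, b z, c z)" by (rule norm_fst_le[of "a z" "(b z, c z)", unfolded real_norm_def])
    moreover have "\<bar>b z\<bar> \<le> norm (b z, c z)" "\<bar>c z\<bar> \<le> norm (b z, c z)"
      by (rule norm_fst_le[of "b z" "c z", unfolded real_norm_def]) (rule norm_snd_le[of "c z" "b z", unfolded real_norm_def])
    moreover have "norm (b z, c z) \<le> norm (a z, b z, c z)" using norm_snd_le by blast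
    ultimately show ?thesis by linarith
  next
    case False
    then have "a z = 0" "b z = 0" "c z = 0" using M(2-4)[THEN vanishes_beyondD, of z] by simp_all
    then show ?thesis using B0 by simp
  qed
  then show ?thesis using B0 by blast
qed

context
  fixes B N e :: real
  assumes B: "\<And>z. \<bar>a z\<bar> \<le> B \<and> \<bar>b z\<bar> \<le> B \<and> \<bar>c z\<bar> \<le> B" and e: "e > 0" and N: "B + 3/2 * e \<le> N"
begin

text \<open>If one of the first two coordinates of p is far out, the corresponding
  \<open>ker0\<close> is 0. Far below the surface the ray meets nothing and \<open>kerI\<close> is
  0; far above it counts every sheet, \<open>kerI\<close> is 1, and the signed count is 0 by the
  third Jacobian identity.\<close>

lemma mollified_degree_vanishes:
  assumes "N \<le> \<bar>fst p\<bar> \<or> N \<le> \<bar>fst (snd p)\<bar> \<or> N \<le> \<bar>snd (snd p)\<bar>"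
  shows "mollified_degree e p = 0"
proof -
  have far: "ker0 e (s - f z) = 0" if "N \<le> \<bar>s\<bar>" "\<And>z. \<bar>f z\<bar> \<le> B" for s and f :: "real \<times> real \<Rightarrow> real" and z
    by (rule ker0_far[OF e]) (use that(1) that(2)[of z] N in linarith)
  have zero: ?thesis if "\<And>z. degree_density e p z = 0"
  proof -
    have "degree_density e p = (\<lambda>z. 0)" using that by (rule ext)
    then show ?thesis by (simp add: mollified_degree_def)
  qed
  consider "N \<le> \<bar>fst p\<bar>" | "N \<le> \<bar>fst (snd p)\<bar>" | "N \<le> - snd (snd p)" | "N \<le> snd (snd p)"
    using assms by linarith
  then show ?thesis
  proof cases
    case 1
    then have "degree_density e p z = 0" for z
      using far[of "fst p" a z] B by (simp add: degree_density_def kk1_def)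
    then show ?thesis by (rule zero)
  next
    case 2
    then have "degree_density e p z = 0" for z
      using far[of "fst (snd p)" b z] B by (simp add: degree_density_def kk2_def)
    then show ?thesis by (rule zero)
  next
    case 3
    then have "snd (snd p) - c z \<le> - (3/2) * e" for z using B[of z] N by (simp add: abs_le_iff)
    then have "degree_density e p z = 0" for z
      using ker_left[OF e] by (simp add: degree_density_def kkI_def)
    then show ?thesis by (rule zero)
  next
    case 4
    then have "snd (snd p) - c z \<ge> 3/2 * e" for z using B[of z] N by (simp add: abs_le_iff)
    then have "degree_density e p = (\<lambda>z. kk1 e p z * kk2 e p z * n3 z)"
      using ker_right[OF e] by (intro ext) (simp add: degree_density_def kkI_def)
    then show ?thesis using jacobian_identities(3)[OF e, of p] by (simp add: mollified_degree_def)
  qed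
qed

lemma integral_kernels:
  "integral (cube N) (\<lambda>p. kk1 e p z * kk2 e p z * kk3 e p z) = 1"
  "integral (cube N) (\<lambda>p. kk1 e p z * kk2 e p z * kkI e p z) = N - c z"
proof -
  have 0: "((\<lambda>s. ker0 e (s - f z)) has_integral 1) {-N..N}" if "\<And>z. \<bar>f z\<bar> \<le> B" for f :: "real \<times> real \<Rightarrow> real"
    by (rule has_integral_ker0[OF e]) (use that[of z] N in linarith)
  have I: "((\<lambda>s. kerI e (s - c z)) has_integral (N - c z)) {-N..N}"
    by (rule has_integral_kerI[OF e]) (use B[of z] N in linarith)
  have k: "continuous_on UNIV (\<lambda>s. ker0 e (s - q))" "continuous_on UNIV (\<lambda>s. kerI e (s - q))" for q
    using e by (auto intro!: continuous_intros continuous_on_ker)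
  show "integral (cube N) (\<lambda>p. kk1 e p z * kk2 e p z * kk3 e p z) = 1"
    using has_integral_prod3[OF k(1) k(1) k(1) 0[of a] 0[of b] 0[of c]] B
    by (simp add: kk1_def kk2_def kk3_def case_prod_unfold)
  show "integral (cube N) (\<lambda>p. kk1 e p z * kk2 e p z * kkI e p z) = N - c z"
    using has_integral_prod3[OF k(1) k(1) k(2) 0[of a] 0[of b] I] B
    by (simp add: kk1_def kk2_def kkI_def case_prod_unfold)
qed

lemma continuous_on_mollified_degree: "continuous_on A (mollified_degree e)"
  using has_derivative_mollified_degree[OF e]
  by (meson continuous_at_imp_continuous_on continuous_on_subset has_derivative_continuous subset_UNIV)

lemma continuous_on_integral_square:
  assumes "continuous_on UNIV (\<lambda>(p, z). f p z)"
  shows "continuous_on A (\<lambda>p. integral (square M) (f p :: _ \<Rightarrow> 'z::euclidean_space))"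
  by (rule integral_continuous_on_param[OF continuous_on_subset[OF assms subset_UNIV]])

lemma swap: "integral (cube N) (\<lambda>p. integral (square M) (f p)) = integral (square M) (\<lambda>z. integral (cube N) (\<lambda>p. f p z))"
  if "continuous_on UNIV (\<lambda>(p, z). f p z)" for f :: "_ \<Rightarrow> _ \<Rightarrow> real"
  using integral_swap_continuous[of "(-N, -N, -N)" "(-M, -M)" "(N, N, N)" "(M, M)" f]
    continuous_on_subset[OF that subset_UNIV] by (simp add: cbox_Pair_eq)

text \<open>After exchanging the integrals the kernels contribute N - c z, and N drops out because
  \<open>n3\<close> has integral 0.\<close>

lemma integral_mollified_degree:
  "integral (cube N) (mollified_degree e) = - integral (square M) (\<lambda>z. c z * n3 z)"
proof -
  have "integral (cube N) (mollified_degree e) = integral (square M) (\<lambda>z. integral (cube N) (\<lambda>p. degree_density e p z))"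
    unfolding mollified_degree_def[abs_def]
    by (rule swap) (use e in \<open>auto simp: case_prod_beta intro!: continuous_intros\<close>)
  also have "\<dots> = integral (square M) (\<lambda>z. (N - c z) * n3 z)"
    unfolding degree_density_def by (simp add: integral_kernels)
  also have "\<dots> = integral (square M) (\<lambda>z. N * n3 z - c z * n3 z)" by (simp add: algebra_simps)
  also have "\<dots> = integral (square M) (\<lambda>z. N * n3 z) - integral (square M) (\<lambda>z. c z * n3 z)"
    by (rule integral_diff) (auto intro!: integrable_continuous continuous_intros)
  finally show ?thesis using jacobian_identities(4)[OF e] by simp
qed

text \<open>The kernels are nonnegative and have mass 1 in p, so mollifying does not increase the
  total variation beyond the area of the surface.\<close>

lemma integral_gradient_mollified_degree:
  "integral (cube N) (\<lambda>p. norm (integral (square M) (gradient_density e p))) \<le> integral (square M) (\<lambda>z. norm (nn z))"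
proof -
  have c: "continuous_on UNIV (\<lambda>(p, z). kk1 e p z * kk2 e p z * kk3 e p z * norm (nn z))"
    unfolding case_prod_beta using e by (auto intro!: continuous_intros)
  have g: "continuous_on UNIV (\<lambda>(p, z). gradient_density e p z)"
    unfolding case_prod_beta using e by (auto intro!: continuous_intros)
  have "integral (cube N) (\<lambda>p. norm (integral (square M) (gradient_density e p)))
    \<le> integral (cube N) (\<lambda>p. integral (square M) (\<lambda>z. kk1 e p z * kk2 e p z * kk3 e p z * norm (nn z)))"
  proof (rule integral_le)
    show "(\<lambda>p. norm (integral (square M) (gradient_density e p))) integrable_on cube N"
      by (intro integrable_continuous continuous_on_norm continuous_on_integral_square g)
    show "(\<lambda>p. integral (square M) (\<lambda>z. kk1 e p z * kk2 e p z * kk3 e p z * norm (nn z))) integrable_on cube N"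
      by (intro integrable_continuous continuous_on_integral_square c)
    show "norm (integral (square M) (gradient_density e p)) \<le> integral (square M) (\<lambda>z. kk1 e p z * kk2 e p z * kk3 e p z * norm (nn z))" for p
    proof (rule integral_norm_bound_integral)
      show "norm (gradient_density e p z) \<le> kk1 e p z * kk2 e p z * kk3 e p z * norm (nn z)" for z
        using ker0_nonneg[OF e] by (simp add: gradient_density_def kk1_def kk2_def kk3_def)
    qed (use e in \<open>auto intro!: integrable_continuous continuous_intros\<close>)
  qed
  also have "\<dots> = integral (square M) (\<lambda>z. norm (nn z))"
    unfolding swap[OF c] by (simp add: integral_kernels)
  finally show ?thesis .
qed

text \<open>The inequality |x| \<le> |x|^(3/2) + \<open>integer_defect x\<close> is applied to the
  values of the mollified winding number; the Sobolev inequality takes care of the first term, with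
  the area in place of the gradient norm.\<close>

lemma volume_bound_up_to_defect:
  "\<bar>integral (square M) (\<lambda>z. c z * n3 z)\<bar>
   \<le> sqrt ((integral (square M) (\<lambda>z. norm (nn z))) ^ 3 / (36 * pi)) + integral (cube N) (\<lambda>p. integer_defect (mollified_degree e p))"
proof -
  let ?g = "mollified_degree e" and ?G = "\<lambda>p. integral (square M) (gradient_density e p)"
  define X where "X = integral (cube N) (\<lambda>p. \<bar>?g p\<bar> * sqrt \<bar>?g p\<bar>)"
  define S where "S = integral (square M) (\<lambda>z. norm (nn z))"
  note cg = continuous_on_mollified_degree
  have Xc: "continuous_on A (\<lambda>p. \<bar>?g p\<bar> * sqrt \<bar>?g p\<bar>)" for A
    by (intro continuous_intros cg)
  have Gc: "continuous_on UNIV ?G"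
    by (rule continuous_on_integral_square) (use e in \<open>auto simp: case_prod_beta intro!: continuous_intros\<close>)
  have g0: "?g p = 0" if "p \<notin> cube N" for p
    using not_cube[OF that] by (intro mollified_degree_vanishes) auto
  have G0: "?G p = 0" if "p \<notin> cube N" for p
  proof -
    have "((\<lambda>p. 0) has_derivative (\<lambda>v. ?G p \<bullet> v)) (at p)"
      by (rule has_derivative_transform_within_open[OF has_derivative_mollified_degree[OF e], of "- cube N"])
        (use that g0 in auto)
    then have "(\<lambda>v. ?G p \<bullet> v) = (\<lambda>v. 0)" by (rule has_derivative_unique) auto
    from fun_cong[OF this, of "?G p"] show ?thesis by simp
  qed
  have "36 * pi * X\<^sup>2 \<le> S ^ 3"
  proof (rule sobolev_L1_gradient[OF has_derivative_mollified_degree[OF e] Gc compact_cbox])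
    show "?g p = 0" if "p \<notin> cube N" for p by (rule g0[OF that])
    have "(\<integral>\<^sup>+p. ennreal (norm (?G p)) \<partial>lborel) = ennreal (integral (cube N) (\<lambda>p. norm (?G p)))"
      by (rule nn_integral_eq_integral_cbox) (use G0 Gc in \<open>auto intro!: continuous_intros\<close>)
    then show "(\<integral>\<^sup>+p. ennreal (norm (?G p)) \<partial>lborel) \<le> ennreal S"
      using integral_gradient_mollified_degree by (simp add: S_def ennreal_leI)
    show "S \<ge> 0" unfolding S_def by (rule integral_nonneg) (auto intro!: integrable_continuous continuous_intros)
    show "(\<integral>\<^sup>+p. ennreal (\<bar>?g p\<bar> * sqrt \<bar>?g p\<bar>) \<partial>lborel) = ennreal X"
      unfolding X_def by (rule nn_integral_eq_integral_cbox) (use g0 Xc in auto)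
    show "X \<ge> 0" unfolding X_def by (rule integral_nonneg) (auto intro!: integrable_continuous Xc)
  qed
  then have "X\<^sup>2 \<le> S ^ 3 / (36 * pi)" by (simp add: field_simps)
  then have X: "X \<le> sqrt (S ^ 3 / (36 * pi))" by (rule real_le_rsqrt)
  have "\<bar>integral (square M) (\<lambda>z. c z * n3 z)\<bar> = norm (integral (cube N) ?g)"
    by (simp add: integral_mollified_degree)
  also have "\<dots> \<le> integral (cube N) (\<lambda>p. \<bar>?g p\<bar> * sqrt \<bar>?g p\<bar> + integer_defect (?g p))"
    by (rule integral_norm_bound_integral)
      (use integer_defect_bounds in \<open>auto intro!: integrable_continuous continuous_on_add Xc continuous_on_integer_defect cg\<close>)
  also have "\<dots> = X + integral (cube N) (\<lambda>p. integer_defect (?g p))"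
    unfolding X_def by (rule integral_add) (auto intro!: integrable_continuous Xc continuous_on_integer_defect cg)
  finally show ?thesis using X by (simp add: S_def)
qed

end

text \<open>Dominated convergence: the defects are at most 1 on a fixed cube, and at almost every p
  they are exactly 0 from some scale on. That scale may depend on p, so no uniformity near the
  surface is involved.\<close>

lemma volume_bound_if_eventually_integer:
  assumes int: "AE p in lborel. \<exists>e0>0. \<forall>e. 0 < e \<and> e < e0 \<longrightarrow> mollified_degree e p \<in> \<int>"
  shows "\<bar>integral (square M) (\<lambda>z. c z * n3 z)\<bar> \<le> sqrt ((integral (square M) (\<lambda>z. norm (nn z))) ^ 3 / (36 * pi))"
proof -
  obtain B where B: "B \<ge> 0" "\<And>z. \<bar>a z\<bar> \<le> B \<and> \<bar>b z\<bar> \<le> B \<and> \<bar>c z\<bar> \<le> B" using bounded_range by blast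
  \<comment> \<open>One cube serves all scales, since \<open>e k\<close> is at most 1.\<close>
  define N where "N = B + 3/2"
  define e where "e k = 1 / real (Suc k)" for k
  have e: "e k > 0" "B + 3/2 * e k \<le> N" for k by (auto simp: e_def N_def field_simps)
  have e_lim: "e \<longlonglongrightarrow> 0" unfolding e_def by (rule LIMSEQ_Suc[OF lim_1_over_n])
  define s where "s k p = indicator (cube N) p * integer_defect (mollified_degree (e k) p)" for k p
  have cg: "continuous_on A (\<lambda>p. integer_defect (mollified_degree (e k) p))" for k A
    by (intro continuous_on_integer_defect continuous_on_mollified_degree[OF B(2) e])
  have [measurable]: "(\<lambda>p. integer_defect (mollified_degree (e k) p)) \<in> borel_measurable borel" for k
    by (rule borel_measurable_continuous_onI[OF cg])
  have [measurable]: "s k \<in> borel_measurable lborel" for k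
    unfolding s_def[abs_def] by measurable
  have w: "integrable lborel (indicator (cube N) :: _ \<Rightarrow> real)"
    by (rule integrable_real_indicator[OF _ emeasure_lborel_cbox_finite]) auto
  have b: "AE p in lborel. norm (s k p) \<le> indicator (cube N) p" for k
    using integer_defect_bounds by (auto simp: s_def indicator_def)
  have "(\<lambda>k. integral\<^sup>L lborel (s k)) \<longlonglongrightarrow> integral\<^sup>L lborel (\<lambda>p::real\<times>real\<times>real. 0::real)"
  proof (rule integral_dominated_convergence[OF _ _ w _ b])
    show "AE p in lborel. (\<lambda>k. s k p) \<longlonglongrightarrow> 0"
      using int
    proof eventually_elim
      case (elim p)
      then obtain e0 where e0: "e0 > 0" "\<And>e. 0 < e \<Longrightarrow> e < e0 \<Longrightarrow> mollified_degree e p \<in> \<int>" by blast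
      have "eventually (\<lambda>k. e k < e0) sequentially" by (rule order_tendstoD(2)[OF e_lim e0(1)])
      then have "eventually (\<lambda>k. s k p = 0) sequentially"
        by eventually_elim (use e0(2) e(1) in \<open>auto simp: s_def integer_defect_Ints\<close>)
      then show ?case by (rule tendsto_eventually)
    qed
  qed auto
  moreover have "integral\<^sup>L lborel (s k) = integral (cube N) (\<lambda>p. integer_defect (mollified_degree (e k) p))" for k
  proof -
    have "integrable lborel (s k)"
      by (rule Bochner_Integration.integrable_bound[OF w]) (use b[of k] in auto)
    then have "integral\<^sup>L lborel (s k) = integral UNIV (s k)" by (rule integral_lborel[symmetric])
    also have "\<dots> = integral UNIV (\<lambda>p. if p \<in> cube N then integer_defect (mollified_degree (e k) p) else 0)"
      by (rule arg_cong[where f = "integral UNIV"]) (auto simp: s_def fun_eq_iff indicator_def)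
    finally show ?thesis unfolding integral_restrict_UNIV .
  qed
  ultimately have "(\<lambda>k. integral (cube N) (\<lambda>p. integer_defect (mollified_degree (e k) p))) \<longlonglongrightarrow> 0" by simp
  then have "(\<lambda>k. sqrt ((integral (square M) (\<lambda>z. norm (nn z))) ^ 3 / (36 * pi)) + integral (cube N) (\<lambda>p. integer_defect (mollified_degree (e k) p)))
     \<longlonglongrightarrow> sqrt ((integral (square M) (\<lambda>z. norm (nn z))) ^ 3 / (36 * pi)) + 0"
    by (intro tendsto_intros)
  then have "\<bar>integral (square M) (\<lambda>z. c z * n3 z)\<bar> \<le> sqrt ((integral (square M) (\<lambda>z. norm (nn z))) ^ 3 / (36 * pi)) + 0"
    by (rule LIMSEQ_le_const) (use volume_bound_up_to_defect[OF B(2) e] in blast)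
  then show ?thesis by simp
qed

end

subsection \<open>Integrality of the winding number\<close>

lemma absolutely_integrable_compact_support:
  fixes f :: "'a::euclidean_space \<Rightarrow> real"
  assumes "continuous_on UNIV f" "compact K" "\<And>x. x \<notin> K \<Longrightarrow> f x = 0" "S \<in> sets lebesgue"
  shows "integrable lborel f" "f absolutely_integrable_on S"
proof -
  have "integrable lborel (\<lambda>x. indicator K x *\<^sub>R f x)"
    by (rule borel_integrable_compact) (use assms in \<open>auto intro: continuous_on_subset\<close>)
  also have "(\<lambda>x. indicator K x *\<^sub>R f x) = f"
    using assms(3) by (auto simp: fun_eq_iff indicator_def)
  finally show 1: "integrable lborel f" .
  have "integrable lebesgue f"
    using 1 by (simp add: integrable_completion)
  then have "f absolutely_integrable_on UNIV" by (simp add: set_integrable_def)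
  then show "f absolutely_integrable_on S"
    by (rule set_integrable_subset) (use assms in auto)
qed

text \<open>The degree argument takes place in \<open>real^2\<close>, where derivatives are matrices
  with determinants, whereas the surface is parametrised over \<open>real \<times> real\<close>. The
  two Lebesgue measures are identified by their values on boxes.\<close>

lemma lborel_vec2: "distr lborel borel (\<lambda>v::real^2. (v $ 1, v $ 2)) = lborel"
proof (rule lborel_eqI[symmetric])
  fix l u :: "real \<times> real"
  assume "\<And>b. b \<in> Basis \<Longrightarrow> l \<bullet> b \<le> u \<bullet> b"
  then have le: "fst l \<le> fst u" "snd l \<le> snd u" by (force simp: Basis_prod_def inner_prod_def)+
  define v where "v p = (vector [fst p, snd p] :: real^2)" for p :: "real \<times> real"
  have v: "v p $ 1 = fst p" "v p $ 2 = snd p" for p by (simp_all add: v_def)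
  have 2: "(1::2) \<noteq> 2" by simp
  have "x \<in> box (v l) (v u) \<longleftrightarrow> fst l < x $ 1 \<and> x $ 1 < fst u \<and> snd l < x $ 2 \<and> x $ 2 < snd u" for x
    by (auto simp: mem_box_cart forall_2 v)
  moreover have "p \<in> box l u \<longleftrightarrow> fst l < fst p \<and> fst p < fst u \<and> snd l < snd p \<and> snd p < snd u" for p
    by (auto simp: mem_box Basis_prod_def inner_prod_def)
  ultimately have "(\<lambda>v::real^2. (v $ 1, v $ 2)) -` box l u = box (v l) (v u)"
    by (auto simp: set_eq_iff)
  moreover have "(\<Prod>b\<in>Basis. (v u - v l) \<bullet> b) = (fst u - fst l) * (snd u - snd l)"
    by (simp add: Basis_vec_def UNIV_2 inner_axis axis_eq_axis v 2 prod.UNION_disjoint)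
  moreover have "v l \<bullet> b \<le> v u \<bullet> b" if "b \<in> Basis" for b
    using that le by (auto simp: Basis_vec_def inner_axis v UNIV_2)
  ultimately have "emeasure lborel ((\<lambda>v::real^2. (v $ 1, v $ 2)) -` box l u) = (fst u - fst l) * (snd u - snd l)"
    by (simp add: emeasure_lborel_box)
  also have "\<dots> = (\<Prod>b\<in>Basis. (u - l) \<bullet> b)"
    by (simp add: Basis_prod_def prod.union_disjoint inner_prod_def mult.commute)
  finally show "emeasure (distr lborel borel (\<lambda>v::real^2. (v $ 1, v $ 2))) (box l u) = (\<Prod>b\<in>Basis. (u - l) \<bullet> b)"
    by (subst emeasure_distr) auto
qed simp

lemma integral_vec2:
  fixes f :: "real \<times> real \<Rightarrow> real"
  assumes f: "continuous_on UNIV f" "compact K" "\<And>x. x \<notin> K \<Longrightarrow> f x = 0"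
  shows "integral UNIV (\<lambda>v::real^2. f (v $ 1, v $ 2)) = integral UNIV f"
proof -
  have i: "integrable lborel f" using absolutely_integrable_compact_support(1)[OF f] by blast
  have m: "(\<lambda>v::real^2. (v $ 1, v $ 2)) \<in> lborel \<rightarrow>\<^sub>M borel"
    by (auto intro!: borel_measurable_continuous_onI continuous_intros)
  have fm: "f \<in> borel_measurable borel" using f(1) by (rule borel_measurable_continuous_onI)
  have "integrable (distr lborel borel (\<lambda>v::real^2. (v $ 1, v $ 2))) f" using i by (simp add: lborel_vec2)
  then have i2: "integrable lborel (\<lambda>v::real^2. f (v $ 1, v $ 2))"
    by (subst (asm) integrable_distr_eq[OF m fm])
  have "integral UNIV f = integral\<^sup>L (distr lborel borel (\<lambda>v::real^2. (v $ 1, v $ 2))) f"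
    using integral_lborel[OF i] by (simp add: lborel_vec2)
  also have "\<dots> = integral\<^sup>L lborel (\<lambda>v::real^2. f (v $ 1, v $ 2))"
    by (rule integral_distr[OF m fm])
  finally show ?thesis using integral_lborel[OF i2] by simp
qed

text \<open>The kernel is 0 off the open square of half-width 3/2 e around q. The set S is left
  general because it will be the image of a small ball, of which only a neighbourhood of q is
  known.\<close>

lemma has_integral_kernel_square:
  fixes q :: "real^2"
  assumes e: "e > 0" and S: "{w. \<forall>i. \<bar>q $ i - w $ i\<bar> < 3/2 * e} \<subseteq> S" "S \<in> sets lebesgue"
  defines "\<phi> \<equiv> \<lambda>w::real^2. ker0 e (q $ 1 - w $ 1) * ker0 e (q $ 2 - w $ 2)"
  shows "integral S \<phi> = 1" "\<phi> absolutely_integrable_on S"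
proof -
  define f where "f p = ker0 e (q $ 1 - fst p) * ker0 e (q $ 2 - snd p)" for p :: "real \<times> real"
  define M where "M = \<bar>q $ 1\<bar> + \<bar>q $ 2\<bar> + 3/2 * e"
  have far: "ker0 e (q $ i - x) = 0" if "x \<notin> {-M..M}" for i x
  proof (rule ker0_far[OF e])
    have "\<bar>q $ i\<bar> \<le> \<bar>q $ 1\<bar> + \<bar>q $ 2\<bar>" using exhaust_2[of i] by auto
    then show "3/2 * e \<le> \<bar>q $ i - x\<bar>" using that unfolding M_def atLeastAtMost_iff by linarith
  qed
  have cf: "continuous_on A f" for A
    unfolding f_def by (intro continuous_intros continuous_on_ker e)
  have f0: "f p = 0" if "p \<notin> square M" for p
    using that far[of "fst p" 1] far[of "snd p" 2] by (cases p) (auto simp: f_def)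
  have c\<phi>: "continuous_on UNIV \<phi>"
    unfolding \<phi>_def by (intro continuous_intros continuous_on_ker e)
  have \<phi>0: "\<phi> w = 0" if "w \<notin> cbox (q - (\<chi> i. 3/2 * e)) (q + (\<chi> i. 3/2 * e))" for w
  proof -
    from that obtain i where "w $ i < q $ i - 3/2 * e \<or> q $ i + 3/2 * e < w $ i"
      by (auto simp: mem_box_cart not_le)
    then have "3/2 * e \<le> \<bar>q $ i - w $ i\<bar>" by linarith
    then show ?thesis using ker0_far[OF e] exhaust_2[of i] by (auto simp: \<phi>_def)
  qed
  show "\<phi> absolutely_integrable_on S"
    by (rule absolutely_integrable_compact_support(2)[OF c\<phi> compact_cbox \<phi>0 S(2)])
  have "((\<lambda>s. ker0 e (q $ i - s)) has_integral 1) {-M..M}" for i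
  proof -
    have "\<bar>- q $ i\<bar> + 3/2 * e \<le> M" using exhaust_2[of i] by (auto simp: M_def)
    from has_integral_reflect_real[THEN iffD2, OF has_integral_ker0[OF e this]]
    show ?thesis by (simp add: add.commute)
  qed
  then have 1: "integral {-M..M} (\<lambda>s. ker0 e (q $ i - s)) = 1" for i by (simp add: integral_unique)
  have "integral (square M) f = integral (cbox (-M) M) (\<lambda>x. integral (cbox (-M) M) (\<lambda>y. ker0 e (q $ 1 - x) * ker0 e (q $ 2 - y)))"
    by (subst integral_prod_continuous[OF cf]) (simp add: f_def)
  also have "\<dots> = 1" by (simp add: 1)
  finally have "integral (square M) f = 1" .
  moreover have "(\<lambda>p. if p \<in> square M then f p else 0) = f" using f0 by (simp add: fun_eq_iff)
  then have "integral UNIV f = integral (square M) f"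
    using integral_restrict_UNIV[of "square M" f] by simp
  moreover have "integral UNIV \<phi> = integral UNIV f"
    using integral_vec2[OF cf compact_cbox, of "(- M, - M)" "(M, M)"] f0 by (simp add: f_def \<phi>_def)
  ultimately have "integral UNIV \<phi> = 1" by simp
  moreover have "\<phi> w = 0" if "w \<notin> S" for w
  proof -
    have "\<not> (\<forall>i. \<bar>q $ i - w $ i\<bar> < 3/2 * e)" using S(1) that by blast
    then obtain i where "3/2 * e \<le> \<bar>q $ i - w $ i\<bar>" by (auto simp: not_less)
    then show ?thesis using ker0_far[OF e] exhaust_2[of i] by (auto simp: \<phi>_def)
  qed
  then have "(\<lambda>w. if w \<in> S then \<phi> w else 0) = \<phi>" by (simp add: fun_eq_iff)
  then have "integral UNIV \<phi> = integral S \<phi>"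
    using integral_restrict_UNIV[of S \<phi>] by simp
  ultimately show "integral S \<phi> = 1" by simp
qed

lemma continuous_on_det2:
  fixes J :: "'a::topological_space \<Rightarrow> real^2^2"
  assumes "continuous_on A J"
  shows "continuous_on A (\<lambda>v. det (J v))"
  unfolding det_2 by (intro continuous_intros assms)

section \<open>The degree at a regular value\<close>

lemma locally_injective_if_det_nonzero:
  fixes F :: "real^2 \<Rightarrow> real^2" and J :: "real^2 \<Rightarrow> real^2^2"
  assumes der: "\<And>v. (F has_derivative (*v) (J v)) (at v)" and J: "continuous_on UNIV J" and z: "det (J z) \<noteq> 0"
  obtains r where "r > 0" "inj_on F (ball z r)"
proof -
  obtain B where B: "B ** J z = mat 1" using z unfolding invertible_det_nz[symmetric] invertible_def by blast
  show ?thesis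
  proof (rule has_derivative_locally_injective[where a = z and S = UNIV and f = F and f' = "\<lambda>v. (*v) (J v)" and g' = "(*v) B"])
    show "bounded_linear ((*v) B)" by (rule matrix_vector_mul_bounded_linear)
    show "(*v) B \<circ> (*v) (J z) = id"
      by (simp add: fun_eq_iff matrix_vector_mul_assoc B)
    show "\<exists>d>0. \<forall>x. dist z x < d \<longrightarrow> onorm (\<lambda>v. J x *v v - J z *v v) < e" if "e > 0" for e
    proof -
      \<comment> \<open>The operator norm of a 2 by 2 matrix is at most four times a bound for its
        entries, so this leaves e/2.\<close>
      have "e / 8 > 0" using that by simp
      then obtain d where d: "d > 0" "\<And>x. dist x z < d \<Longrightarrow> dist (J x) (J z) < e / 8"
        using J unfolding continuous_on_iff by (metis UNIV_I)
      have "onorm (\<lambda>v. J x *v v - J z *v v) < e" if "dist z x < d" for x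
      proof -
        have "onorm ((*v) (J x - J z)) \<le> real CARD(2) * real CARD(2) * norm (J x - J z)"
        proof (rule onorm_le_matrix_component)
          show "\<bar>(J x - J z) $ i $ j\<bar> \<le> norm (J x - J z)" for i j
            by (metis component_le_norm_cart Finite_Cartesian_Product.norm_nth_le order_trans)
        qed
        also have "\<dots> = 4 * norm (J x - J z)" by simp
        also have "\<dots> < e"
          using d(2)[OF that[unfolded dist_commute[of z x]], unfolded dist_norm] norm_ge_zero[of "J x - J z"] by linarith
        also have "(*v) (J x - J z) = (\<lambda>v. J x *v v - J z *v v)"
          by (simp add: fun_eq_iff matrix_vector_mult_diff_rdistrib)
        finally show ?thesis .
      qed
      then show ?thesis using d(1) by blast
    qed
  qed (use der that in auto)
qed

lemma ball_in_open_condition: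
  fixes f :: "'a::metric_space \<Rightarrow> real"
  assumes "continuous_on UNIV f" "f z > k"
  obtains r where "r > 0" "\<And>v. v \<in> ball z r \<Longrightarrow> f v > k"
proof -
  have "open {v. f v > k}" using assms(1) by (intro open_Collect_less) auto
  then show ?thesis using assms(2) that unfolding open_contains_ball by (metis mem_Collect_eq subsetD)
qed

text \<open>Near a regular preimage z the map F is a homeomorphism onto an open set, the sign of the
  Jacobian is constant, and for small e the factor \<open>kerI\<close> is constantly 0 or 1. A
  change of variables turns the integral into that constant times the sign times the mass 1 of the
  kernel. All radii up to \<open>r0\<close> are allowed because the balls are shrunk later to become
  disjoint.\<close>

lemma local_degree_integer:
  fixes F :: "real^2 \<Rightarrow> real^2" and J :: "real^2 \<Rightarrow> real^2^2" and c :: "real^2 \<Rightarrow> real"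
  assumes der: "\<And>v. (F has_derivative (*v) (J v)) (at v)" and J: "continuous_on UNIV J" and c: "continuous_on UNIV c"
    and z: "det (J z) \<noteq> 0" "c z \<noteq> s" "F z = q"
  shows "\<exists>r0>0. \<forall>r. 0 < r \<and> r \<le> r0 \<longrightarrow> (\<forall>v\<in>ball z r. F v = q \<longrightarrow> v = z) \<and>
    (\<exists>e0>0. \<forall>e. 0 < e \<and> e < e0 \<longrightarrow>
      integral (ball z r) (\<lambda>v. ker0 e (q $ 1 - F v $ 1) * ker0 e (q $ 2 - F v $ 2) * kerI e (s - c v) * det (J v)) \<in> \<int>)"
proof -
  \<comment> \<open>\<sigma> is the orientation of F at z, \<tau> tells on which side of height s
    the surface passes, and \<eta> is half its distance from that height.\<close>
  define \<sigma> where "\<sigma> = sgn (det (J z))"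
  define \<tau> where "\<tau> = sgn (s - c z)"
  define \<eta> where "\<eta> = \<bar>s - c z\<bar> / 2"
  have \<eta>: "\<eta> > 0" using z by (simp add: \<eta>_def)
  have cF: "continuous_on A F" for A
    using der by (meson continuous_at_imp_continuous_on has_derivative_continuous)
  obtain r1 where r1: "r1 > 0" "inj_on F (ball z r1)"
    using locally_injective_if_det_nonzero[OF der J z(1)] by blast
  obtain r2 where r2: "r2 > 0" "\<And>v. v \<in> ball z r2 \<Longrightarrow> \<sigma> * det (J v) > 0"
    by (rule ball_in_open_condition[of "\<lambda>v. \<sigma> * det (J v)" 0 z])
      (use z J in \<open>auto simp: \<sigma>_def sgn_if intro!: continuous_intros continuous_on_det2\<close>)
  obtain r3 where r3: "r3 > 0" "\<And>v. v \<in> ball z r3 \<Longrightarrow> (s - c v) * \<tau> > \<eta>"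
    by (rule ball_in_open_condition[of "\<lambda>v. (s - c v) * \<tau>" \<eta> z])
      (use z c in \<open>auto simp: \<tau>_def \<eta>_def sgn_if intro!: continuous_intros\<close>)
  show ?thesis
  proof (rule exI[of _ "min r1 (min r2 r3)"], intro conjI allI impI)
    show "min r1 (min r2 r3) > 0" using r1 r2 r3 by simp
    fix r assume "0 < r \<and> r \<le> min r1 (min r2 r3)"
    then have r: "0 < r" "ball z r \<subseteq> ball z r1" "ball z r \<subseteq> ball z r2" "ball z r \<subseteq> ball z r3"
      by (auto simp: subset_ball)
    have inj: "inj_on F (ball z r)" using r1(2) r(2) by (rule inj_on_subset)
    then show "\<forall>v\<in>ball z r. F v = q \<longrightarrow> v = z"
      using z(3) r(1) by (auto dest: inj_onD)
    have op: "open (F ` ball z r)" by (rule invariance_of_domain[OF cF open_ball inj])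
    moreover have "q \<in> F ` ball z r" using z(3) r(1) by force
    ultimately obtain \<delta> where \<delta>: "\<delta> > 0" "ball q \<delta> \<subseteq> F ` ball z r" by (meson open_contains_ball)
    show "\<exists>e0>0. \<forall>e. 0 < e \<and> e < e0 \<longrightarrow>
      integral (ball z r) (\<lambda>v. ker0 e (q $ 1 - F v $ 1) * ker0 e (q $ 2 - F v $ 2) * kerI e (s - c v) * det (J v)) \<in> \<int>"
    \<comment> \<open>With e < \<delta>/3 the support of the kernel, of l1 radius 3 e, lies in the
      image of the ball; with e < 2/3 \<eta> the argument of \<open>kerI\<close> is outside its
      transition zone.\<close>
    proof (intro exI[of _ "min (\<delta>/3) (2/3 * \<eta>)"] conjI allI impI)
      show "min (\<delta>/3) (2/3 * \<eta>) > 0" using \<delta> \<eta> by simp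
      fix e assume "0 < e \<and> e < min (\<delta>/3) (2/3 * \<eta>)"
      then have e: "e > 0" "3 * e < \<delta>" "3/2 * e < \<eta>" by auto
      define \<phi> where "\<phi> w = ker0 e (q $ 1 - w $ 1) * ker0 e (q $ 2 - w $ 2)" for w :: "real^2"
      have "w \<in> F ` ball z r" if "\<forall>i. \<bar>q $ i - w $ i\<bar> < 3/2 * e" for w
      proof -
        have "norm (q - w) \<le> (\<Sum>i\<in>UNIV. \<bar>(q - w) $ i\<bar>)" by (rule norm_le_l1_cart)
        also have "\<dots> < \<delta>" using that[rule_format, of 1] that[rule_format, of 2] e(2) by (simp add: sum_2)
        finally show ?thesis using \<delta>(2) by (auto simp: dist_norm)
      qed
      then have near: "{w. \<forall>i. \<bar>q $ i - w $ i\<bar> < 3/2 * e} \<subseteq> F ` ball z r" by blast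
      note \<phi> = has_integral_kernel_square[OF e(1), of q "F ` ball z r", folded \<phi>_def]
      have V: "F ` ball z r \<in> sets lebesgue" using op by auto
      \<comment> \<open>The scalar kernel is recast as a map into \<open>real^1\<close>, the form in
        which the change of variables formula is applied.\<close>
      define f where "f w = (vec (\<phi> w) :: real^1)" for w
      have f1: "f absolutely_integrable_on (F ` ball z r)"
        unfolding absolutely_integrable_componentwise_iff[where f = f] using \<phi>(2)[OF near V]
        by (simp add: f_def Basis_vec_def inner_axis)
      have "integral (F ` ball z r) f $ 1 = integral (F ` ball z r) (\<lambda>w. f w $ 1)"
        using f1 by (subst integral_component_eq_cart) (auto intro: set_lebesgue_integral_eq_integral(1))
      then have f2: "integral (F ` ball z r) f $ 1 = 1" using \<phi>(1)[OF near V] by (simp add: f_def)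
      have "(\<lambda>v. \<bar>det (matrix ((*v) (J v)))\<bar> *\<^sub>R f (F v)) absolutely_integrable_on ball z r \<and>
          integral (ball z r) (\<lambda>v. \<bar>det (matrix ((*v) (J v)))\<bar> *\<^sub>R f (F v)) = integral (F ` ball z r) f"
        by (rule has_absolute_integral_change_of_variables[THEN iffD2])
          (use inj f1 der in \<open>auto intro: has_derivative_at_withinI\<close>)
      then have "integral (ball z r) (\<lambda>v. (\<bar>det (J v)\<bar> *\<^sub>R f (F v)) $ 1) = 1"
        using f2 by (subst integral_component_eq_cart) (auto intro: set_lebesgue_integral_eq_integral(1))
      then have 1: "integral (ball z r) (\<lambda>v. \<bar>det (J v)\<bar> * \<phi> (F v)) = 1" by (simp add: f_def)
      \<comment> \<open>The value of the smoothed Heaviside function: the sheet through z counts if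
        it passes below height s.\<close>
      define \<kappa> where "\<kappa> = (if \<tau> > 0 then 1 else 0 :: real)"
      have "integral (ball z r) (\<lambda>v. ker0 e (q $ 1 - F v $ 1) * ker0 e (q $ 2 - F v $ 2) * kerI e (s - c v) * det (J v))
        = integral (ball z r) (\<lambda>v. \<sigma> * \<kappa> * (\<bar>det (J v)\<bar> * \<phi> (F v)))"
      proof (rule integral_cong)
        fix v assume v: "v \<in> ball z r"
        have "kerI e (s - c v) = \<kappa>"
        proof (cases "\<tau> > 0")
          case True
          then have "\<tau> = 1" by (simp add: \<tau>_def sgn_if split: if_splits)
          then have "s - c v > \<eta>" using r3(2)[of v] v r(4) by auto
          then show ?thesis using ker_right[OF e(1), of "s - c v"] e(3) True by (simp add: \<kappa>_def)
        next
          case False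
          then have "\<tau> = -1" using z(2) by (simp add: \<tau>_def sgn_if split: if_splits)
          then have "s - c v < - \<eta>" using r3(2)[of v] v r(4) by auto
          then show ?thesis using ker_left[OF e(1), of "s - c v"] e(3) False by (simp add: \<kappa>_def)
        qed
        moreover have "0 < \<sigma> * det (J v)" using r2(2) v r(3) by blast
        then have "\<sigma> * \<bar>det (J v)\<bar> = det (J v)"
          using z(1) by (auto simp: \<sigma>_def sgn_if split: if_splits)
        ultimately show "ker0 e (q $ 1 - F v $ 1) * ker0 e (q $ 2 - F v $ 2) * kerI e (s - c v) * det (J v)
            = \<sigma> * \<kappa> * (\<bar>det (J v)\<bar> * \<phi> (F v))"
          unfolding \<phi>_def by (simp add: mult_ac)
      qed
      also have "\<dots> = \<sigma> * \<kappa>" using 1 by simp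
      also have "\<dots> \<in> \<int>" by (auto simp: \<sigma>_def \<kappa>_def sgn_if)
      finally show "integral (ball z r) (\<lambda>v. ker0 e (q $ 1 - F v $ 1) * ker0 e (q $ 2 - F v $ 2) * kerI e (s - c v) * det (J v)) \<in> \<int>" .
    qed
  qed
qed

text \<open>The preimages of q are isolated in a compact set, hence finite in number. Away from
  small disjoint balls around them F keeps a positive distance from q, so for small e the integrand
  vanishes there and the integral is a finite sum of local degrees. The condition that q is not 0
  keeps preimages away from the region where F is constant.\<close>

lemma degree_eventually_integer:
  fixes F :: "real^2 \<Rightarrow> real^2" and J :: "real^2 \<Rightarrow> real^2^2" and c :: "real^2 \<Rightarrow> real"
  assumes der: "\<And>v. (F has_derivative (*v) (J v)) (at v)" and J: "continuous_on UNIV J" and c: "continuous_on UNIV c"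
    and M: "\<And>v. M \<le> norm v \<Longrightarrow> F v = 0" "\<And>v. M \<le> norm v \<Longrightarrow> det (J v) = 0" and q: "q \<noteq> 0"
    and reg: "\<And>v. F v = q \<Longrightarrow> det (J v) \<noteq> 0 \<and> c v \<noteq> s"
  shows "\<exists>e0>0. \<forall>e. 0 < e \<and> e < e0 \<longrightarrow>
      integral UNIV (\<lambda>v. ker0 e (q $ 1 - F v $ 1) * ker0 e (q $ 2 - F v $ 2) * kerI e (s - c v) * det (J v)) \<in> \<int>"
proof -
  define H where "H e v = ker0 e (q $ 1 - F v $ 1) * ker0 e (q $ 2 - F v $ 2) * kerI e (s - c v) * det (J v)" for e v
  define Z where "Z = {v. F v = q}"
  have cF: "continuous_on A F" for A
    using der by (meson continuous_at_imp_continuous_on has_derivative_continuous)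
  define good where "good z r \<longleftrightarrow> (\<forall>v\<in>ball z r. F v = q \<longrightarrow> v = z) \<and>
    (\<exists>e0>0. \<forall>e. 0 < e \<and> e < e0 \<longrightarrow> integral (ball z r) (H e) \<in> \<int>)" for z r
  have "\<exists>r0. r0 > 0 \<and> (\<forall>r. 0 < r \<and> r \<le> r0 \<longrightarrow> good z r)" if "z \<in> Z" for z
  proof -
    have Fz: "F z = q" using that by (simp add: Z_def)
    have "det (J z) \<noteq> 0" "c z \<noteq> s" using reg[OF Fz] by auto
    from local_degree_integer[OF der J c this Fz] show ?thesis unfolding good_def H_def .
  qed
  then have "\<forall>z\<in>Z. \<exists>r0. r0 > 0 \<and> (\<forall>r. 0 < r \<and> r \<le> r0 \<longrightarrow> good z r)" ..
  then obtain r0 where "\<forall>z\<in>Z. r0 z > 0 \<and> (\<forall>r. 0 < r \<and> r \<le> r0 z \<longrightarrow> good z r)"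
    by (rule bchoice[THEN exE])
  then have r0: "\<And>z. z \<in> Z \<Longrightarrow> r0 z > 0" "\<And>z r. z \<in> Z \<Longrightarrow> 0 < r \<Longrightarrow> r \<le> r0 z \<Longrightarrow> good z r" by auto
  have "finite (Z \<inter> Z)"
  proof (rule finite_not_islimpt_in_compact)
    have "closed Z" unfolding Z_def by (intro closed_Collect_eq cF continuous_on_const)
    moreover have "norm v \<le> M" if "v \<in> Z" for v
    proof (rule ccontr)
      assume "\<not> norm v \<le> M"
      then have "F v = 0" by (intro M(1)) simp
      then show False using that q by (simp add: Z_def)
    qed
    then have "Z \<subseteq> cball 0 M" by auto
    ultimately show "compact Z" using bounded_subset[OF bounded_cball] compact_eq_bounded_closed by blast
    fix z assume z: "z \<in> Z"
    have "\<forall>v\<in>ball z (r0 z). F v = q \<longrightarrow> v = z" using r0(2)[OF z r0(1)[OF z]] by (simp add: good_def)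
    then show "\<not> z islimpt Z"
      unfolding islimpt_approachable using r0(1)[OF z] by (auto simp: Z_def dist_commute)
  qed
  then have fin: "finite Z" by simp
  have "\<exists>d>0. \<forall>x\<in>Z. x \<noteq> z \<longrightarrow> d \<le> dist z x" for z by (rule finite_set_avoid[OF fin])
  then have "\<forall>z. \<exists>d. d > 0 \<and> (\<forall>x\<in>Z. x \<noteq> z \<longrightarrow> d \<le> dist z x)" ..
  then obtain d where "\<forall>z. d z > 0 \<and> (\<forall>x\<in>Z. x \<noteq> z \<longrightarrow> d z \<le> dist z x)" by (rule choice[THEN exE])
  then have d: "\<And>z. d z > 0" "\<And>z x. x \<in> Z \<Longrightarrow> x \<noteq> z \<Longrightarrow> d z \<le> dist z x" by auto
  \<comment> \<open>Half the distance to the other preimages makes the balls disjoint.\<close>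
  define r where "r z = min (r0 z) (d z / 2)" for z
  have r: "0 < r z" "r z \<le> r0 z" "r z \<le> d z / 2" if "z \<in> Z" for z using r0(1)[OF that] d(1) by (auto simp: r_def)
  have disj: "x = y" if "x \<in> Z" "y \<in> Z" "v \<in> ball x (r x)" "v \<in> ball y (r y)" for x y v
  proof (rule ccontr)
    assume "x \<noteq> y"
    then have "d x \<le> dist x y" "d y \<le> dist x y" using d(2)[of y x] d(2)[of x y] that by (auto simp: dist_commute)
    moreover have "dist x y < r x + r y" using that dist_triangle2[of x y v] by (simp add: dist_commute)
    ultimately show False using r(3)[OF that(1)] r(3)[OF that(2)] by linarith
  qed
  have "\<forall>z\<in>Z. \<exists>e0. e0 > 0 \<and> (\<forall>e. 0 < e \<and> e < e0 \<longrightarrow> integral (ball z (r z)) (H e) \<in> \<int>)"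
    using r0(2)[OF _ r(1,2)] unfolding good_def by blast
  then obtain e0 where "\<forall>z\<in>Z. e0 z > 0 \<and> (\<forall>e. 0 < e \<and> e < e0 z \<longrightarrow> integral (ball z (r z)) (H e) \<in> \<int>)"
    by (rule bchoice[THEN exE])
  then have e0: "\<And>z. z \<in> Z \<Longrightarrow> e0 z > 0"
    "\<And>z e. z \<in> Z \<Longrightarrow> 0 < e \<Longrightarrow> e < e0 z \<Longrightarrow> integral (ball z (r z)) (H e) \<in> \<int>" by auto
  \<comment> \<open>The part of the disc not covered by the balls. Outside the disc the Jacobian
    factor makes the integrand 0.\<close>
  define K where "K = cball 0 M - (\<Union>z\<in>Z. ball z (r z))"
  have "compact K" unfolding K_def by (intro compact_diff compact_cball open_UN ballI open_ball)
  then have "closed (F ` K)" by (intro compact_imp_closed compact_continuous_image cF)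
  moreover have "q \<notin> F ` K"
  proof
    assume "q \<in> F ` K"
    then obtain v where "v \<in> K" "v \<in> Z" by (auto simp: Z_def)
    then show False using r(1)[of v] by (auto simp: K_def)
  qed
  ultimately have "\<exists>\<delta>>0. \<forall>x\<in>F ` K. \<delta> \<le> dist q x" by (rule separate_point_closed)
  then obtain \<delta> where \<delta>: "\<delta> > 0" "\<And>v. v \<in> K \<Longrightarrow> \<delta> \<le> dist q (F v)" by auto
  \<comment> \<open>Adjoining \<delta>/3 keeps the set nonempty when q has no preimage; it makes the
    l1 radius 3 e of the kernel smaller than the distance from q to the image of K.\<close>
  define m where "m = Min (insert (\<delta>/3) (e0 ` Z))"
  have m: "m > 0" "m \<le> \<delta> / 3" "\<And>z. z \<in> Z \<Longrightarrow> m \<le> e0 z"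
  proof -
    show "m \<le> \<delta> / 3" unfolding m_def by (rule Min_le) (use fin in auto)
  qed (use fin e0(1) \<delta>(1) in \<open>auto simp: m_def\<close>)
  have "integral UNIV (H e) \<in> \<int>" if e: "0 < e" "e < m" for e
  proof -
    have cH: "continuous_on UNIV (H e)"
      unfolding H_def by (intro continuous_intros continuous_on_ker e continuous_on_det2 J c cF)
    have H0: "H e v = 0" if "v \<notin> cball 0 M" for v
      using that M(2)[of v] by (simp add: H_def)
    have H1: "H e v = 0" if "v \<in> K" for v
    proof -
      have "\<exists>i. 3/2 * e \<le> \<bar>q $ i - F v $ i\<bar>"
      proof (rule ccontr)
        assume "\<not> ?thesis"
        then have *: "\<bar>q $ i - F v $ i\<bar> < 3/2 * e" for i by (auto simp: not_le)
        have "norm (q - F v) \<le> (\<Sum>i\<in>UNIV. \<bar>(q - F v) $ i\<bar>)" by (rule norm_le_l1_cart)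
        also have "\<dots> < \<delta>" using *[of 1] *[of 2] e(2) m(2) by (simp add: sum_2)
        finally show False using \<delta>(2)[OF that] by (simp add: dist_norm)
      qed
      then obtain i where i: "3/2 * e \<le> \<bar>q $ i - F v $ i\<bar>" ..
      from ker0_far[OF e(1) i] exhaust_2[of i] show ?thesis by (auto simp: H_def)
    qed
    have eq: "H e v = (\<Sum>z\<in>Z. if v \<in> ball z (r z) then H e v else 0)" for v
    proof (cases "v \<in> (\<Union>z\<in>Z. ball z (r z))")
      case True
      then obtain z where z: "z \<in> Z" "v \<in> ball z (r z)" by blast
      have "(\<Sum>z\<in>Z. if v \<in> ball z (r z) then H e v else 0) = (\<Sum>x\<in>{z}. if v \<in> ball x (r x) then H e v else 0)"
        by (rule sum.mono_neutral_right[OF fin]) (use z disj in auto)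
      then show ?thesis using z by simp
    next
      case False
      then have "H e v = 0" using H0 H1 unfolding K_def by blast
      moreover from this have "(\<Sum>z\<in>Z. if v \<in> ball z (r z) then H e v else 0) = 0" by (intro sum.neutral) auto
      ultimately show ?thesis by simp
    qed
    have i: "(\<lambda>v. if v \<in> ball z (r z) then H e v else 0) integrable_on UNIV" for z
      unfolding integrable_restrict_UNIV
      by (rule set_lebesgue_integral_eq_integral(1), rule absolutely_integrable_compact_support(2)[OF cH compact_cball[of 0 M] H0]) auto
    have "integral UNIV (H e) = integral UNIV (\<lambda>v. \<Sum>z\<in>Z. if v \<in> ball z (r z) then H e v else 0)"
      by (rule arg_cong[where f = "integral UNIV"]) (rule ext, rule eq)
    also have "\<dots> = (\<Sum>z\<in>Z. integral UNIV (\<lambda>v. if v \<in> ball z (r z) then H e v else 0))"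
      by (rule Henstock_Kurzweil_Integration.integral_sum[OF fin]) (rule i)
    also have "\<dots> = (\<Sum>z\<in>Z. integral (ball z (r z)) (H e))"
      unfolding integral_restrict_UNIV ..
    also have "(\<Sum>z\<in>Z. integral (ball z (r z)) (H e)) \<in> \<int>"
      by (rule Ints_sum) (use e0(2) m(3) e in force)
    finally show ?thesis .
  qed
  then show ?thesis unfolding H_def using m(1) by blast
qed

lemma AE_not_in_negligible: "negligible S \<Longrightarrow> AE x in lborel. x \<notin> S"
  using AE_not_in[of S lebesgue] by (simp add: negligible_iff_null_sets AE_completion_iff)

lemma norm_vec2: "norm ((v::real^2) $ 1, v $ 2) = norm v"
  by (simp add: norm_Pair norm_vec_def L2_set_def sum_2)

context compact_surface
begin

text \<open>Two null sets of points p are excluded: the vertical lines over critical values of (a,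
  b), null by Sard's theorem, and the surface itself, null as a differentiable image of the plane.
  For the other p the ray from p crosses the surface transversally and p is not on it.\<close>

lemma mollified_degree_eventually_integer:
  "AE p in lborel. \<exists>e0>0. \<forall>e. 0 < e \<and> e < e0 \<longrightarrow> mollified_degree e p \<in> \<int>"
proof -
  define \<iota> where "\<iota> v = (v $ 1, v $ 2)" for v :: "real^2"
  define F :: "real^2 \<Rightarrow> real^2" where "F v = a (\<iota> v) *\<^sub>R axis 1 1 + b (\<iota> v) *\<^sub>R axis 2 1" for v :: "real^2"
  define J :: "real^2 \<Rightarrow> real^2^2" where "J v = (\<chi> i. if i = 1 then ax (\<iota> v) *\<^sub>R axis 1 1 + ay (\<iota> v) *\<^sub>R axis 2 1
     else bx (\<iota> v) *\<^sub>R axis 1 1 + by' (\<iota> v) *\<^sub>R axis 2 1)" for v :: "real^2"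
  have ci: "continuous_on A \<iota>" for A unfolding \<iota>_def by (intro continuous_intros)
  have comp: "continuous_on A (\<lambda>v. f (\<iota> v))" if "continuous_on UNIV f" for A and f :: "real \<times> real \<Rightarrow> real"
    by (rule continuous_on_compose2[OF that ci]) auto
  have F: "F v $ 1 = a (\<iota> v)" "F v $ 2 = b (\<iota> v)" for v
    by (simp_all add: F_def axis_def)
  have det: "det (J v) = n3 (\<iota> v)" for v
    by (simp add: det_2 J_def axis_def n3_def)
  have d\<iota>: "(\<iota> has_derivative \<iota>) (at v)" for v
    unfolding \<iota>_def by (intro has_derivative_Pair bounded_linear_imp_has_derivative bounded_linear_vec_nth)
  have der: "(F has_derivative (*v) (J v)) (at v)" for v
  proof (rule has_derivative_eq_rhs)
    show "(F has_derivative (\<lambda>h. (fst (\<iota> h) *\<^sub>R ax (\<iota> v) + snd (\<iota> h) *\<^sub>R ay (\<iota> v)) *\<^sub>R axis 1 1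
        + (fst (\<iota> h) *\<^sub>R bx (\<iota> v) + snd (\<iota> h) *\<^sub>R by' (\<iota> v)) *\<^sub>R axis 2 1)) (at v)"
      unfolding F_def
      by (intro has_derivative_add has_derivative_scaleR_left
        has_derivative_compose[OF d\<iota> C1_planeD(1)[OF C1(1)]] has_derivative_compose[OF d\<iota> C1_planeD(1)[OF C1(4)]])
    show "(\<lambda>h. (fst (\<iota> h) *\<^sub>R ax (\<iota> v) + snd (\<iota> h) *\<^sub>R ay (\<iota> v)) *\<^sub>R axis 1 1
        + (fst (\<iota> h) *\<^sub>R bx (\<iota> v) + snd (\<iota> h) *\<^sub>R by' (\<iota> v)) *\<^sub>R axis 2 1) = (*v) (J v)"
      by (simp add: fun_eq_iff vec_eq_iff forall_2 matrix_vector_mult_def sum_2 J_def \<iota>_def axis_def algebra_simps)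
  qed
  have cJ: "continuous_on UNIV J"
    unfolding J_def
  proof (rule continuous_on_vec_lambda)
    show "continuous_on UNIV (\<lambda>v. if i = 1 then ax (\<iota> v) *\<^sub>R axis 1 1 + ay (\<iota> v) *\<^sub>R axis 2 1
     else bx (\<iota> v) *\<^sub>R axis 1 1 + by' (\<iota> v) *\<^sub>R axis 2 1 :: real^2)" for i :: 2
      by (cases "i = 1") (auto intro!: continuous_intros comp C1_planeD[OF C1(1)] C1_planeD[OF C1(4)])
  qed
  have cc: "continuous_on UNIV (\<lambda>v. c (\<iota> v))" by (rule comp) (rule C1_planeD[OF C1(7)])
  have norm\<iota>: "norm (\<iota> v) = norm v" for v unfolding \<iota>_def by (rule norm_vec2)
  have M1: "F v = 0" if "M \<le> norm v" for v
    using M(2,3)[THEN vanishes_beyondD, of "\<iota> v"] that by (simp add: F_def norm\<iota>)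
  have M2: "det (J v) = 0" if "M \<le> norm v" for v
    using vanish[THEN vanishes_beyondD, of "\<iota> v"] that by (simp add: det n3_def norm\<iota>)
  define C where "C = F ` {v. det (J v) = 0}"
  have negC: "negligible C" unfolding C_def
  proof (rule baby_Sard)
    show "(F has_derivative (*v) (J v)) (at v within {v. det (J v) = 0})" for v
      using der by (rule has_derivative_at_withinI)
  qed (auto simp: det_eq_0_rank)
  \<comment> \<open>The parameter points of norm M are critical and are mapped to 0, so avoiding
    critical values also ensures q \<noteq> 0.\<close>
  have 0: "0 \<in> C"
  proof -
    have "norm (M *\<^sub>R axis 1 1 :: real^2) = M" using M(1) by (simp add: norm_axis_1)
    then show ?thesis using M1[of "M *\<^sub>R axis 1 1"] M2[of "M *\<^sub>R axis 1 1"] unfolding C_def by (intro image_eqI) auto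
  qed
  have "C \<in> null_sets lebesgue" using negC by (simp add: negligible_iff_null_sets)
  \<comment> \<open>A Borel null set containing C, so that its product with the line is a measurable
    null set.\<close>
  then obtain N where N: "N \<in> null_sets lborel" "C \<subseteq> N"
    by (meson null_sets_completion_iff2)
  have "N \<times> (UNIV::real set) \<in> null_sets (lborel \<Otimes>\<^sub>M lborel)"
    by (rule lborel.times_in_null_sets1[OF N(1)]) simp
  then have "negligible (N \<times> (UNIV::real set))"
    by (simp add: lborel_prod negligible_iff_null_sets null_sets_completionI)
  then have "negligible ((\<lambda>x. (fst x $ 1, fst x $ 2, snd x)) ` (N \<times> (UNIV::real set)))"
    by (rule negligible_differentiable_image_negligible[rotated])
      (auto intro!: linear_imp_differentiable_on linearI)
  then have N': "negligible {p::real \<times> real \<times> real. vector [fst p, fst (snd p)] \<in> C}"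
  proof (rule negligible_subset)
    show "{p. vector [fst p, fst (snd p)] \<in> C} \<subseteq> (\<lambda>x. (fst x $ 1, fst x $ 2, snd x)) ` (N \<times> (UNIV::real set))"
    proof
      fix p :: "real \<times> real \<times> real" assume "p \<in> {p. vector [fst p, fst (snd p)] \<in> C}"
      then have "vector [fst p, fst (snd p)] \<in> N" using N(2) by blast
      then show "p \<in> (\<lambda>x. (fst x $ 1, fst x $ 2, snd x)) ` (N \<times> (UNIV::real set))"
        by (intro image_eqI[of _ _ "(vector [fst p, fst (snd p)], snd (snd p))"]) auto
    qed
  qed
  have R: "negligible (range (\<lambda>z. (a z, b z, c z)))"
  proof (rule negligible_differentiable_image_lowdim)
    have "f differentiable_on UNIV" if "C1_plane f fx fy" for f fx fy :: "real \<times> real \<Rightarrow> real"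
      using C1_planeD(1)[OF that] unfolding differentiable_on_def differentiable_def by blast
    then have "a differentiable_on UNIV" "b differentiable_on UNIV" "c differentiable_on UNIV" using C1 by blast+
    then show "(\<lambda>z. (a z, b z, c z)) differentiable_on UNIV"
      unfolding differentiable_on_def by (auto intro!: differentiable_Pair)
  qed simp
  have "AE p in lborel. p \<notin> {p::real \<times> real \<times> real. vector [fst p, fst (snd p)] \<in> C}" by (rule AE_not_in_negligible[OF N'])
  moreover have "AE p in lborel. p \<notin> range (\<lambda>z. (a z, b z, c z))" by (rule AE_not_in_negligible[OF R])
  ultimately show ?thesis
  proof eventually_elim
    case (elim p)
    define q :: "real^2" where "q = vector [fst p, fst (snd p)]"
    have q: "q $ 1 = fst p" "q $ 2 = fst (snd p)" by (simp_all add: q_def)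
    have "q \<notin> C" using elim(1) by (simp add: q_def)
    then have "q \<noteq> 0" using 0 by auto
    have reg: "det (J v) \<noteq> 0 \<and> c (\<iota> v) \<noteq> snd (snd p)" if "F v = q" for v
    proof
      show "det (J v) \<noteq> 0" using \<open>q \<notin> C\<close> that by (auto simp: C_def)
      have ab: "a (\<iota> v) = fst p" "b (\<iota> v) = fst (snd p)" using F[of v] that q by auto
      show "c (\<iota> v) \<noteq> snd (snd p)"
      proof
        assume "c (\<iota> v) = snd (snd p)"
        then have "p = (a (\<iota> v), b (\<iota> v), c (\<iota> v))" using ab by (simp add: prod_eq_iff)
        then show False using elim(2) by blast
      qed
    qed
    have "mollified_degree e p = integral UNIV (\<lambda>v. ker0 e (q $ 1 - F v $ 1) * ker0 e (q $ 2 - F v $ 2) * kerI e (snd (snd p) - c (\<iota> v)) * det (J v))"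
      if e: "e > 0" for e
    proof -
      have v: "vanishes_beyond M (degree_density e p)"
        using vanish unfolding vanishes_beyond_def degree_density_def n3_def by simp
      have "mollified_degree e p = integral UNIV (degree_density e p)"
        unfolding mollified_degree_def by (rule integral_UNIV_eq_square[OF v, symmetric])
      also have "\<dots> = integral UNIV (\<lambda>v::real^2. degree_density e p (v $ 1, v $ 2))"
      proof (rule integral_vec2[symmetric])
        show "continuous_on UNIV (degree_density e p)"
          by (rule continuous_on_densities(5)[OF e continuous_on_const continuous_on_id])
        show "degree_density e p z = 0" if "z \<notin> cball 0 M" for z
          using that by (intro vanishes_beyondD[OF v]) auto
      qed simp
      finally show ?thesis by (simp add: degree_density_def kk1_def kk2_def kkI_def F det q \<iota>_def)
    qed
    then show ?case
      using degree_eventually_integer[OF der cJ cc M1 M2 \<open>q \<noteq> 0\<close> reg] by auto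
  qed
qed

lemmas volume_bound = volume_bound_if_eventually_integer[OF mollified_degree_eventually_integer]

end

subsection \<open>The isoperimetric inequality\<close>

lemma norm_cross3_le: "norm (cross3 x y) \<le> norm x * norm y"
proof (rule power2_le_imp_le)
  show "(norm (cross3 x y))\<^sup>2 \<le> (norm x * norm y)\<^sup>2"
    using norm_cross_dot[of x y] zero_le_power2[of "x \<bullet> y"] by linarith
qed simp

text \<open>The volume bound with two substitutions: the triple product integrates to three times
  the third coordinate formula for the volume, and the area is at most G/2, with equality for
  conformal maps. The constant is 9 / (8 * 36 pi) = 1 / (32 pi).\<close>

lemma isoperimetric_inequality:
  fixes u :: "real \<times> real \<Rightarrow> real^3"
  assumes u: "C1_plane u ux uy" "C1_plane ux uxx uxy" "C1_plane uy uxy uyy" and M: "vanishes_beyond M u" "M > 0"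
  defines "G \<equiv> integral (square M) (\<lambda>z. (norm (ux z))\<^sup>2 + (norm (uy z))\<^sup>2)"
  shows "\<bar>integral (square M) (\<lambda>z. u z \<bullet> cross3 (ux z) (uy z))\<bar> \<le> sqrt (G ^ 3 / (32 * pi))"
proof -
  note lin = C1_plane_linear[OF bounded_linear_vec_nth]
  interpret s: compact_surface "\<lambda>z. u z $ 1" "\<lambda>z. u z $ 2" "\<lambda>z. u z $ 3" "\<lambda>z. ux z $ 1" "\<lambda>z. uy z $ 1"
    "\<lambda>z. uxx z $ 1" "\<lambda>z. uxy z $ 1" "\<lambda>z. uyy z $ 1" "\<lambda>z. ux z $ 2" "\<lambda>z. uy z $ 2"
    "\<lambda>z. uxx z $ 2" "\<lambda>z. uxy z $ 2" "\<lambda>z. uyy z $ 2" "\<lambda>z. ux z $ 3" "\<lambda>z. uy z $ 3" M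
    by unfold_locales (use lin[OF u(1)] lin[OF u(2)] lin[OF u(3)] M in \<open>auto simp: vanishes_beyond_def\<close>)
  have c: "continuous_on UNIV ux" "continuous_on UNIV uy" using C1_planeD[OF u(1)] by auto
  have i: "(\<lambda>z. f z * s.n1 z) integrable_on square M" "(\<lambda>z. f z * s.n2 z) integrable_on square M"
    "(\<lambda>z. f z * s.n3 z) integrable_on square M" if "continuous_on UNIV f" for f
    using that by (auto intro!: integrable_continuous continuous_intros s.cont continuous_on_subset[OF that])
  have cu: "continuous_on UNIV (\<lambda>z. u z $ i)" for i using C1_planeD(2)[OF u(1)] by (intro continuous_intros)
  have "(\<lambda>z. u z \<bullet> cross3 (ux z) (uy z)) = (\<lambda>z. u z $ 1 * s.n1 z + u z $ 2 * s.n2 z + u z $ 3 * s.n3 z)"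
    by (simp add: fun_eq_iff cross3_simps inner_vec_def sum_3 s.n1_def s.n2_def s.n3_def)
  then have "integral (square M) (\<lambda>z. u z \<bullet> cross3 (ux z) (uy z)) = 3 * integral (square M) (\<lambda>z. u z $ 3 * s.n3 z)"
    using s.jacobian_identities(5,6)[of 1]
    by (simp add: Henstock_Kurzweil_Integration.integral_add integrable_add i cu)
  then have 1: "\<bar>integral (square M) (\<lambda>z. u z \<bullet> cross3 (ux z) (uy z))\<bar> \<le> 3 * sqrt ((integral (square M) (\<lambda>z. norm (s.nn z))) ^ 3 / (36 * pi))"
    using s.volume_bound by (simp add: abs_mult)
  have nn: "norm (s.nn z) \<le> 1/2 * ((norm (ux z))\<^sup>2 + (norm (uy z))\<^sup>2)" for z
  proof -
    have "norm (s.nn z) = norm (cross3 (ux z) (uy z))"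
      by (simp add: s.nn_def norm_Pair norm_vec_def L2_set_def sum_3 cross3_simps s.n1_def s.n2_def s.n3_def add.assoc)
    also have "\<dots> \<le> norm (ux z) * norm (uy z)"
      by (rule norm_cross3_le)
    also have "\<dots> \<le> 1/2 * ((norm (ux z))\<^sup>2 + (norm (uy z))\<^sup>2)"
      using zero_le_power2[of "norm (ux z) - norm (uy z)"] by (simp add: power2_diff)
    finally show ?thesis .
  qed
  have "integral (square M) (\<lambda>z. norm (s.nn z)) \<le> integral (square M) (\<lambda>z. 1/2 * ((norm (ux z))\<^sup>2 + (norm (uy z))\<^sup>2))"
    by (rule integral_le[OF _ _ nn]) (auto intro!: integrable_continuous continuous_intros continuous_on_subset[OF c(1)] continuous_on_subset[OF c(2)])
  then have "integral (square M) (\<lambda>z. norm (s.nn z)) \<le> G / 2" by (simp add: G_def)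
  moreover have "0 \<le> integral (square M) (\<lambda>z. norm (s.nn z))"
    by (rule integral_nonneg) (auto intro!: integrable_continuous continuous_intros)
  ultimately have "(integral (square M) (\<lambda>z. norm (s.nn z))) ^ 3 / (36 * pi) \<le> (G / 2) ^ 3 / (36 * pi)"
    by (intro divide_right_mono power_mono) auto
  then have "3 * sqrt ((integral (square M) (\<lambda>z. norm (s.nn z))) ^ 3 / (36 * pi)) \<le> 3 * sqrt ((G / 2) ^ 3 / (36 * pi))"
    by simp
  also have "\<dots> = sqrt (9 * ((G / 2) ^ 3 / (36 * pi)))" by (subst real_sqrt_mult) simp
  also have "9 * ((G / 2) ^ 3 / (36 * pi)) = G ^ 3 / (32 * pi)" by (simp add: power3_eq_cube field_simps)
  finally show ?thesis using 1 by simp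
qed

subsection \<open>Calculus in space-time\<close>

text \<open>Points are (t, x, y). Derivatives are taken within \<open>I \<times> UNIV\<close>, hence
  one-sided in time at end points of I, so that the initial time is included.\<close>

definition C1_spacetime :: "real set \<Rightarrow> (real \<times> real \<times> real \<Rightarrow> 'a::real_normed_vector) \<Rightarrow> (real \<times> real \<times> real \<Rightarrow> 'a)
    \<Rightarrow> (real \<times> real \<times> real \<Rightarrow> 'a) \<Rightarrow> (real \<times> real \<times> real \<Rightarrow> 'a) \<Rightarrow> bool" where
  "C1_spacetime I f ft fx fy \<longleftrightarrow>
    (\<forall>p\<in>I \<times> UNIV. (f has_derivative (\<lambda>v. fst v *\<^sub>R ft p + fst (snd v) *\<^sub>R fx p + snd (snd v) *\<^sub>R fy p)) (at p within I \<times> UNIV)) \<and>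
    continuous_on (I \<times> UNIV) ft \<and> continuous_on (I \<times> UNIV) fx \<and> continuous_on (I \<times> UNIV) fy"

lemma C1_spacetimeD:
  assumes "C1_spacetime I f ft fx fy"
  shows "p \<in> I \<times> UNIV \<Longrightarrow> (f has_derivative (\<lambda>v. fst v *\<^sub>R ft p + fst (snd v) *\<^sub>R fx p + snd (snd v) *\<^sub>R fy p)) (at p within I \<times> UNIV)"
    "continuous_on (I \<times> UNIV) f" "continuous_on (I \<times> UNIV) ft" "continuous_on (I \<times> UNIV) fx" "continuous_on (I \<times> UNIV) fy"
  using assms unfolding C1_spacetime_def continuous_on_eq_continuous_within[of _ f]
  by (blast intro: has_derivative_continuous)+

lemma C1_spacetime_subset:
  assumes "C1_spacetime I f ft fx fy" "K \<subseteq> I"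
  shows "C1_spacetime K f ft fx fy"
proof -
  have K: "K \<times> (UNIV :: (real \<times> real) set) \<subseteq> I \<times> UNIV" using assms(2) by blast
  show ?thesis
    unfolding C1_spacetime_def
  proof (intro conjI ballI)
    fix p :: "real \<times> real \<times> real" assume "p \<in> K \<times> UNIV"
    then show "(f has_derivative (\<lambda>v. fst v *\<^sub>R ft p + fst (snd v) *\<^sub>R fx p + snd (snd v) *\<^sub>R fy p)) (at p within K \<times> UNIV)"
      using has_derivative_subset[OF C1_spacetimeD(1)[OF assms(1)] K] K by blast
  qed (use C1_spacetimeD[OF assms(1)] continuous_on_subset[OF _ K] in blast)+
qed

lemma C1_spacetime_plane:
  assumes f: "C1_spacetime I f ft fx fy" and t: "t \<in> I"
  shows "C1_plane (\<lambda>z. f (t, z)) (\<lambda>z. fx (t, z)) (\<lambda>z. fy (t, z))"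
  unfolding C1_plane_def
proof (intro conjI allI)
  fix z
  have "((\<lambda>z. f (t, z)) has_derivative (\<lambda>h. fst (0::real, h) *\<^sub>R ft (t, z) + fst (snd (0::real, h)) *\<^sub>R fx (t, z) + snd (snd (0::real, h)) *\<^sub>R fy (t, z))) (at z within UNIV)"
    by (rule has_derivative_in_compose2[where g = f and f = "Pair t" and t = "I \<times> UNIV" and s = UNIV and x = z, OF C1_spacetimeD(1)[OF f]])
      (use t in \<open>auto intro!: derivative_eq_intros\<close>)
  then show "((\<lambda>z. f (t, z)) has_derivative (\<lambda>v. fst v *\<^sub>R fx (t, z) + snd v *\<^sub>R fy (t, z))) (at z)" by simp
  have *: "continuous_on UNIV (\<lambda>z. g (t, z))" if "continuous_on (I \<times> UNIV) g" for g :: "_ \<Rightarrow> 'a"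
    by (rule continuous_on_compose2[OF that]) (use t in \<open>auto intro!: continuous_intros\<close>)
  show "continuous_on UNIV (\<lambda>z. fx (t, z))" "continuous_on UNIV (\<lambda>z. fy (t, z))"
    by (rule *, rule C1_spacetimeD[OF f])+
qed

lemma C1_spacetime_time:
  assumes f: "C1_spacetime I f ft fx fy" and t: "t \<in> I"
  shows "((\<lambda>s. f (s, z)) has_vector_derivative ft (t, z)) (at t within I)"
proof -
  have "((\<lambda>s. f (s, z)) has_derivative (\<lambda>h. fst (h, 0::real \<times> real) *\<^sub>R ft (t, z) + fst (snd (h, 0::real \<times> real)) *\<^sub>R fx (t, z) + snd (snd (h, 0::real \<times> real)) *\<^sub>R fy (t, z))) (at t within I)"
    by (rule has_derivative_in_compose2[where g = f and f = "\<lambda>s. (s, z)" and t = "I \<times> UNIV" and s = I and x = t, OF C1_spacetimeD(1)[OF f]])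
      (use t in \<open>auto intro!: derivative_eq_intros\<close>)
  then show ?thesis by (simp add: has_vector_derivative_def)
qed

lemma (in bounded_bilinear) C1_spacetime:
  assumes f: "C1_spacetime I f ft fx fy" and g: "C1_spacetime I g gt gx gy"
  shows "C1_spacetime I (\<lambda>z. prod (f z) (g z)) (\<lambda>z. prod (f z) (gt z) + prod (ft z) (g z))
     (\<lambda>z. prod (f z) (gx z) + prod (fx z) (g z)) (\<lambda>z. prod (f z) (gy z) + prod (fy z) (g z))"
  unfolding C1_spacetime_def
proof (intro conjI ballI)
  fix p :: "real \<times> real \<times> real" assume p: "p \<in> I \<times> UNIV"
  show "((\<lambda>z. prod (f z) (g z)) has_derivative (\<lambda>v. fst v *\<^sub>R (prod (f p) (gt p) + prod (ft p) (g p)) +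
      fst (snd v) *\<^sub>R (prod (f p) (gx p) + prod (fx p) (g p)) + snd (snd v) *\<^sub>R (prod (f p) (gy p) + prod (fy p) (g p)))) (at p within I \<times> UNIV)"
    by (rule has_derivative_eq_rhs[OF FDERIV[OF C1_spacetimeD(1)[OF f p] C1_spacetimeD(1)[OF g p]]])
      (simp add: fun_eq_iff add_left add_right scaleR_left scaleR_right scaleR_add_right)
qed (use C1_spacetimeD[OF f] C1_spacetimeD[OF g] in \<open>auto intro!: continuous_on_add continuous_on\<close>)

lemmas C1_spacetime_mult = bounded_bilinear.C1_spacetime[OF bounded_bilinear_mult]
lemmas C1_spacetime_inner = bounded_bilinear.C1_spacetime[OF bounded_bilinear_inner]
lemma bounded_bilinear_cross3: "bounded_bilinear cross3"
  unfolding bilinear_conv_bounded_bilinear[symmetric] bilinear_def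
  by (auto intro!: linearI simp: cross3_simps vec_eq_iff forall_3)

lemmas C1_spacetime_cross3 = bounded_bilinear.C1_spacetime[OF bounded_bilinear_cross3]

lemma C1_spacetime_add:
  assumes "C1_spacetime I f ft fx fy" "C1_spacetime I g gt gx gy"
  shows "C1_spacetime I (\<lambda>z. f z + g z) (\<lambda>z. ft z + gt z) (\<lambda>z. fx z + gx z) (\<lambda>z. fy z + gy z)"
  unfolding C1_spacetime_def
proof (intro conjI ballI)
  fix p :: "real \<times> real \<times> real" assume p: "p \<in> I \<times> UNIV"
  show "((\<lambda>z. f z + g z) has_derivative (\<lambda>v. fst v *\<^sub>R (ft p + gt p) + fst (snd v) *\<^sub>R (fx p + gx p) + snd (snd v) *\<^sub>R (fy p + gy p))) (at p within I \<times> UNIV)"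
    by (rule has_derivative_eq_rhs[OF has_derivative_add[OF C1_spacetimeD(1)[OF assms(1) p] C1_spacetimeD(1)[OF assms(2) p]]])
      (simp add: fun_eq_iff algebra_simps)
qed (use C1_spacetimeD[OF assms(1)] C1_spacetimeD[OF assms(2)] in \<open>auto intro!: continuous_intros\<close>)

lemma C1_spacetime_cmult:
  fixes f :: "real \<times> real \<times> real \<Rightarrow> real"
  assumes "C1_spacetime I f ft fx fy"
  shows "C1_spacetime I (\<lambda>z. k * f z) (\<lambda>z. k * ft z) (\<lambda>z. k * fx z) (\<lambda>z. k * fy z)"
proof -
  have "C1_spacetime I (\<lambda>z. k) (\<lambda>z. 0) (\<lambda>z. 0) (\<lambda>z. 0)" by (simp add: C1_spacetime_def)
  from C1_spacetime_mult[OF this assms] show ?thesis by simp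
qed

text \<open>Needed for translations of time and, with \<sigma> = -1, for its reversal.\<close>

lemma C1_spacetime_affine_time:
  assumes f: "C1_spacetime I f ft fx fy" and K: "\<And>s. s \<in> K \<Longrightarrow> c + \<sigma> * s \<in> I"
  shows "C1_spacetime K (\<lambda>p. f (c + \<sigma> * fst p, snd p)) (\<lambda>p. \<sigma> *\<^sub>R ft (c + \<sigma> * fst p, snd p))
    (\<lambda>p. fx (c + \<sigma> * fst p, snd p)) (\<lambda>p. fy (c + \<sigma> * fst p, snd p))"
  unfolding C1_spacetime_def
proof (intro conjI ballI)
  define h where "h p = (c + \<sigma> * fst p, snd p)" for p :: "real \<times> real \<times> real"
  have h: "h ` (K \<times> UNIV) \<subseteq> I \<times> UNIV" using K by (auto simp: h_def)
  have dh: "(h has_derivative (\<lambda>v. (\<sigma> * fst v, snd v))) (at p within A)" for p A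
    unfolding h_def by (auto intro!: derivative_eq_intros)
  fix p :: "real \<times> real \<times> real" assume p: "p \<in> K \<times> UNIV"
  have "((\<lambda>p. f (h p)) has_derivative (\<lambda>v. fst (\<sigma> * fst v, snd v) *\<^sub>R ft (h p) + fst (snd (\<sigma> * fst v, snd v)) *\<^sub>R fx (h p) + snd (snd (\<sigma> * fst v, snd v)) *\<^sub>R fy (h p))) (at p within K \<times> UNIV)"
    by (rule has_derivative_in_compose2[OF C1_spacetimeD(1)[OF f] h p dh])
  then show "((\<lambda>p. f (c + \<sigma> * fst p, snd p)) has_derivative (\<lambda>v. fst v *\<^sub>R (\<sigma> *\<^sub>R ft (c + \<sigma> * fst p, snd p)) +
     fst (snd v) *\<^sub>R fx (c + \<sigma> * fst p, snd p) + snd (snd v) *\<^sub>R fy (c + \<sigma> * fst p, snd p))) (at p within K \<times> UNIV)"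
    by (simp add: h_def mult.commute)
next
  have *: "continuous_on (K \<times> UNIV) (\<lambda>p. g (c + \<sigma> * fst p, snd p))" if "continuous_on (I \<times> UNIV) g" for g :: "_ \<Rightarrow> 'a"
    by (rule continuous_on_compose2[OF that]) (use K in \<open>auto intro!: continuous_intros\<close>)
  show "continuous_on (K \<times> UNIV) (\<lambda>p. \<sigma> *\<^sub>R ft (c + \<sigma> * fst p, snd p))"
    "continuous_on (K \<times> UNIV) (\<lambda>p. fx (c + \<sigma> * fst p, snd p))"
    "continuous_on (K \<times> UNIV) (\<lambda>p. fy (c + \<sigma> * fst p, snd p))"
    by (intro continuous_on_scaleR continuous_on_const * C1_spacetimeD[OF f])+
qed

text \<open>The family F that witnesses smoothness is closed under partial derivatives and therefore
  witnesses their smoothness as well; this allows iteration.\<close>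

lemma smooth_on_C1_spacetime:
  assumes "smooth_on (I \<times> UNIV) f"
  obtains ft fx fy where "C1_spacetime I f ft fx fy" "smooth_on (I \<times> UNIV) ft" "smooth_on (I \<times> UNIV) fx" "smooth_on (I \<times> UNIV) fy"
proof -
  obtain F where F: "f \<in> F" "\<And>g. g \<in> F \<Longrightarrow> continuous_on (I \<times> UNIV) g"
    "\<And>g. g \<in> F \<Longrightarrow> \<exists>D. (\<forall>x\<in>I \<times> UNIV. (g has_derivative D x) (at x within I \<times> UNIV)) \<and> (\<forall>b\<in>Basis. (\<lambda>x. D x b) \<in> F)"
    using assms unfolding smooth_on_def by blast
  have sm: "smooth_on (I \<times> UNIV) g" if "g \<in> F" for g
    unfolding smooth_on_def using that F by blast
  obtain D where D: "\<And>x. x \<in> I \<times> UNIV \<Longrightarrow> (f has_derivative D x) (at x within I \<times> UNIV)" "\<And>b. b \<in> Basis \<Longrightarrow> (\<lambda>x. D x b) \<in> F"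
    using F(3)[OF F(1)] by blast
  have b: "(1, 0, 0) \<in> (Basis :: (real \<times> real \<times> real) set)" "(0, 1, 0) \<in> (Basis :: (real \<times> real \<times> real) set)" "(0, 0, 1) \<in> (Basis :: (real \<times> real \<times> real) set)"
    by (auto simp: Basis_prod_def zero_prod_def)
  have "D p v = fst v *\<^sub>R D p (1, 0, 0) + fst (snd v) *\<^sub>R D p (0, 1, 0) + snd (snd v) *\<^sub>R D p (0, 0, 1)" if "p \<in> I \<times> UNIV" for p v
  proof -
    interpret bounded_linear "D p" using D(1)[OF that] by (rule has_derivative_bounded_linear)
    have "v = fst v *\<^sub>R (1, 0, 0) + fst (snd v) *\<^sub>R (0, 1, 0) + snd (snd v) *\<^sub>R (0, 0, 1)" by (simp add: prod_eq_iff)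
    then show ?thesis by (metis add scaleR)
  qed
  then have "D p = (\<lambda>v. fst v *\<^sub>R D p (1, 0, 0) + fst (snd v) *\<^sub>R D p (0, 1, 0) + snd (snd v) *\<^sub>R D p (0, 0, 1))" if "p \<in> I \<times> UNIV" for p
    using that by (intro ext)
  then have "C1_spacetime I f (\<lambda>p. D p (1, 0, 0)) (\<lambda>p. D p (0, 1, 0)) (\<lambda>p. D p (0, 0, 1))"
    unfolding C1_spacetime_def using D(1) F(2)[OF D(2)[OF b(1)]] F(2)[OF D(2)[OF b(2)]] F(2)[OF D(2)[OF b(3)]] by simp
  then show ?thesis using that sm D(2) b by blast
qed

text \<open>Write f as f at time a plus the integral of \<open>fs\<close>, differentiate under the
  integral in x, and then differentiate the result in s by the fundamental theorem. This works up to
  the ends of the interval, where derivatives in s are one-sided.\<close>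

lemma mixed_partials_commute:
  fixes f fs fx fsx fxs :: "real \<Rightarrow> real \<Rightarrow> 'a::euclidean_space"
  assumes ab: "a < b" "s \<in> {a..b}"
    and fs: "\<And>s x. s \<in> {a..b} \<Longrightarrow> ((\<lambda>s. f s x) has_vector_derivative fs s x) (at s within {a..b})"
    and fx: "\<And>s x. s \<in> {a..b} \<Longrightarrow> ((\<lambda>x. f s x) has_vector_derivative fx s x) (at x)"
    and fsx: "\<And>s x. s \<in> {a..b} \<Longrightarrow> ((\<lambda>x. fs s x) has_vector_derivative fsx s x) (at x)"
    and fxs: "\<And>s x. s \<in> {a..b} \<Longrightarrow> ((\<lambda>s. fx s x) has_vector_derivative fxs s x) (at s within {a..b})"
    and c: "continuous_on ({a..b} \<times> UNIV) (\<lambda>(s, x). fs s x)" "continuous_on ({a..b} \<times> UNIV) (\<lambda>(s, x). fsx s x)"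
  shows "fxs s x = fsx s x"
proof -
  have c1: "continuous_on {a..b} (\<lambda>s. fs s x)" "continuous_on {a..b} (\<lambda>s. fsx s x)" for x
  proof -
    have "continuous_on {a..b} (\<lambda>s. case (s, x) of (s, x) \<Rightarrow> fs s x)" "continuous_on {a..b} (\<lambda>s. case (s, x) of (s, x) \<Rightarrow> fsx s x)"
      by (rule continuous_on_compose2[OF c(1)] continuous_on_compose2[OF c(2)]; auto intro!: continuous_intros)+
    then show "continuous_on {a..b} (\<lambda>s. fs s x)" "continuous_on {a..b} (\<lambda>s. fsx s x)" by simp_all
  qed
  have ftc: "f s x = f a x + integral {a..s} (\<lambda>r. fs r x)" if "s \<in> {a..b}" for s x
  proof -
    have "((\<lambda>r. fs r x) has_integral f s x - f a x) {a..s}"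
    proof (rule fundamental_theorem_of_calculus)
      show "((\<lambda>s. f s x) has_vector_derivative fs r x) (at r within {a..s})" if "r \<in> {a..s}" for r
        by (rule has_vector_derivative_within_subset[OF fs]) (use that \<open>s \<in> {a..b}\<close> in auto)
    qed (use that in auto)
    then show ?thesis by (simp add: integral_unique)
  qed
  have fx_eq: "fx s x = fx a x + integral {a..s} (\<lambda>r. fsx r x)" if "s \<in> {a..b}" for s x
  proof -
    have "((\<lambda>x. integral (cbox a s) (\<lambda>r. fs r x)) has_vector_derivative integral (cbox a s) (\<lambda>r. fsx r x)) (at x within UNIV)"
    proof (rule leibniz_rule_vector_derivative)
      show "((\<lambda>x. fs t x) has_vector_derivative fsx t x) (at x within UNIV)" if "t \<in> cbox a s" for x t
        using fsx[of t x] that \<open>s \<in> {a..b}\<close> by auto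
      show "(\<lambda>r. fs r x) integrable_on cbox a s" for x
        by (rule integrable_continuous, rule continuous_on_subset[OF c1(1)]) (use that in auto)
      show "continuous_on (UNIV \<times> cbox a s) (\<lambda>(x, t). fsx t x)"
      proof -
        have "continuous_on (UNIV \<times> cbox a s) (\<lambda>p. case (snd p, fst p) of (s, x) \<Rightarrow> fsx s x)"
          by (rule continuous_on_compose2[OF c(2)]) (use that in \<open>auto intro!: continuous_intros\<close>)
        then show ?thesis by (simp add: case_prod_beta)
      qed
    qed auto
    then have "((\<lambda>x. f a x + integral {a..s} (\<lambda>r. fs r x)) has_vector_derivative fx a x + integral {a..s} (\<lambda>r. fsx r x)) (at x)"
      using fx[of a x] ab(1) by (intro has_vector_derivative_add) auto
    then have "((\<lambda>x. f s x) has_vector_derivative fx a x + integral {a..s} (\<lambda>r. fsx r x)) (at x)"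
      using ftc[OF that] by simp
    then show ?thesis using fx[OF that, of x] vector_derivative_unique_at by blast
  qed
  have "((\<lambda>s. fx a x + integral {a..s} (\<lambda>r. fsx r x)) has_vector_derivative 0 + fsx s x) (at s within {a..b})"
    by (intro has_vector_derivative_add has_vector_derivative_const integral_has_vector_derivative c1 ab)
  then have "((\<lambda>s. fx s x) has_vector_derivative fsx s x) (at s within {a..b})"
    by (intro has_vector_derivative_transform[OF ab(2) fx_eq]) simp_all
  then show ?thesis
    using vector_derivative_unique_within_closed_interval[OF ab(1)] ab(2) fxs[OF ab(2), of x] by (metis box_real(2))
qed

lemma C1_spacetime_mixed_time:
  fixes f :: "real \<times> real \<times> real \<Rightarrow> 'a::euclidean_space"
  assumes f: "C1_spacetime {a..b} f ft fx fy" "C1_spacetime {a..b} ft ftt ftx fty" "C1_spacetime {a..b} fx fxt fxx fxy"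
    "C1_spacetime {a..b} fy fyt fyx fyy" and ab: "a < b" "p \<in> {a..b} \<times> UNIV"
  shows "fxt p = ftx p" "fyt p = fty p"
proof -
  obtain s x y where p: "p = (s, x, y)" "s \<in> {a..b}" using ab(2) by auto
  note pl = C1_planeD(5,6)[OF C1_spacetime_plane]
  have c: "continuous_on ({a..b} \<times> UNIV) (\<lambda>(s, x). g (s, x, y))" "continuous_on ({a..b} \<times> UNIV) (\<lambda>(s, y). g (s, x, y))"
    if "continuous_on ({a..b} \<times> UNIV) g" for g :: "_ \<Rightarrow> 'a"
    unfolding case_prod_beta by (rule continuous_on_compose2[OF that]; auto intro!: continuous_intros)+
  show "fxt p = ftx p" unfolding p(1)
    by (rule mixed_partials_commute[OF ab(1) p(2), where f = "\<lambda>s x. f (s, x, y)" and fs = "\<lambda>s x. ft (s, x, y)"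
        and fx = "\<lambda>s x. fx (s, x, y)" and fsx = "\<lambda>s x. ftx (s, x, y)" and fxs = "\<lambda>s x. fxt (s, x, y)"])
      (auto intro!: C1_spacetime_time[OF f(1)] C1_spacetime_time[OF f(3)] pl(1)[OF f(1)] pl(1)[OF f(2)] c C1_spacetimeD[OF f(1)] C1_spacetimeD[OF f(2)])
  show "fyt p = fty p" unfolding p(1)
    by (rule mixed_partials_commute[OF ab(1) p(2), where f = "\<lambda>s y. f (s, x, y)" and fs = "\<lambda>s y. ft (s, x, y)"
        and fx = "\<lambda>s y. fy (s, x, y)" and fsx = "\<lambda>s y. fty (s, x, y)" and fxs = "\<lambda>s y. fyt (s, x, y)"])
      (auto intro!: C1_spacetime_time[OF f(1)] C1_spacetime_time[OF f(4)] pl(2)[OF f(1)] pl(2)[OF f(2)] c C1_spacetimeD[OF f(1)] C1_spacetimeD[OF f(2)])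
qed

lemma C1_plane_mixed:
  fixes f :: "real \<times> real \<Rightarrow> 'a::euclidean_space"
  assumes f: "C1_plane f fx fy" "C1_plane fx fxx fxy" "C1_plane fy fyx fyy"
  shows "fxy z = fyx z"
proof -
  obtain x y where z: "z = (x, y)" by (cases z)
  have c: "continuous_on A (\<lambda>(x, y). g (x, y))" if "continuous_on UNIV g" for A and g :: "_ \<Rightarrow> 'a"
    using that by (auto intro: continuous_on_subset)
  have "fyx (x, y) = fxy (x, y)"
    by (rule mixed_partials_commute[of "x - 1" "x + 1" x "\<lambda>x y. f (x, y)" "\<lambda>x y. fx (x, y)" "\<lambda>x y. fy (x, y)"
        "\<lambda>x y. fxy (x, y)" "\<lambda>x y. fyx (x, y)"])
      (auto intro!: C1_planeD(5)[OF f(1)] C1_planeD(6)[OF f(1)] C1_planeD(6)[OF f(2)] C1_planeD(5)[OF f(3)] c C1_planeD(3)[OF f(1)] C1_planeD(4)[OF f(2)])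
  then show ?thesis using z by simp
qed

lemma C1_spacetime_compose_real:
  fixes f :: "real \<times> real \<times> real \<Rightarrow> real"
  assumes f: "C1_spacetime I f ft fx fy" and h: "\<And>s. (h has_real_derivative h' s) (at s)" and h': "continuous_on UNIV h'"
  shows "C1_spacetime I (\<lambda>z. h (f z)) (\<lambda>z. h' (f z) * ft z) (\<lambda>z. h' (f z) * fx z) (\<lambda>z. h' (f z) * fy z)"
  unfolding C1_spacetime_def
proof (intro conjI ballI)
  fix p :: "real \<times> real \<times> real" assume p: "p \<in> I \<times> UNIV"
  show "((\<lambda>z. h (f z)) has_derivative (\<lambda>v. fst v *\<^sub>R (h' (f p) * ft p) + fst (snd v) *\<^sub>R (h' (f p) * fx p) + snd (snd v) *\<^sub>R (h' (f p) * fy p))) (at p within I \<times> UNIV)"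
    by (rule has_derivative_eq_rhs[OF has_derivative_compose[OF C1_spacetimeD(1)[OF f p] h[unfolded has_field_derivative_def]]])
      (simp add: fun_eq_iff algebra_simps)
qed (use C1_spacetimeD[OF f] in \<open>auto intro!: continuous_intros continuous_on_compose2[OF h']\<close>)

lemma has_real_derivative_integral_square:
  fixes f :: "real \<times> real \<times> real \<Rightarrow> real"
  assumes f: "C1_spacetime {0..S} f ft fx fy" and s: "s \<in> {0..S}"
  shows "((\<lambda>s. integral (square M) (\<lambda>z. f (s, z))) has_real_derivative integral (square M) (\<lambda>z. ft (s, z))) (at s within {0..S})"
  unfolding has_real_derivative_iff_has_vector_derivative
proof (rule leibniz_rule_vector_derivative)
  show "((\<lambda>s. f (s, z)) has_vector_derivative ft (t, z)) (at t within {0..S})" if "t \<in> {0..S}" for t z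
    by (rule C1_spacetime_time[OF f that])
  show "(\<lambda>z. f (t, z)) integrable_on square M" if "t \<in> {0..S}" for t
    by (rule integrable_continuous) (rule C1_planeD(2)[OF C1_spacetime_plane[OF f that]])
  show "continuous_on ({0..S} \<times> square M) (\<lambda>(s, z). ft (s, z))"
    using C1_spacetimeD(3)[OF f] by (auto intro: continuous_on_subset)
qed (use s in auto)

section \<open>Two inequalities for the energy method on light cones\<close>

lemma gronwall_zero:
  fixes f f' :: "real \<Rightarrow> real"
  assumes d: "\<And>s. s \<in> {0..S} \<Longrightarrow> (f has_real_derivative f' s) (at s within {0..S})"
    and le: "\<And>s. s \<in> {0..S} \<Longrightarrow> f' s \<le> k * f s" and f: "f 0 = 0" "\<And>s. s \<in> {0..S} \<Longrightarrow> 0 \<le> f s" and s: "s \<in> {0..S}"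
  shows "f s = 0"
proof -
  define g where "g t = f t * exp (- k * t)" for t
  have g: "(g has_real_derivative (f' t - k * f t) * exp (- k * t)) (at t within {0..S})" if "t \<in> {0..S}" for t
    unfolding g_def by (rule derivative_eq_intros d[OF that] refl | simp add: algebra_simps)+
  have "g s \<le> g 0"
  proof (rule DERIV_nonpos_imp_decreasing_open[where f = g and a = 0 and b = s])
    show "0 \<le> s" using s by simp
    show "\<exists>y. (g has_real_derivative y) (at t) \<and> y \<le> 0" if "0 < t" "t < s" for t
    proof (intro exI conjI)
      have "t \<in> interior {0..S}" using that s by simp
      then show "(g has_real_derivative (f' t - k * f t) * exp (- k * t)) (at t)"
        using g[of t] that s at_within_interior[of t "{0..S}"] by auto
      show "(f' t - k * f t) * exp (- k * t) \<le> 0"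
        using le[of t] that s by (intro mult_nonpos_nonneg) auto
    qed
    have "continuous_on {0..S} g" by (rule DERIV_continuous_on[OF g])
    then show "continuous_on {0..s} g" by (rule continuous_on_subset) (use s in auto)
  qed
  then have "f s * exp (- k * s) \<le> 0" by (simp add: g_def f)
  then have "f s \<le> 0" by (simp add: mult_le_0_iff)
  then show ?thesis using f(2)[OF s] by simp
qed

text \<open>Completing squares: the difference of the two sides is \<rho> times the squared
  distances of x and y from multiples of t, plus a nonnegative multiple of
  \<open>t \<bullet> t\<close>. In the application (\<alpha>, \<beta>) is the displacement from the
  axis of a light cone, \<rho> the time left until its vertex, and the left side the flux of
  energy.\<close>

lemma cone_inequality:
  fixes t x y :: "'a::real_inner"
  assumes r: "\<rho> > 0" "\<alpha>\<^sup>2 + \<beta>\<^sup>2 \<le> \<rho>\<^sup>2"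
  shows "2 * \<alpha> * (x \<bullet> t) + 2 * \<beta> * (y \<bullet> t) \<le> \<rho> * (t \<bullet> t + x \<bullet> x + y \<bullet> y)"
proof -
  have "0 \<le> \<rho> * ((norm (x - (\<alpha> / \<rho>) *\<^sub>R t))\<^sup>2 + (norm (y - (\<beta> / \<rho>) *\<^sub>R t))\<^sup>2) + (\<rho>\<^sup>2 - (\<alpha>\<^sup>2 + \<beta>\<^sup>2)) / \<rho> * (t \<bullet> t)"
    using r by simp
  also have "\<dots> = \<rho> * (t \<bullet> t + x \<bullet> x + y \<bullet> y) - (2 * \<alpha> * (x \<bullet> t) + 2 * \<beta> * (y \<bullet> t))"
  proof -
    have n: "(norm (x - k *\<^sub>R t))\<^sup>2 = x \<bullet> x - 2 * k * (x \<bullet> t) + k\<^sup>2 * (t \<bullet> t)" for k and x :: 'a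
      unfolding power2_norm_eq_inner
      by (simp add: inner_diff_left inner_diff_right inner_commute power2_eq_square algebra_simps)
    have "\<rho> * ((X - 2 * (\<alpha> / \<rho>) * P + (\<alpha> / \<rho>)\<^sup>2 * T) + (Y - 2 * (\<beta> / \<rho>) * Q + (\<beta> / \<rho>)\<^sup>2 * T)) + (\<rho>\<^sup>2 - (\<alpha>\<^sup>2 + \<beta>\<^sup>2)) / \<rho> * T
      = \<rho> * (T + X + Y) - (2 * \<alpha> * P + 2 * \<beta> * Q)" for X Y P Q T
      using r(1) by (simp add: field_simps power2_eq_square)
    then show ?thesis unfolding n .
  qed
  finally show ?thesis by simp
qed

subsection \<open>Finite speed of propagation\<close>

text \<open>\<open>utx\<close> and \<open>uty\<close> appear both as space derivatives of
  \<open>ut\<close> and as time derivatives of \<open>ux\<close> and \<open>uy\<close>, and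
  \<open>uxy\<close> likewise appears twice: the symmetry of second derivatives is built into the
  parameters.\<close>

locale wave_strip =
  fixes S :: real and u ut ux uy utt utx uty uxx uxy uyy :: "real \<times> real \<times> real \<Rightarrow> real^3"
  assumes S: "S > 0"
    and C1: "C1_spacetime {0..S} u ut ux uy" "C1_spacetime {0..S} ut utt utx uty"
      "C1_spacetime {0..S} ux utx uxx uxy" "C1_spacetime {0..S} uy uty uxy uyy"
    and eq: "\<And>p. p \<in> {0..S} \<times> UNIV \<Longrightarrow> utt p = uxx p + uyy p - 2 *\<^sub>R cross3 (ux p) (uy p)"
begin

text \<open>Twice the energy density without its cubic term. Unlike the full density it is
  nonnegative, as the weighted estimate requires.\<close>

definition "eden p = ut p \<bullet> ut p + ux p \<bullet> ux p + uy p \<bullet> uy p"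

lemma C1_eden: "C1_spacetime {0..S} eden (\<lambda>p. 2 * (ut p \<bullet> utt p + ux p \<bullet> utx p + uy p \<bullet> uty p))
    (\<lambda>p. 2 * (ut p \<bullet> utx p + ux p \<bullet> uxx p + uy p \<bullet> uxy p)) (\<lambda>p. 2 * (ut p \<bullet> uty p + ux p \<bullet> uxy p + uy p \<bullet> uyy p))"
  using C1_spacetime_add[OF C1_spacetime_add[OF C1_spacetime_inner[OF C1(2) C1(2)] C1_spacetime_inner[OF C1(3) C1(3)]] C1_spacetime_inner[OF C1(4) C1(4)]]
  unfolding eden_def[abs_def] by (simp add: inner_commute algebra_simps)

text \<open>One gradient factor is absorbed into the constant K, so the cubic contribution to the
  growth becomes linear in the quadratic energy density.\<close>

lemma nonlinearity_bound:
  assumes "norm x \<le> K"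
  shows "- 4 * (t \<bullet> cross3 x y) \<le> 4 * K * (t \<bullet> t + x \<bullet> x + y \<bullet> y)"
proof -
  have "\<bar>t \<bullet> cross3 x y\<bar> \<le> norm t * norm (cross3 x y)" by (rule Cauchy_Schwarz_ineq2)
  also have "norm (cross3 x y) \<le> norm x * norm y"
    by (rule norm_cross3_le)
  also have "norm t * (norm x * norm y) \<le> norm t * (K * norm y)"
    using assms by (intro mult_left_mono mult_right_mono) auto
  also have "norm t * (K * norm y) = K * (norm t * norm y)" by simp
  also have "K * (norm t * norm y) \<le> K * (t \<bullet> t + x \<bullet> x + y \<bullet> y)"
  proof (rule mult_left_mono)
    have "2 * (norm t * norm y) \<le> (norm t)\<^sup>2 + (norm y)\<^sup>2"
      using zero_le_power2[of "norm t - norm y"] by (simp add: power2_diff)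
    then show "norm t * norm y \<le> t \<bullet> t + x \<bullet> x + y \<bullet> y"
      using inner_ge_zero[of x] inner_ge_zero[of t] inner_ge_zero[of y] unfolding power2_norm_eq_inner by linarith
    show "0 \<le> K" using assms norm_ge_zero order_trans by blast
  qed
  finally have "\<bar>t \<bullet> cross3 x y\<bar> \<le> K * (t \<bullet> t + x \<bullet> x + y \<bullet> y)" by (simp add: mult_left_mono)
  then show ?thesis by linarith
qed

text \<open>Gronwall's inequality for the energy density weighted by the square of
  \<open>\<phi> = (R - s)\<^sup>2 - \<bar>z - z1\<bar>\<^sup>2\<close>, cut off at 0: the time derivative of the weight absorbs its gradient.\<close>

lemma finite_speed_point:
  assumes n: "n > 0" "vanishes_beyond n (\<lambda>z. u (0, z))" "vanishes_beyond n (\<lambda>z. ut (0, z))"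
    and s1: "0 < s1" "s1 \<le> S" "n + s1 < norm (z1 :: real \<times> real)"
  shows "u (s1, z1) = 0"
proof -
  \<comment> \<open>R is the distance from z1 to the disc that carries the data. It exceeds
    \<open>s1\<close>, so the backward cone with vertex (R, z1) contains (s1, z1); M is large enough
    for all slices of the cone.\<close>
  define R where "R = norm z1 - n"
  define M where "M = norm z1 + R"
  have R: "s1 < R" "M > 0" "norm z1 \<le> M" using s1 n by (auto simp: R_def M_def)
  have sub: "{0..s1} \<subseteq> {0..S}" using s1 by auto
  define \<phi> where "\<phi> p = (R - fst p)\<^sup>2 - ((fst (snd p) - fst z1)\<^sup>2 + (snd (snd p) - snd z1)\<^sup>2)" for p :: "real \<times> real \<times> real"
  define w where "w p = pospow 2 (\<phi> p)" for p
  define W where "W p = pospow 1 (\<phi> p)" for p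
  have W: "W p \<ge> 0" "w p = (W p)\<^sup>2" for p by (auto simp: W_def w_def pospow_def)
  have C\<phi>: "C1_spacetime {0..s1} \<phi> (\<lambda>p. - 2 * (R - fst p)) (\<lambda>p. - 2 * (fst (snd p) - fst z1)) (\<lambda>p. - 2 * (snd (snd p) - snd z1))"
    unfolding C1_spacetime_def \<phi>_def
    by (auto intro!: derivative_eq_intros continuous_intros simp: fun_eq_iff algebra_simps)
  have dp: "(pospow 2 has_real_derivative 2 * pospow 1 s) (at s)" for s
    using DERIV_pospow[of 0 s] by (simp add: numeral_2_eq_2)
  have Cw: "C1_spacetime {0..s1} w (\<lambda>p. 2 * W p * (- 2 * (R - fst p))) (\<lambda>p. 2 * W p * (- 2 * (fst (snd p) - fst z1)))
      (\<lambda>p. 2 * W p * (- 2 * (snd (snd p) - snd z1)))"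
    using C1_spacetime_compose_real[OF C\<phi> dp] unfolding w_def[abs_def] W_def[abs_def]
    by (simp add: continuous_intros)
  note C = C1[THEN C1_spacetime_subset[OF _ sub]]
  \<comment> \<open>\<open>Cf\<close> is the weighted density, \<open>CP\<close> and
    \<open>CQ\<close> are the weighted components of the energy flux.\<close>
  note Cf = C1_spacetime_mult[OF Cw C1_spacetime_subset[OF C1_eden sub]]
  note CP = C1_spacetime_mult[OF Cw C1_spacetime_inner[OF C(3) C(2)]]
  note CQ = C1_spacetime_mult[OF Cw C1_spacetime_inner[OF C(4) C(2)]]
  define I where "I s = integral (square M) (\<lambda>z. w (s, z) * eden (s, z))" for s
  define ft Px Qy where
    "ft p = w p * (2 * (ut p \<bullet> utt p + ux p \<bullet> utx p + uy p \<bullet> uty p)) + 2 * W p * (- 2 * (R - fst p)) * eden p"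
    and "Px p = w p * (ux p \<bullet> utx p + uxx p \<bullet> ut p) + 2 * W p * (- 2 * (fst (snd p) - fst z1)) * (ux p \<bullet> ut p)"
    and "Qy p = w p * (uy p \<bullet> uty p + uyy p \<bullet> ut p) + 2 * W p * (- 2 * (snd (snd p) - snd z1)) * (uy p \<bullet> ut p)" for p
  note Cf = Cf[folded ft_def] and CP = CP[folded Px_def] and CQ = CQ[folded Qy_def]
  have dz: "(norm (z - z1))\<^sup>2 = (fst z - fst z1)\<^sup>2 + (snd z - snd z1)\<^sup>2" for z
    by (simp add: norm_prod_def)
  have w0: "w (s, z) = 0" if "M \<le> norm z" "s \<in> {0..s1}" for s z
  proof -
    have "R - s \<le> norm (z - z1)" using that norm_triangle_ineq2[of z z1] by (auto simp: M_def)
    then have "(R - s)\<^sup>2 \<le> (norm (z - z1))\<^sup>2" using R(1) that by (intro power_mono) auto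
    then show ?thesis by (simp add: w_def pospow_neg \<phi>_def dz)
  qed
  have "compact ({0..s1} \<times> square M)" by (intro compact_Times compact_Icc compact_cbox)
  then have "compact (ux ` ({0..s1} \<times> square M))"
    by (rule compact_continuous_image[rotated]) (use C1_spacetimeD(2)[OF C(3)] in \<open>auto intro: continuous_on_subset\<close>)
  then have "bounded (ux ` ({0..s1} \<times> square M))" by (rule compact_imp_bounded)
  then obtain K where "\<forall>x\<in>ux ` ({0..s1} \<times> square M). norm x \<le> K" unfolding bounded_iff by (rule exE)
  then have K: "norm (ux p) \<le> K" if "p \<in> {0..s1} \<times> square M" for p using that by blast
  have zero: "I s = 0" if "s \<in> {0..s1}" for s
  proof (rule gronwall_zero[OF _ _ _ _ that])
    fix s assume s: "s \<in> {0..s1}"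
    show "(I has_real_derivative integral (square M) (\<lambda>z. ft (s, z))) (at s within {0..s1})"
      unfolding I_def[abs_def] by (rule has_real_derivative_integral_square[OF Cf s])
    have Pv: "vanishes_beyond M (\<lambda>z. w (s, z) * (ux (s, z) \<bullet> ut (s, z)))" "vanishes_beyond M (\<lambda>z. w (s, z) * (uy (s, z) \<bullet> ut (s, z)))"
      using w0 s by (auto simp: vanishes_beyond_def)
    note pP = C1_spacetime_plane[OF CP s] and pQ = C1_spacetime_plane[OF CQ s]
    have div0: "integral (square M) (\<lambda>z. Px (s, z)) = 0" "integral (square M) (\<lambda>z. Qy (s, z)) = 0"
      using integral_partial_derivative_eq_0(1)[OF pP Pv(1) R(2)] integral_partial_derivative_eq_0(2)[OF pQ Pv(2) R(2)] by auto
    have cts: "continuous_on (square M) (\<lambda>z. ft (s, z))" "continuous_on (square M) (\<lambda>z. w (s, z) * eden (s, z))"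
      "continuous_on (square M) (\<lambda>z. Px (s, z))" "continuous_on (square M) (\<lambda>z. Qy (s, z))"
    proof -
      have "continuous_on (square M) (\<lambda>z. g (s, z))" if "continuous_on ({0..s1} \<times> UNIV) g" for g :: "_ \<Rightarrow> real"
        by (rule continuous_on_compose2[OF that]) (use s in \<open>auto intro!: continuous_intros\<close>)
      then show "continuous_on (square M) (\<lambda>z. ft (s, z))" using C1_spacetimeD(3)[OF Cf] by blast
      show "continuous_on (square M) (\<lambda>z. w (s, z) * eden (s, z))"
        by (rule C1_planeD(2)[OF C1_spacetime_plane[OF Cf s]])
      show "continuous_on (square M) (\<lambda>z. Px (s, z))" "continuous_on (square M) (\<lambda>z. Qy (s, z))"
        by (rule C1_planeD(3)[OF pP], rule C1_planeD(4)[OF pQ])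
    qed
    \<comment> \<open>Subtracting twice the divergence of the flux does not change the integral, and
      by the equation it removes all second derivatives.\<close>
    have "integral (square M) (\<lambda>z. ft (s, z)) = integral (square M) (\<lambda>z. ft (s, z) - 2 * Px (s, z) - 2 * Qy (s, z))"
      using div0 cts by (simp add: Henstock_Kurzweil_Integration.integral_diff integrable_diff integrable_continuous continuous_intros)
    also have "\<dots> \<le> integral (square M) (\<lambda>z. 4 * K * (w (s, z) * eden (s, z)))"
    proof (rule integral_le)
      fix z assume z: "z \<in> square M"
      let ?p = "(s, z)"
      define \<alpha> \<beta> where "\<alpha> = fst z - fst z1" and "\<beta> = snd z - snd z1"
      have p: "?p \<in> {0..S} \<times> UNIV" using s sub by auto
      \<comment> \<open>Inside the cone this is \<open>cone_inequality\<close> with \<rho> = R - s;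
        outside, the weight W is 0.\<close>
      have "W ?p * (2 * \<alpha> * (ux ?p \<bullet> ut ?p) + 2 * \<beta> * (uy ?p \<bullet> ut ?p)) \<le> W ?p * ((R - s) * eden ?p)"
      proof (cases "\<phi> ?p > 0")
        case True
        then have "\<alpha>\<^sup>2 + \<beta>\<^sup>2 \<le> (R - s)\<^sup>2" by (simp add: \<phi>_def \<alpha>_def \<beta>_def)
        moreover have "R - s > 0" using s R(1) by auto
        ultimately show ?thesis unfolding eden_def using W(1) by (intro mult_left_mono cone_inequality) auto
      next
        case False
        then have "W ?p = 0" by (simp add: W_def pospow_neg)
        then show ?thesis by simp
      qed
      moreover have "ft ?p - 2 * Px ?p - 2 * Qy ?p = w ?p * (- 4 * (ut ?p \<bullet> cross3 (ux ?p) (uy ?p)))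
          + 4 * (W ?p * (2 * \<alpha> * (ux ?p \<bullet> ut ?p) + 2 * \<beta> * (uy ?p \<bullet> ut ?p)) - W ?p * ((R - s) * eden ?p))"
        unfolding ft_def Px_def Qy_def \<alpha>_def \<beta>_def eq[OF p]
        by (simp add: inner_simps inner_commute[of "ut ?p"] algebra_simps)
      moreover have "w ?p * (- 4 * (ut ?p \<bullet> cross3 (ux ?p) (uy ?p))) \<le> w ?p * (4 * K * eden ?p)"
        unfolding eden_def by (intro mult_left_mono nonlinearity_bound K) (use s z W in auto)
      ultimately show "ft ?p - 2 * Px ?p - 2 * Qy ?p \<le> 4 * K * (w ?p * eden ?p)" by (simp add: mult_ac)
    qed (use cts in \<open>auto intro!: integrable_continuous continuous_intros\<close>)
    also have "\<dots> = 4 * K * I s" by (simp add: I_def)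
    finally show "integral (square M) (\<lambda>z. ft (s, z)) \<le> 4 * K * I s" .
    show "0 \<le> I s" unfolding I_def
      by (rule integral_nonneg) (use cts in \<open>auto intro!: integrable_continuous simp: W(2) eden_def\<close>)
  next
    have pl: "vanishes_beyond n (\<lambda>z. ux (0, z))" "vanishes_beyond n (\<lambda>z. uy (0, z))"
      using C1_plane_vanishes[OF C1_spacetime_plane[OF C1(1), of 0] n(2,1)] S by auto
    \<comment> \<open>Where the data may be nonzero, the distance to z1 is at least R, so the weight
      is 0.\<close>
    have "w (0, z) * eden (0, z) = 0" for z
    proof (cases "n \<le> norm z")
      case True
      then show ?thesis
        using vanishes_beyondD[OF pl(1) True] vanishes_beyondD[OF pl(2) True] vanishes_beyondD[OF n(3) True] by (simp add: eden_def)
    next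
      case False
      then have "R \<le> norm (z - z1)" using norm_triangle_ineq3[of z z1] by (simp add: R_def)
      then have "R\<^sup>2 \<le> (norm (z - z1))\<^sup>2" using R(1) s1(1) by (intro power_mono) auto
      then show ?thesis by (simp add: w_def pospow_neg \<phi>_def dz)
    qed
    then have "(\<lambda>z. w (0, z) * eden (0, z)) = (\<lambda>z. 0)" by (rule ext)
    then show "I 0 = 0" unfolding I_def by (simp only: integral_0)
  qed
  \<comment> \<open>The weight is positive along the segment over z1 because R > s1. A continuous
    nonnegative function with integral 0 vanishes, hence \<open>eden\<close> is 0 there, and u at z1
    keeps its initial value.\<close>
  have ut0: "ut (s, z1) = 0" if s: "s \<in> {0..s1}" for s
  proof -
    have c: "continuous_on (square M) (\<lambda>z. w (s, z) * eden (s, z))"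
      by (rule C1_planeD(2)[OF C1_spacetime_plane[OF Cf s]])
    have "((\<lambda>z. w (s, z) * eden (s, z)) has_integral 0) (square M)"
      using zero[OF s] integrable_integral[OF integrable_continuous[OF c]] by (simp add: I_def)
    from has_integral_0_cbox_imp_0[OF c _ this] have "w (s, z1) * eden (s, z1) = 0"
      using R norm_le_imp_square by (auto simp: W(2) eden_def box_ne_empty Basis_prod_def)
    moreover have "w (s, z1) > 0" using s R(1) by (simp add: w_def \<phi>_def pospow_def)
    ultimately have "eden (s, z1) = 0" by simp
    then show ?thesis
      using inner_ge_zero[of "ut (s, z1)"] inner_ge_zero[of "ux (s, z1)"] inner_ge_zero[of "uy (s, z1)"]
      unfolding eden_def by (metis add_nonneg_eq_0_iff add_nonneg_nonneg inner_eq_zero_iff)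
  qed
  have "\<exists>c. \<forall>s\<in>{0..s1}. u (s, z1) = c"
  proof (rule has_vector_derivative_zero_constant)
    show "((\<lambda>s. u (s, z1)) has_vector_derivative 0) (at s within {0..s1})" if "s \<in> {0..s1}" for s
      using C1_spacetime_time[OF C(1) that, of z1] ut0[OF that] by simp
  qed auto
  then have "u (s1, z1) = u (0, z1)" using s1(1) by auto
  also have "\<dots> = 0" using vanishes_beyondD[OF n(2), of z1] s1 by simp
  finally show ?thesis .
qed

lemma finite_speed:
  assumes n: "n > 0" "vanishes_beyond n (\<lambda>z. u (0, z))" "vanishes_beyond n (\<lambda>z. ut (0, z))" and s: "s \<in> {0..S}"
  shows "vanishes_beyond (n + s) (\<lambda>z. u (s, z))"
proof (cases "s = 0")
  case False
  show ?thesis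
  proof (rule vanishes_beyond_closure)
    show "continuous_on UNIV (\<lambda>z. u (s, z))" by (rule C1_planeD(2)[OF C1_spacetime_plane[OF C1(1) s]])
  qed (use finite_speed_point[OF n] s False n in auto)
qed (use n in simp)

end

subsection \<open>Energy and virial identities\<close>

lemma C1_spacetime_zero_time_derivative:
  assumes f: "C1_spacetime {a..b} f ft fx fy" and ab: "a < b" and z: "\<And>s. s \<in> {a..b} \<Longrightarrow> f (s, z) = 0" and s: "s \<in> {a..b}"
  shows "ft (s, z) = 0"
proof -
  have "((\<lambda>s. 0) has_vector_derivative ft (s, z)) (at s within {a..b})"
    by (rule has_vector_derivative_transform[OF s _ C1_spacetime_time[OF f s, of z]]) (use z in auto)
  then show ?thesis
    using vector_derivative_unique_within_closed_interval[OF ab, of s "\<lambda>s. 0" 0 "ft (s, z)"] s by auto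
qed

definition L2_norm_sq :: "(real \<times> real \<times> real \<Rightarrow> real^3) \<Rightarrow> real \<Rightarrow> real" where
  "L2_norm_sq v s = integral UNIV (\<lambda>z. v (s, z) \<bullet> v (s, z))"

lemma integral_nonneg_pointwise:
  fixes f :: "'a::euclidean_space \<Rightarrow> real"
  assumes "\<And>x. 0 \<le> f x"
  shows "0 \<le> integral A f"
  using assms by (cases "f integrable_on A") (auto simp: Henstock_Kurzweil_Integration.integral_nonneg not_integrable_integral)

lemma quadratic_nonneg_imp:
  fixes a b c :: real
  assumes "\<And>l. 0 \<le> a - 2 * l * b + l\<^sup>2 * c" "0 \<le> c"
  shows "b\<^sup>2 \<le> a * c"
proof (cases "c = 0")
  case True
  have "b = 0"
  proof (rule ccontr)
    assume "b \<noteq> 0"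
    \<comment> \<open>For c = 0 the quadratic is affine in l, and this l gives it the value
      -1.\<close>
    then show False using assms(1)[of "(a + 1) / (2 * b)"] True by simp
  qed
  then show ?thesis using True by simp
next
  case False
  then have "c > 0" using assms(2) by simp
  then show ?thesis using assms(1)[of "b / c"] by (simp add: field_simps power2_eq_square)
qed

context wave_strip
begin

definition "energy_density p = 1/2 * eden p + 2/3 * (u p \<bullet> cross3 (ux p) (uy p))"
definition "total_energy s = integral UNIV (\<lambda>z. energy_density (s, z))"
definition "dirichlet s = L2_norm_sq ux s + L2_norm_sq uy s"

context
  fixes M :: real
  assumes M: "M > 0" and supp: "\<And>s. s \<in> {0..S} \<Longrightarrow> vanishes_beyond M (\<lambda>z. u (s, z))"
begin

text \<open>For \<open>ut\<close> it matters that M is common to all times: at a fixed z beyond M, u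
  is 0 throughout the time interval.\<close>

lemma vanish:
  assumes "s \<in> {0..S}" "M \<le> norm z"
  shows "u (s, z) = 0" "ut (s, z) = 0" "ux (s, z) = 0" "uy (s, z) = 0"
proof -
  show u0: "u (s, z) = 0" by (rule vanishes_beyondD[OF supp[OF assms(1)] assms(2)])
  show "ut (s, z) = 0"
    by (rule C1_spacetime_zero_time_derivative[OF C1(1) S _ assms(1)]) (rule vanishes_beyondD[OF supp assms(2)])
  note v = C1_plane_vanishes[OF C1_spacetime_plane[OF C1(1) assms(1)] supp[OF assms(1)] M]
  show "ux (s, z) = 0" "uy (s, z) = 0"
    using vanishes_beyondD[OF v(1) assms(2)] vanishes_beyondD[OF v(2) assms(2)] by auto
qed

lemma to_square: "integral UNIV f = integral (square M) f" if "\<And>z. M \<le> norm z \<Longrightarrow> f z = 0" for f :: "real \<times> real \<Rightarrow> real"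
  by (rule integral_UNIV_eq_square) (use that in \<open>simp add: vanishes_beyond_def\<close>)

lemma L2_norm_sq_square: "L2_norm_sq v s = integral (square M) (\<lambda>z. v (s, z) \<bullet> v (s, z))" if "\<And>z. M \<le> norm z \<Longrightarrow> v (s, z) = 0" for v s
  unfolding L2_norm_sq_def by (rule to_square) (use that in simp)

lemma has_derivative_integral_UNIV:
  fixes f :: "real \<times> real \<times> real \<Rightarrow> real"
  assumes f: "C1_spacetime {0..S} f ft fx fy" and 0: "\<And>s z. s \<in> {0..S} \<Longrightarrow> M \<le> norm z \<Longrightarrow> f (s, z) = 0" and s: "s \<in> {0..S}"
  shows "((\<lambda>s. integral UNIV (\<lambda>z. f (s, z))) has_real_derivative integral (square M) (\<lambda>z. ft (s, z))) (at s within {0..S})"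
  using has_real_derivative_integral_square[OF f s, of M] unfolding has_real_derivative_iff_has_vector_derivative
  by (rule has_vector_derivative_transform[OF s, rotated]) (use to_square 0 in auto)

lemma slice_integrable: "(\<lambda>z. f (s, z)) integrable_on square M"
  if "continuous_on ({0..S} \<times> UNIV) f" "s \<in> {0..S}" for f :: "real \<times> real \<times> real \<Rightarrow> real"
  by (rule integrable_continuous, rule continuous_on_compose2[OF that(1)]) (use that(2) in \<open>auto intro!: continuous_intros\<close>)

lemma integral_divergence_eq_0:
  fixes f g :: "real \<times> real \<times> real \<Rightarrow> real"
  assumes f: "C1_spacetime {0..S} f ft fx fy" and g: "C1_spacetime {0..S} g gt gx gy"
    and 0: "\<And>z. M \<le> norm z \<Longrightarrow> f (s, z) = 0" "\<And>z. M \<le> norm z \<Longrightarrow> g (s, z) = 0" and s: "s \<in> {0..S}"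
  shows "integral (square M) (\<lambda>z. fx (s, z) + gy (s, z)) = 0"
  using integral_partial_derivative_eq_0(1)[OF C1_spacetime_plane[OF f s] _ M] integral_partial_derivative_eq_0(2)[OF C1_spacetime_plane[OF g s] _ M] 0
  by (subst Henstock_Kurzweil_Integration.integral_add)
    (auto intro!: slice_integrable[OF C1_spacetimeD(4)[OF f] s] slice_integrable[OF C1_spacetimeD(5)[OF g] s] simp: vanishes_beyond_def)

lemmas C1_density = C1_spacetime_add[OF C1_spacetime_cmult[OF C1_eden, of "1/2"]
    C1_spacetime_cmult[OF C1_spacetime_inner[OF C1(1) C1_spacetime_cross3[OF C1(3,4)]], of "2/3"]]

text \<open>The time derivative of the density is the divergence of the flux with components ut
  \<bullet> ux + 2/3 u \<bullet> (ut \<times> uy) and ut \<bullet> uy + 2/3 u \<bullet> (ux \<times>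
  ut). The terms with \<open>uxy\<close> cancel by antisymmetry, and three equal triple products
  explain the factor 2/3 against the 2 of the equation.\<close>

lemma energy_conserved:
  assumes "s \<in> {0..S}"
  shows "total_energy s = total_energy 0"
proof -
  note F1 = C1_spacetime_add[OF C1_spacetime_inner[OF C1(2,3)] C1_spacetime_cmult[OF C1_spacetime_inner[OF C1(1) C1_spacetime_cross3[OF C1(2,4)]], of "2/3"]]
  note F2 = C1_spacetime_add[OF C1_spacetime_inner[OF C1(2,4)] C1_spacetime_cmult[OF C1_spacetime_inner[OF C1(1) C1_spacetime_cross3[OF C1(3,2)]], of "2/3"]]
  have "(total_energy has_real_derivative 0) (at s within {0..S})" if s: "s \<in> {0..S}" for s
  proof -
    have "(total_energy has_real_derivative integral (square M)
        (\<lambda>z. let p = (s, z) in 1/2 * (2 * (ut p \<bullet> utt p + ux p \<bullet> utx p + uy p \<bullet> uty p))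
          + 2/3 * (u p \<bullet> (cross3 (ux p) (uty p) + cross3 (utx p) (uy p)) + ut p \<bullet> cross3 (ux p) (uy p)))) (at s within {0..S})"
      unfolding total_energy_def[abs_def] energy_density_def Let_def
      by (rule has_derivative_integral_UNIV[OF C1_density _ s]) (use vanish in \<open>auto simp: eden_def\<close>)
    also have "(\<lambda>z. let p = (s, z) in 1/2 * (2 * (ut p \<bullet> utt p + ux p \<bullet> utx p + uy p \<bullet> uty p))
          + 2/3 * (u p \<bullet> (cross3 (ux p) (uty p) + cross3 (utx p) (uy p)) + ut p \<bullet> cross3 (ux p) (uy p)))
      = (\<lambda>z. let p = (s, z) in (ut p \<bullet> uxx p + utx p \<bullet> ux p + 2/3 * (u p \<bullet> (cross3 (ut p) (uxy p) + cross3 (utx p) (uy p)) + ux p \<bullet> cross3 (ut p) (uy p)))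
         + (ut p \<bullet> uyy p + uty p \<bullet> uy p + 2/3 * (u p \<bullet> (cross3 (ux p) (uty p) + cross3 (uxy p) (ut p)) + uy p \<bullet> cross3 (ux p) (ut p))))"
    proof (rule ext)
      fix z :: "real \<times> real"
      have "(s, z) \<in> {0..S} \<times> UNIV" using s by simp
      note e = eq[OF this]
      show "(let p = (s, z) in 1/2 * (2 * (ut p \<bullet> utt p + ux p \<bullet> utx p + uy p \<bullet> uty p))
          + 2/3 * (u p \<bullet> (cross3 (ux p) (uty p) + cross3 (utx p) (uy p)) + ut p \<bullet> cross3 (ux p) (uy p)))
        = (let p = (s, z) in (ut p \<bullet> uxx p + utx p \<bullet> ux p + 2/3 * (u p \<bullet> (cross3 (ut p) (uxy p) + cross3 (utx p) (uy p)) + ux p \<bullet> cross3 (ut p) (uy p)))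
         + (ut p \<bullet> uyy p + uty p \<bullet> uy p + 2/3 * (u p \<bullet> (cross3 (ux p) (uty p) + cross3 (uxy p) (ut p)) + uy p \<bullet> cross3 (ux p) (ut p))))"
        unfolding Let_def e
        by (simp add: inner_vec_def sum_3 cross3_def algebra_simps)
    qed
    also have "integral (square M) \<dots> = 0"
      unfolding Let_def
      by (rule integral_divergence_eq_0[OF F1 F2 _ _ s]) (use vanish[OF s] in auto)
    finally show ?thesis .
  qed
  then have "\<exists>c. \<forall>s\<in>{0..S}. total_energy s = c"
    by (intro has_field_derivative_zero_constant) auto
  then show ?thesis using assms S by auto
qed

lemma energy_splits:
  assumes s: "s \<in> {0..S}"
  shows "total_energy s = 1/2 * (L2_norm_sq ut s + dirichlet s) + 2/3 * integral (square M) (\<lambda>z. u (s, z) \<bullet> cross3 (ux (s, z)) (uy (s, z)))"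
proof -
  note c = C1_spacetimeD(2)[OF C1_spacetime_inner[OF C1(2,2)]] C1_spacetimeD(2)[OF C1_spacetime_inner[OF C1(3,3)]]
    C1_spacetimeD(2)[OF C1_spacetime_inner[OF C1(4,4)]] C1_spacetimeD(2)[OF C1_spacetime_inner[OF C1(1) C1_spacetime_cross3[OF C1(3,4)]]]
  note i = c[THEN slice_integrable, OF s]
  have "total_energy s = integral (square M) (\<lambda>z. energy_density (s, z))"
    unfolding total_energy_def by (rule to_square) (use vanish[OF s] in \<open>simp add: energy_density_def eden_def\<close>)
  then show ?thesis
    using i by (simp add: energy_density_def eden_def dirichlet_def L2_norm_sq_square vanish[OF s]
        Henstock_Kurzweil_Integration.integral_add integrable_add integrable_on_cmult_left)
qed

lemma dirichlet_square:
  assumes s: "s \<in> {0..S}"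
  shows "dirichlet s = integral (square M) (\<lambda>z. (norm (ux (s, z)))\<^sup>2 + (norm (uy (s, z)))\<^sup>2)"
proof -
  note c = C1_spacetimeD(2)[OF C1_spacetime_inner[OF C1(3,3)]] C1_spacetimeD(2)[OF C1_spacetime_inner[OF C1(4,4)]]
  show ?thesis
    using c[THEN slice_integrable, OF s]
    by (simp add: dirichlet_def L2_norm_sq_square vanish[OF s] power2_norm_eq_inner Henstock_Kurzweil_Integration.integral_add)
qed

lemma dirichlet_above_threshold:
  assumes E: "total_energy 0 < 4 * pi / 3" and G: "dirichlet 0 > 8 * pi" and s: "s \<in> {0..S}"
  shows "dirichlet s > 8 * pi"
proof (rule ccontr)
  assume neg: "\<not> ?thesis"
  have "continuous_on {0..S} dirichlet"
  proof (rule DERIV_continuous_on)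
    fix s assume s: "s \<in> {0..S}"
    show "(dirichlet has_real_derivative integral (square M) (\<lambda>z. ux (s, z) \<bullet> utx (s, z) + utx (s, z) \<bullet> ux (s, z))
        + integral (square M) (\<lambda>z. uy (s, z) \<bullet> uty (s, z) + uty (s, z) \<bullet> uy (s, z))) (at s within {0..S})"
      unfolding dirichlet_def[abs_def] L2_norm_sq_def
      by (intro DERIV_add has_derivative_integral_UNIV[OF C1_spacetime_inner[OF C1(3,3)] _ s]
          has_derivative_integral_UNIV[OF C1_spacetime_inner[OF C1(4,4)] _ s]) (use vanish in auto)
  qed
  then have "continuous_on {0..s} dirichlet" by (rule continuous_on_subset) (use s in auto)
  \<comment> \<open>A first failure of the bound would force the value 8 pi exactly, at which the
    isoperimetric bound is |V| \<le> 4 pi.\<close>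
  then obtain r where r: "0 \<le> r" "r \<le> s" "dirichlet r = 8 * pi"
    using IVT2'[of dirichlet s "8 * pi" 0] G s neg by auto
  then have rS: "r \<in> {0..S}" using s by auto
  note pl = C1_spacetime_plane[OF C1(1) rS] C1_spacetime_plane[OF C1(3) rS] C1_spacetime_plane[OF C1(4) rS]
  have "\<bar>integral (square M) (\<lambda>z. u (r, z) \<bullet> cross3 (ux (r, z)) (uy (r, z)))\<bar> \<le> sqrt ((8 * pi) ^ 3 / (32 * pi))"
    using isoperimetric_inequality[OF pl supp[OF rS] M] r(3) dirichlet_square[OF rS] by simp
  also have "(8 * pi) ^ 3 / (32 * pi) = (4 * pi)\<^sup>2" by (simp add: power2_eq_square power3_eq_cube)
  finally have "\<bar>integral (square M) (\<lambda>z. u (r, z) \<bullet> cross3 (ux (r, z)) (uy (r, z)))\<bar> \<le> 4 * pi"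
    unfolding real_sqrt_abs by simp
  from abs_le_D2[OF this]
  have "- integral (square M) (\<lambda>z. u (r, z) \<bullet> cross3 (ux (r, z)) (uy (r, z))) \<le> 4 * pi" .
  moreover have "L2_norm_sq ut r \<ge> 0"
    unfolding L2_norm_sq_def by (rule integral_nonneg_pointwise) simp
  \<comment> \<open>With p = pi: half of 8 pi minus two thirds of 4 pi is 4 pi/3, and the kinetic
    part only adds to it.\<close>
  moreover have "4 * p / 3 \<le> e" if "- v \<le> 4 * p" "0 \<le> a" "e = 1/2 * (a + 8 * p) + 2/3 * v" for a v e p :: real
    using that by argo
  ultimately have "total_energy r \<ge> 4 * pi / 3" using energy_splits[OF rS] unfolding r(3) by blast
  then show False using energy_conserved[OF rS] E by simp
qed

lemma first_variation:
  assumes s: "s \<in> {0..S}"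
  shows "(L2_norm_sq u has_real_derivative integral UNIV (\<lambda>z. 2 * (u (s, z) \<bullet> ut (s, z)))) (at s within {0..S})"
proof -
  have "integral UNIV (\<lambda>z. 2 * (u (s, z) \<bullet> ut (s, z))) = integral (square M) (\<lambda>z. u (s, z) \<bullet> ut (s, z) + ut (s, z) \<bullet> u (s, z))"
    by (subst to_square) (use vanish[OF s] in \<open>auto simp: inner_commute\<close>)
  then show ?thesis
    unfolding L2_norm_sq_def[abs_def]
    using has_derivative_integral_UNIV[OF C1_spacetime_inner[OF C1(1,1)] _ s] vanish by simp
qed

text \<open>By the equation and integration by parts y'' = 2A - 2G - 4V; the conserved energy gives
  4V = 6E - 3A - 3G. The multiple 6 of E is thus chosen to eliminate V, which has no sign.\<close>

lemma second_variation:
  assumes s: "s \<in> {0..S}"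
  shows "((\<lambda>s. integral UNIV (\<lambda>z. 2 * (u (s, z) \<bullet> ut (s, z)))) has_real_derivative
     5 * L2_norm_sq ut s + dirichlet s - 6 * total_energy s) (at s within {0..S})"
proof -
  note CX = C1_spacetime_inner[OF C1(1,3)] and CY = C1_spacetime_inner[OF C1(1,4)]
  note CU = C1_spacetime_cmult[OF C1_spacetime_inner[OF C1(1,2)], of 2]
  have "integral (square M) (\<lambda>z. 2 * (u (s, z) \<bullet> utt (s, z) + ut (s, z) \<bullet> ut (s, z)))
    = integral (square M) (\<lambda>z. 5 * (ut (s, z) \<bullet> ut (s, z)) + (ux (s, z) \<bullet> ux (s, z) + uy (s, z) \<bullet> uy (s, z)) - 6 * energy_density (s, z)
        + 2 * ((u (s, z) \<bullet> uxx (s, z) + ux (s, z) \<bullet> ux (s, z)) + (u (s, z) \<bullet> uyy (s, z) + uy (s, z) \<bullet> uy (s, z))))"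
  proof (rule integral_cong)
    fix z :: "real \<times> real"
    have "(s, z) \<in> {0..S} \<times> UNIV" using s by simp
    note e = eq[OF this]
    show "2 * (u (s, z) \<bullet> utt (s, z) + ut (s, z) \<bullet> ut (s, z)) = 5 * (ut (s, z) \<bullet> ut (s, z)) + (ux (s, z) \<bullet> ux (s, z) + uy (s, z) \<bullet> uy (s, z)) - 6 * energy_density (s, z)
        + 2 * ((u (s, z) \<bullet> uxx (s, z) + ux (s, z) \<bullet> ux (s, z)) + (u (s, z) \<bullet> uyy (s, z) + uy (s, z) \<bullet> uy (s, z)))"
      unfolding e by (simp add: energy_density_def eden_def inner_simps algebra_simps)
  qed
  also have "\<dots> = 5 * L2_norm_sq ut s + dirichlet s - 6 * total_energy s"
  proof -
    note i = C1_spacetimeD(2)[OF C1_spacetime_inner[OF C1(2,2)], THEN slice_integrable, OF s]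
      C1_spacetimeD(2)[OF C1_spacetime_inner[OF C1(3,3)], THEN slice_integrable, OF s]
      C1_spacetimeD(2)[OF C1_spacetime_inner[OF C1(4,4)], THEN slice_integrable, OF s]
      C1_spacetimeD(2)[OF C1_density[folded energy_density_def], THEN slice_integrable, OF s]
      C1_spacetimeD(4)[OF CX, THEN slice_integrable, OF s] C1_spacetimeD(5)[OF CY, THEN slice_integrable, OF s]
    have d: "integral (square M) (\<lambda>z. (u (s, z) \<bullet> uxx (s, z) + ux (s, z) \<bullet> ux (s, z)) + (u (s, z) \<bullet> uyy (s, z) + uy (s, z) \<bullet> uy (s, z))) = 0"
      by (rule integral_divergence_eq_0[OF CX CY _ _ s]) (use vanish[OF s] in auto)
    have E: "total_energy s = integral (square M) (\<lambda>z. energy_density (s, z))"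
      unfolding total_energy_def by (rule to_square) (use vanish[OF s] in \<open>simp add: energy_density_def eden_def\<close>)
    have D: "dirichlet s = integral (square M) (\<lambda>z. ux (s, z) \<bullet> ux (s, z) + uy (s, z) \<bullet> uy (s, z))"
      using i by (simp add: dirichlet_def L2_norm_sq_square vanish[OF s] Henstock_Kurzweil_Integration.integral_add)
    have A: "L2_norm_sq ut s = integral (square M) (\<lambda>z. ut (s, z) \<bullet> ut (s, z))"
      by (rule L2_norm_sq_square) (use vanish[OF s] in simp)
    have lin: "integral (square M) (\<lambda>z. 5 * a z + b z - 6 * c z + 2 * e z)
        = 5 * integral (square M) a + integral (square M) b - 6 * integral (square M) c + 2 * integral (square M) e"
      if "a integrable_on square M" "b integrable_on square M" "c integrable_on square M" "e integrable_on square M" for a b c e :: "real \<times> real \<Rightarrow> real"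
      using that by (simp add: Henstock_Kurzweil_Integration.integral_add Henstock_Kurzweil_Integration.integral_diff
          integrable_add integrable_diff integrable_on_cmult_left)
    show ?thesis
      unfolding E D A lin[OF i(1) integrable_add[OF i(2,3)] i(4) integrable_add[OF i(5,6)]] d by simp
  qed
  finally show ?thesis
    using has_derivative_integral_UNIV[OF CU _ s] vanish by simp
qed

text \<open>Cauchy-Schwarz, from the discriminant of the nonnegative quadratic l -> ||u - l ut||^2;
  the factor 4 is the square of the 2 in the first variation.\<close>

lemma first_variation_bound:
  assumes s: "s \<in> {0..S}"
  shows "(integral UNIV (\<lambda>z. 2 * (u (s, z) \<bullet> ut (s, z))))\<^sup>2 \<le> 4 * L2_norm_sq u s * L2_norm_sq ut s"
proof -
  note i = C1_spacetimeD(2)[OF C1_spacetime_inner[OF C1(1,1)], THEN slice_integrable, OF s]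
    C1_spacetimeD(2)[OF C1_spacetime_inner[OF C1(1,2)], THEN slice_integrable, OF s]
    C1_spacetimeD(2)[OF C1_spacetime_inner[OF C1(2,2)], THEN slice_integrable, OF s]
  let ?I = "\<lambda>f. integral (square M) f"
  have "0 \<le> L2_norm_sq u s - 2 * l * ?I (\<lambda>z. u (s, z) \<bullet> ut (s, z)) + l\<^sup>2 * L2_norm_sq ut s" for l
  proof -
    have "0 \<le> ?I (\<lambda>z. (u (s, z) - l *\<^sub>R ut (s, z)) \<bullet> (u (s, z) - l *\<^sub>R ut (s, z)))"
      by (rule integral_nonneg_pointwise) simp
    also have "(\<lambda>z. (u (s, z) - l *\<^sub>R ut (s, z)) \<bullet> (u (s, z) - l *\<^sub>R ut (s, z)))
        = (\<lambda>z. u (s, z) \<bullet> u (s, z) - 2 * l * (u (s, z) \<bullet> ut (s, z)) + l\<^sup>2 * (ut (s, z) \<bullet> ut (s, z)))"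
      by (simp add: fun_eq_iff inner_simps inner_commute power2_eq_square algebra_simps)
    also have "?I \<dots> = ?I (\<lambda>z. u (s, z) \<bullet> u (s, z)) - 2 * l * ?I (\<lambda>z. u (s, z) \<bullet> ut (s, z)) + l\<^sup>2 * ?I (\<lambda>z. ut (s, z) \<bullet> ut (s, z))"
    proof -
      have "?I (\<lambda>z. a z - 2 * l * b z + l\<^sup>2 * c z) = ?I a - 2 * l * ?I b + l\<^sup>2 * ?I c"
        if "a integrable_on square M" "b integrable_on square M" "c integrable_on square M" for a b c :: "real \<times> real \<Rightarrow> real"
        using that by (simp add: Henstock_Kurzweil_Integration.integral_add Henstock_Kurzweil_Integration.integral_diff
            integrable_diff integrable_on_mult_right)
      from this[OF i] show ?thesis .
    qed
    finally show ?thesis by (simp add: L2_norm_sq_square vanish[OF s])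
  qed
  moreover have "0 \<le> L2_norm_sq ut s" unfolding L2_norm_sq_def by (rule integral_nonneg_pointwise) simp
  ultimately have "(?I (\<lambda>z. u (s, z) \<bullet> ut (s, z)))\<^sup>2 \<le> L2_norm_sq u s * L2_norm_sq ut s"
    by (rule quadratic_nonneg_imp)
  moreover have "integral UNIV (\<lambda>z. 2 * (u (s, z) \<bullet> ut (s, z))) = 2 * ?I (\<lambda>z. u (s, z) \<bullet> ut (s, z))"
    by (subst to_square) (use vanish[OF s] in auto)
  ultimately show ?thesis by (simp add: power_mult_distrib)
qed

end

end

subsection \<open>Blow-up\<close>

text \<open>The inequalities give y y'' \<ge> 5/4 y'^2, which is concavity of y^(-1/4) wherever y >
  0. Beyond \<open>s1\<close> this power lies below its tangent at \<open>s1\<close>, a line of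
  negative slope, and so could not stay positive.\<close>

lemma no_global_concave_power:
  fixes y y1 y2 A :: "real \<Rightarrow> real"
  assumes \<delta>: "\<delta> > 0"
    and d1: "\<And>s. s > 0 \<Longrightarrow> (y has_real_derivative y1 s) (at s)"
    and d2: "\<And>s. s > 0 \<Longrightarrow> (y1 has_real_derivative y2 s) (at s)"
    and y2: "\<And>s. s > 0 \<Longrightarrow> 5 * A s + \<delta> \<le> y2 s"
    and cs: "\<And>s. s > 0 \<Longrightarrow> (y1 s)\<^sup>2 \<le> 4 * y s * A s"
    and nonneg: "\<And>s. 0 \<le> y s" "\<And>s. 0 \<le> A s"
  shows False
proof -
  \<comment> \<open>Since y'' \<ge> \<delta>, the slope of y is at least 1 after this time, whatever
    its value at time 1.\<close>
  define s1 where "s1 = 1 + (\<bar>y1 1\<bar> + 1) / \<delta>"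
  have s1: "s1 \<ge> 1" using \<delta> by (simp add: s1_def)
  have y1: "y1 s \<ge> 1" if "s \<ge> s1" for s
  proof -
    have "y1 1 - \<delta> * 1 \<le> y1 s - \<delta> * s"
    proof (rule DERIV_nonneg_imp_nondecreasing[where f = "\<lambda>s. y1 s - \<delta> * s"])
      show "1 \<le> s" using that s1 by simp
      fix t assume t: "1 \<le> t" "t \<le> s"
      have "((\<lambda>s. y1 s - \<delta> * s) has_real_derivative y2 t - \<delta>) (at t)"
        by (rule derivative_eq_intros d2 refl | use t in simp)+
      moreover have "0 \<le> y2 t - \<delta>" using y2[of t] nonneg(2)[of t] t by simp
      ultimately show "\<exists>d. ((\<lambda>s. y1 s - \<delta> * s) has_real_derivative d) (at t) \<and> 0 \<le> d" by blast
    qed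
    moreover have "\<delta> * s1 \<le> \<delta> * s" using that \<delta> by simp
    moreover have "\<delta> * s1 = \<delta> + \<bar>y1 1\<bar> + 1" using \<delta> by (simp add: s1_def field_simps)
    ultimately show ?thesis by linarith
  qed
  \<comment> \<open>A zero of y would force y' = 0 by the Cauchy-Schwarz hypothesis.\<close>
  have y: "y s > 0" if "s \<ge> s1" for s
  proof (rule ccontr)
    assume "\<not> y s > 0"
    then have "y s = 0" using nonneg(1)[of s] by simp
    then have "(y1 s)\<^sup>2 \<le> 0" using cs[of s] that s1 by simp
    then show False using y1[OF that] by simp
  qed
  define z where "z s = y s powr (- 1/4)" for s
  define z' where "z' s = - 1/4 * y s powr (- 5/4) * y1 s" for s
  have dz: "(z has_real_derivative z' s) (at s)" if "s \<ge> s1" for s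
    using DERIV_fun_powr[OF d1 y[OF that], of "- 1/4"] that s1 by (simp add: z_def[abs_def] z'_def)
  have z'_mono: "z' s \<le> z' s1" if "s \<ge> s1" for s
  proof (rule DERIV_nonpos_imp_nonincreasing[where f = z', OF that])
    fix t assume t: "s1 \<le> t" "t \<le> s"
    then have t0: "t > 0" using s1 by simp
    have "((\<lambda>s. y s powr (- 5/4)) has_real_derivative - 5/4 * y t powr (- 9/4) * y1 t) (at t)"
      using DERIV_fun_powr[OF d1[OF t0] y[OF t(1)], of "- 5/4"] by simp
    from DERIV_cmult[OF DERIV_mult[OF this d2[OF t0]], of "- 1/4"]
    have "(z' has_real_derivative - 1/4 * (- 5/4 * y t powr (- 9/4) * y1 t * y1 t + y2 t * y t powr (- 5/4))) (at t)"
      by (simp add: z'_def[abs_def] mult_ac)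
    moreover have "y t powr (- 5/4) = y t powr (- 9/4) * y t"
      using y[OF t(1)] powr_add[of "y t" "- 9/4" 1] by simp
    then have "- 1/4 * (- 5/4 * y t powr (- 9/4) * y1 t * y1 t + y2 t * y t powr (- 5/4))
      = 1/4 * y t powr (- 9/4) * (5/4 * (y1 t)\<^sup>2 - y t * y2 t)"
      by (simp add: power2_eq_square algebra_simps)
    moreover have "5/4 * (y1 t)\<^sup>2 - y t * y2 t \<le> 0"
    proof -
      have "y t * (5 * A t) \<le> y t * y2 t" using y2[OF t0] \<delta> nonneg(1) by (intro mult_left_mono) auto
      then show ?thesis using cs[OF t0] by simp
    qed
    then have "1/4 * y t powr (- 9/4) * (5/4 * (y1 t)\<^sup>2 - y t * y2 t) \<le> 0"
      by (intro mult_nonneg_nonpos) auto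
    ultimately show "\<exists>d. (z' has_real_derivative d) (at t) \<and> d \<le> 0" by metis
  qed
  define \<kappa> where "\<kappa> = - z' s1"
  have \<kappa>: "\<kappa> > 0" using y[of s1] y1[of s1] by (simp add: \<kappa>_def z'_def)
  \<comment> \<open>The zero of the tangent to \<open>z\<close> at \<open>s1\<close>.\<close>
  define s where "s = s1 + z s1 / \<kappa>"
  have zpos: "z s > 0" if "s \<ge> s1" for s using y[OF that] by (simp add: z_def)
  have s: "s \<ge> s1" using zpos[of s1] \<kappa> by (simp add: s_def)
  have "z s + \<kappa> * s \<le> z s1 + \<kappa> * s1"
  proof (rule DERIV_nonpos_imp_nonincreasing[where f = "\<lambda>s. z s + \<kappa> * s", OF s])
    fix t assume t: "s1 \<le> t" "t \<le> s"
    have "((\<lambda>s. z s + \<kappa> * s) has_real_derivative z' t + \<kappa>) (at t)"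
      by (rule derivative_eq_intros dz refl | use t in simp)+
    then show "\<exists>d. ((\<lambda>s. z s + \<kappa> * s) has_real_derivative d) (at t) \<and> d \<le> 0"
      using z'_mono[OF t(1)] by (auto simp: \<kappa>_def)
  qed
  moreover have "\<kappa> * s = z s1 + \<kappa> * s1" using \<kappa> by (simp add: s_def field_simps)
  ultimately have "z s \<le> 0" by simp
  then show False using zpos[OF s] by simp
qed

text \<open>The supports at different times are not assumed to be uniformly bounded; by Baire's theorem
  they are on some time interval, and finite speed of propagation does the rest.\<close>

lemma uniform_support_on_interval:
  fixes u :: "real \<times> real \<times> real \<Rightarrow> real^3"
  assumes c: "continuous_on ({0..} \<times> UNIV) u" and b: "\<And>t. 0 \<le> t \<Longrightarrow> bounded {z. u (t, z) \<noteq> 0}"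
  obtains a b n where "0 < a" "a < b" "0 < n" "\<And>s. s \<in> {a..b} \<Longrightarrow> vanishes_beyond n (\<lambda>z. u (s, z))"
proof -
  \<comment> \<open>Closed sets of times with support radius at most n + 1; they cover the interval
    [1, 2], so one of them contains a subinterval.\<close>
  define F where "F n = {t\<in>{1..2}. vanishes_beyond (real (Suc n)) (\<lambda>z. u (t, z))}" for n
  have cl: "closed {t\<in>{1..2}. u (t, z) = 0}" for z
    by (rule continuous_closed_preimage_constant, rule continuous_on_compose2[OF c]) (auto intro!: continuous_intros)
  have "F n = {1..2} \<inter> (\<Inter>z\<in>{z. real (Suc n) \<le> norm z}. {t\<in>{1..2}. u (t, z) = 0})" for n
    unfolding F_def vanishes_beyond_def by blast
  then have clF: "closed (F n)" for n
    using cl by (auto intro!: closed_Int closed_INT)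
  \<comment> \<open>Baire in dual form: if all the relatively open complements were dense, so would
    be their intersection, which is empty.\<close>
  have "\<exists>n. \<not> {1..2} \<subseteq> closure ({1..2} - F n)"
  proof (rule ccontr)
    assume "\<not> ?thesis"
    then have dense: "{1..2} \<subseteq> closure ({1..2} - F n)" for n by blast
    have "{1..2} \<subseteq> closure (\<Inter>(range (\<lambda>n. {1..2} - F n)))"
    proof (rule Baire)
      fix T assume "T \<in> range (\<lambda>n. {1..2} - F n)"
      then obtain n where T: "T = {1..2} - F n" by blast
      then have "T = {1..2} \<inter> - F n" by blast
      then have "openin (top_of_set {1..2}) T" using clF[of n] by (auto simp: openin_open)
      then show "openin (top_of_set {1..2}) T \<and> {1..2} \<subseteq> closure T" using dense[of n] T by simp
    qed auto
    moreover have "\<Inter>(range (\<lambda>n. {1..2} - F n)) = {}"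
    proof -
      have "\<exists>n. t \<in> F n" if t: "t \<in> {1..2}" for t
      proof -
        obtain B where B: "\<forall>z\<in>{z. u (t, z) \<noteq> 0}. norm z \<le> B"
          using b[of t] t unfolding bounded_iff by auto
        obtain n where n: "B < real n" using reals_Archimedean2 by blast
        have "u (t, z) = 0" if "real (Suc n) \<le> norm z" for z
        proof (rule ccontr)
          assume "u (t, z) \<noteq> 0"
          then have "norm z \<le> B" using B by blast
          then show False using that n by simp
        qed
        then have "t \<in> F n" using t by (simp add: F_def vanishes_beyond_def)
        then show ?thesis ..
      qed
      then show ?thesis by blast
    qed
    ultimately have "{1..2::real} \<subseteq> closure {}" by (simp only:)
    then show False by simp
  qed
  then obtain n t where t: "t \<in> {1..2}" "t \<notin> closure ({1..2} - F n)" by blast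
  then obtain e where "e > 0" "\<forall>s\<in>{1..2} - F n. \<not> dist s t < e"
    unfolding closure_approachable by blast
  then have e: "e > 0" "\<And>s. dist s t < e \<Longrightarrow> s \<notin> {1..2} - F n" by blast+
  have "vanishes_beyond (real (Suc n)) (\<lambda>z. u (s, z))" if "s \<in> {max 1 (t - e/2)..min 2 (t + e/2)}" for s
  proof -
    have "dist s t < e" using that e(1) by (auto simp: dist_real_def abs_if)
    then show ?thesis using e(2)[of s] that by (auto simp: F_def)
  qed
  \<comment> \<open>Since t lies in [1, 2], cutting the interval around t off at 1 and 2 leaves it
    nondegenerate, even when t is an end point.\<close>
  then show ?thesis
    using that[of "max 1 (t - e/2)" "min 2 (t + e/2)" "real (Suc n)"] t(1) e(1) by auto
qed

section \<open>From the hypotheses of the theorem to wave strips\<close>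

lemma C1_spacetime_cong:
  assumes "C1_spacetime I f ft fx fy" "\<And>p. p \<in> I \<times> UNIV \<Longrightarrow> ft p = gt p \<and> fx p = gx p \<and> fy p = gy p"
  shows "C1_spacetime I f gt gx gy"
  using assms unfolding C1_spacetime_def by (simp cong: continuous_on_cong_simp)

lemma C1_spacetime_scaleR:
  assumes "C1_spacetime I f ft fx fy"
  shows "C1_spacetime I (\<lambda>p. k *\<^sub>R f p) (\<lambda>p. k *\<^sub>R ft p) (\<lambda>p. k *\<^sub>R fx p) (\<lambda>p. k *\<^sub>R fy p)"
proof -
  have "C1_spacetime I (\<lambda>p. k) (\<lambda>p. 0) (\<lambda>p. 0) (\<lambda>p. 0)" by (simp add: C1_spacetime_def)
  from bounded_bilinear.C1_spacetime[OF bounded_bilinear_scaleR this assms] show ?thesis by simp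
qed

text \<open>A reversal changes the sign of first time derivatives only;
  \<open>\<sigma> * \<sigma> = 1\<close> leaves the second one, and hence the equation,
  unchanged.\<close>

lemma wave_strip_affine_time:
  assumes C1: "C1_spacetime I u ut ux uy" "C1_spacetime I ut utt utx uty" "C1_spacetime I ux utx uxx uxy" "C1_spacetime I uy uty uxy uyy"
    and eq: "\<And>p. p \<in> I \<times> UNIV \<Longrightarrow> utt p = uxx p + uyy p - 2 *\<^sub>R cross3 (ux p) (uy p)"
    and \<sigma>: "\<sigma> * \<sigma> = 1" and S: "S > 0" "\<And>s. s \<in> {0..S} \<Longrightarrow> c + \<sigma> * s \<in> I"
  defines "h \<equiv> \<lambda>f p. f (c + \<sigma> * fst p, snd p)"
  shows "wave_strip S (h u) (\<lambda>p. \<sigma> *\<^sub>R h ut p) (h ux) (h uy) (h utt) (\<lambda>p. \<sigma> *\<^sub>R h utx p) (\<lambda>p. \<sigma> *\<^sub>R h uty p) (h uxx) (h uxy) (h uyy)"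
proof
  have a: "C1_spacetime {0..S} (\<lambda>p. f (c + \<sigma> * fst p, snd p)) (\<lambda>p. \<sigma> *\<^sub>R ft (c + \<sigma> * fst p, snd p))
      (\<lambda>p. fx (c + \<sigma> * fst p, snd p)) (\<lambda>p. fy (c + \<sigma> * fst p, snd p))"
    if "C1_spacetime I f ft fx fy" for f ft fx fy :: "real \<times> real \<times> real \<Rightarrow> real^3"
    by (rule C1_spacetime_affine_time[OF that S(2)])
  show "C1_spacetime {0..S} (\<lambda>p. \<sigma> *\<^sub>R h ut p) (h utt) (\<lambda>p. \<sigma> *\<^sub>R h utx p) (\<lambda>p. \<sigma> *\<^sub>R h uty p)"
    using C1_spacetime_scaleR[OF a[OF C1(2)], of \<sigma>] \<sigma> by (simp add: h_def)
  show "C1_spacetime {0..S} (h u) (\<lambda>p. \<sigma> *\<^sub>R h ut p) (h ux) (h uy)"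
    "C1_spacetime {0..S} (h ux) (\<lambda>p. \<sigma> *\<^sub>R h utx p) (h uxx) (h uxy)"
    "C1_spacetime {0..S} (h uy) (\<lambda>p. \<sigma> *\<^sub>R h uty p) (h uxy) (h uyy)"
    using a[OF C1(1)] a[OF C1(3)] a[OF C1(4)] by (simp_all add: h_def)
  show "h utt p = h uxx p + h uyy p - 2 *\<^sub>R cross3 (h ux p) (h uy p)" if "p \<in> {0..S} \<times> UNIV" for p
    unfolding h_def by (rule eq) (use that S(2) in auto)
qed (rule S)

lemma dx_dy_C1_plane:
  assumes "C1_plane f fx fy"
  shows "dx f = fx" "dy f = fy"
proof -
  show "dx f = fx"
    unfolding dx_def using C1_planeD(5)[OF assms, of "snd z" "fst z" UNIV for z] by (auto intro!: vector_derivative_at simp: fun_eq_iff)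
  show "dy f = fy"
    unfolding dy_def using C1_planeD(6)[OF assms, of "fst z" "snd z" UNIV for z] by (auto intro!: vector_derivative_at simp: fun_eq_iff)
qed

text \<open>If T were infinite, y = \<open>L2_norm_sq u\<close> and A = \<open>L2_norm_sq ut\<close>
  would be finite at all positive times because of the compact supports, and would meet the
  hypotheses of \<open>no_global_concave_power\<close>.\<close>

theorem theorem1p7:
  fixes u :: "real \<times> real \<times> real \<Rightarrow> real^3" and T :: ereal
  assumes T_pos: "T > 0"
    and smooth: "smooth_on {p. 0 \<le> fst p \<and> ereal (fst p) < T} u"
    and eq: "\<And>t x y. 0 < t \<Longrightarrow> ereal t < T \<Longrightarrow>
       - vector_derivative (\<lambda>s. vector_derivative (\<lambda>r. u (r, x, y)) (at s)) (at t)
       + dx (dx (\<lambda>z. u (t, z))) (x, y) + dy (dy (\<lambda>z. u (t, z))) (x, y)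
       = 2 *\<^sub>R cross3 (dx (\<lambda>z. u (t, z)) (x, y)) (dy (\<lambda>z. u (t, z)) (x, y))"
    and supp: "\<And>t. 0 \<le> t \<Longrightarrow> ereal t < T \<Longrightarrow> bounded {z. u (t, z) \<noteq> 0}"
    and en: "energy (\<lambda>z. u (0, z)) (\<lambda>z. vector_derivative (\<lambda>s. u (s, z)) (at 0 within {0..}))
             < 4 * pi / 3"
    and grad: "grad_L2 (\<lambda>z. u (0, z)) > sqrt (8 * pi)"
  shows "T < \<infinity>"
proof (rule ccontr)
  assume "\<not> T < \<infinity>"
  then have T: "ereal t < T" for t by simp
  have "{p :: real \<times> real \<times> real. 0 \<le> fst p \<and> ereal (fst p) < T} = {0..} \<times> UNIV" using T by auto
  then have sm: "smooth_on ({0..} \<times> UNIV) u" using smooth by simp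
  obtain ut ux uy where u: "C1_spacetime {0..} u ut ux uy" and sm1: "smooth_on ({0..} \<times> UNIV) ut" "smooth_on ({0..} \<times> UNIV) ux" "smooth_on ({0..} \<times> UNIV) uy"
    by (rule smooth_on_C1_spacetime[OF sm])
  obtain utt utx uty where ut: "C1_spacetime {0..} ut utt utx uty" by (rule smooth_on_C1_spacetime[OF sm1(1)])
  obtain uxt uxx uxy where ux': "C1_spacetime {0..} ux uxt uxx uxy" by (rule smooth_on_C1_spacetime[OF sm1(2)])
  obtain uyt uyx uyy where uy': "C1_spacetime {0..} uy uyt uyx uyy" by (rule smooth_on_C1_spacetime[OF sm1(3)])
  have mix: "uxt p = utx p" "uyt p = uty p" if "p \<in> {0..} \<times> UNIV" for p
  proof -
    \<comment> \<open>The added 1 gives a nondegenerate compact time interval around p, also when p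
      is at time 0.\<close>
    have sub: "{0..fst p + 1} \<subseteq> {0..}" by auto
    have p: "0 < fst p + 1" "p \<in> {0..fst p + 1} \<times> UNIV" using that by (cases p, auto)+
    note C = u[THEN C1_spacetime_subset, OF sub] ut[THEN C1_spacetime_subset, OF sub] ux'[THEN C1_spacetime_subset, OF sub] uy'[THEN C1_spacetime_subset, OF sub]
    show "uxt p = utx p" "uyt p = uty p"
      by (rule C1_spacetime_mixed_time[OF C p])+
  qed
  have mixxy: "uyx p = uxy p" if "p \<in> {0..} \<times> UNIV" for p
  proof -
    have "fst p \<in> {0..}" using that by auto
    note pl = C1_spacetime_plane[OF _ this]
    show ?thesis using C1_plane_mixed[OF pl[OF u] pl[OF ux'] pl[OF uy'], of "snd p"] by simp
  qed
  have ux: "C1_spacetime {0..} ux utx uxx uxy" and uy: "C1_spacetime {0..} uy uty uxy uyy"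
    using mix mixxy by (auto intro: C1_spacetime_cong[OF ux'] C1_spacetime_cong[OF uy'])
  have pl: "dx (\<lambda>z. u (t, z)) = (\<lambda>z. ux (t, z))" "dy (\<lambda>z. u (t, z)) = (\<lambda>z. uy (t, z))"
    "dx (\<lambda>z. ux (t, z)) = (\<lambda>z. uxx (t, z))" "dy (\<lambda>z. uy (t, z)) = (\<lambda>z. uyy (t, z))" if "t \<in> {0..}" for t
    using dx_dy_C1_plane[OF C1_spacetime_plane[OF u that]] dx_dy_C1_plane[OF C1_spacetime_plane[OF ux that]]
      dx_dy_C1_plane[OF C1_spacetime_plane[OF uy that]] by auto
  have at: "(at t within {0..}) = at t" if "t > 0" for t :: real
    using that by (intro at_within_interior) (simp add: interior_real_atLeast)
  have wave_pos: "utt p - (uxx p + uyy p - 2 *\<^sub>R cross3 (ux p) (uy p)) = 0" if p: "p \<in> {0<..} \<times> UNIV" for p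
  proof -
    obtain t x y where p: "p = (t, x, y)" and t: "t > 0" using p by auto
    have vd: "vector_derivative (\<lambda>r. u (r, x, y)) (at s) = ut (s, x, y)" if "s > 0" for s
      using C1_spacetime_time[OF u, of s "(x, y)"] that at[OF that] by (auto intro: vector_derivative_at)
    have "((\<lambda>s. ut (s, x, y)) has_vector_derivative utt (t, x, y)) (at t)"
      using C1_spacetime_time[OF ut, of t "(x, y)"] t at[OF t] by auto
    then have "((\<lambda>s. vector_derivative (\<lambda>r. u (r, x, y)) (at s)) has_vector_derivative utt (t, x, y)) (at t)"
      by (rule has_vector_derivative_transform_within_open[of _ _ _ "{0<..}"]) (use t vd in auto)
    then show ?thesis
      using eq[OF t T, of x y] t by (simp add: vector_derivative_at pl p algebra_simps)
  qed
  \<comment> \<open>The equation is assumed for positive times; continuity of the second derivatives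
    extends it to time 0, from where energy conservation starts.\<close>
  have wave: "utt p = uxx p + uyy p - 2 *\<^sub>R cross3 (ux p) (uy p)" if p: "p \<in> {0..} \<times> UNIV" for p
  proof -
    have cl: "closure ({0<..} \<times> (UNIV :: (real \<times> real) set)) = {0::real..} \<times> UNIV"
      by (simp add: closure_Times)
    have "continuous_on ({0..} \<times> UNIV) (\<lambda>p. utt p - (uxx p + uyy p - 2 *\<^sub>R cross3 (ux p) (uy p)))"
      by (intro continuous_on_diff continuous_on_add continuous_on_scaleR continuous_on_const
          bounded_bilinear.continuous_on[OF bounded_bilinear_cross3] C1_spacetimeD(3)[OF ut] C1_spacetimeD(4)[OF ux]
          C1_spacetimeD(5)[OF uy] C1_spacetimeD(4)[OF u] C1_spacetimeD(5)[OF u])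
    then have "utt p - (uxx p + uyy p - 2 *\<^sub>R cross3 (ux p) (uy p)) = 0"
      unfolding cl[symmetric]
    proof (rule continuous_constant_on_closure)
      show "p \<in> closure ({0<..} \<times> UNIV)" using p cl by simp
    qed (rule wave_pos)
    then show ?thesis by simp
  qed
  note affine = wave_strip_affine_time[OF u ut ux uy wave]
  obtain t0 t1 n where t0: "0 < t0" "t0 < t1" and n: "n > 0" "\<And>s. s \<in> {t0..t1} \<Longrightarrow> vanishes_beyond n (\<lambda>z. u (s, z))"
    using uniform_support_on_interval[OF C1_spacetimeD(2)[OF u] supp[OF _ T]] by metis
  have u_t0: "vanishes_beyond n (\<lambda>z. u (t0, z))" using n(2)[of t0] t0 by simp
  have sub: "{t0..t1} \<subseteq> {0..}" using t0 by auto
  \<comment> \<open>One time with compact support says nothing about \<open>ut\<close>; here u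
    vanishes outside a fixed disc on a whole interval starting at t0.\<close>
  have ut_t0: "vanishes_beyond n (\<lambda>z. ut (t0, z))"
    unfolding vanishes_beyond_def
  proof (intro allI impI)
    fix z :: "real \<times> real" assume z: "n \<le> norm z"
    show "ut (t0, z) = 0"
      by (rule C1_spacetime_zero_time_derivative[OF C1_spacetime_subset[OF u sub] t0(2)])
        (use vanishes_beyondD[OF n(2) z] t0 in auto)
  qed
  have supports: "vanishes_beyond (n + t0 + S) (\<lambda>z. u (s, z))" if "s \<in> {0..S}" for s S
  proof (cases "s \<le> t0")
    \<comment> \<open>Times before t0 are reached by propagating the support backwards, through the
      time-reversed solution.\<close>
    case True
    interpret w: wave_strip t0 "\<lambda>p. u (t0 + (-1) * fst p, snd p)" "\<lambda>p. (-1) *\<^sub>R ut (t0 + (-1) * fst p, snd p)"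
      "\<lambda>p. ux (t0 + (-1) * fst p, snd p)" "\<lambda>p. uy (t0 + (-1) * fst p, snd p)" "\<lambda>p. utt (t0 + (-1) * fst p, snd p)"
      "\<lambda>p. (-1) *\<^sub>R utx (t0 + (-1) * fst p, snd p)" "\<lambda>p. (-1) *\<^sub>R uty (t0 + (-1) * fst p, snd p)"
      "\<lambda>p. uxx (t0 + (-1) * fst p, snd p)" "\<lambda>p. uxy (t0 + (-1) * fst p, snd p)" "\<lambda>p. uyy (t0 + (-1) * fst p, snd p)"
      by (rule affine) (use t0 in auto)
    have "vanishes_beyond (n + (t0 - s)) (\<lambda>z. u (s, z))"
      using w.finite_speed[OF n(1), of "t0 - s"] u_t0 ut_t0 True that by (simp add: vanishes_beyond_def)
    then show ?thesis by (rule vanishes_beyond_mono) (use that in auto)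
  next
    \<comment> \<open>Times after t0 are reached by propagating forwards from t0.\<close>
    case False
    interpret w: wave_strip s "\<lambda>p. u (t0 + 1 * fst p, snd p)" "\<lambda>p. 1 *\<^sub>R ut (t0 + 1 * fst p, snd p)"
      "\<lambda>p. ux (t0 + 1 * fst p, snd p)" "\<lambda>p. uy (t0 + 1 * fst p, snd p)" "\<lambda>p. utt (t0 + 1 * fst p, snd p)"
      "\<lambda>p. 1 *\<^sub>R utx (t0 + 1 * fst p, snd p)" "\<lambda>p. 1 *\<^sub>R uty (t0 + 1 * fst p, snd p)"
      "\<lambda>p. uxx (t0 + 1 * fst p, snd p)" "\<lambda>p. uxy (t0 + 1 * fst p, snd p)" "\<lambda>p. uyy (t0 + 1 * fst p, snd p)"
      by (rule affine) (use t0 False in auto)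
    have "vanishes_beyond (n + (s - t0)) (\<lambda>z. u (s, z))"
      using w.finite_speed[OF n(1), of "s - t0"] u_t0 ut_t0 False t0 by (simp add: vanishes_beyond_def)
    then show ?thesis by (rule vanishes_beyond_mono) (use that t0 in auto)
  qed
  have strip: "wave_strip S u ut ux uy utt utx uty uxx uxy uyy" if "S > 0" for S
    using affine[where \<sigma> = 1 and c = 0 and S = S] that by simp
  have M: "n + t0 + S > 0" if "S > 0" for S using n(1) t0(1) that by simp
  define E where "E = wave_strip.total_energy u ut ux uy 0"
  define G where "G s = L2_norm_sq ux s + L2_norm_sq uy s" for s
  have E: "E < 4 * pi / 3"
  proof -
    have "vector_derivative (\<lambda>s. u (s, z)) (at 0 within {0..}) = ut (0, z)" for z
      by (rule vector_derivative_within[OF _ C1_spacetime_time[OF u]]) (auto simp: at_within_Ici_at_right)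
    then have "energy (\<lambda>z. u (0, z)) (\<lambda>z. vector_derivative (\<lambda>s. u (s, z)) (at 0 within {0..})) = E"
      unfolding energy_def E_def wave_strip.total_energy_def[OF strip[OF zero_less_one]]
        wave_strip.energy_density_def[OF strip[OF zero_less_one]] wave_strip.eden_def[OF strip[OF zero_less_one]]
      by (simp add: pl power2_norm_eq_inner)
    then show ?thesis using en by simp
  qed
  have G0: "G 0 > 8 * pi"
  proof -
    interpret w: wave_strip 1 u ut ux uy utt utx uty uxx uxy uyy by (rule strip) simp
    have v: "vanishes_beyond (n + t0 + 1) (\<lambda>z. (norm (ux (0, z)))\<^sup>2 + (norm (uy (0, z)))\<^sup>2)"
    proof -
      have m: "n + t0 + 1 > 0" by (rule M) simp
      have "ux (0, z) = 0" "uy (0, z) = 0" if "n + t0 + 1 \<le> norm z" for z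
        using w.vanish(3)[OF m supports _ that] w.vanish(4)[OF m supports _ that] by auto
      then show ?thesis unfolding vanishes_beyond_def by simp
    qed
    have "G 0 = integral UNIV (\<lambda>z. (norm (ux (0, z)))\<^sup>2 + (norm (uy (0, z)))\<^sup>2)"
      unfolding G_def w.dirichlet_def[symmetric] integral_UNIV_eq_square[OF v]
      by (rule w.dirichlet_square[OF M supports]) auto
    then have "grad_L2 (\<lambda>z. u (0, z)) = sqrt (G 0)" by (simp add: grad_L2_def pl)
    then show ?thesis using grad by simp
  qed
  show False
  proof (rule no_global_concave_power)
    \<comment> \<open>The lower bound G > 8 pi turns y'' = 5A + G - 6E into the form required, with
      this constant as \<delta>; its positivity is the hypothesis E < 4 pi/3.\<close>
    show "8 * pi - 6 * E > 0" using E by simp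
    fix s :: real assume s: "s > 0"
    \<comment> \<open>A strip that reaches beyond s makes s an interior time, so the derivatives
      there are two-sided.\<close>
    interpret w: wave_strip "s + 1" u ut ux uy utt utx uty uxx uxy uyy by (rule strip) (use s in simp)
    have M': "n + t0 + (s + 1) > 0" by (rule M) (use s in simp)
    have sI: "s \<in> {0..s + 1}" "0 \<in> {0..s + 1}" using s by auto
    have at: "at s within {0..s + 1} = at s" by (rule at_within_interior) (use s in simp)
    show "(L2_norm_sq u has_real_derivative integral UNIV (\<lambda>z. 2 * (u (s, z) \<bullet> ut (s, z)))) (at s)"
      using w.first_variation[OF M' supports sI(1)] unfolding at .
    have cons: "w.total_energy s = E"
      unfolding E_def by (rule w.energy_conserved[OF M' supports sI(1)])
    show "((\<lambda>s. integral UNIV (\<lambda>z. 2 * (u (s, z) \<bullet> ut (s, z)))) has_real_derivative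
       5 * L2_norm_sq ut s + G s - 6 * E) (at s)"
      using w.second_variation[OF M' supports sI(1)] unfolding at cons G_def w.dirichlet_def .
    have "G s > 8 * pi"
      using w.dirichlet_above_threshold[OF M' supports _ _ sI(1)] E G0 unfolding G_def w.dirichlet_def E_def by blast
    then show "5 * L2_norm_sq ut s + (8 * pi - 6 * E) \<le> 5 * L2_norm_sq ut s + G s - 6 * E" by simp
    show "(integral UNIV (\<lambda>z. 2 * (u (s, z) \<bullet> ut (s, z))))\<^sup>2 \<le> 4 * L2_norm_sq u s * L2_norm_sq ut s"
      by (rule w.first_variation_bound[OF M' supports sI(1)])
  qed (simp_all add: L2_norm_sq_def integral_nonneg_pointwise)
qed

end
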